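(* For any $m\ge 3$ and any nonzero homogeneous $f_o\in\mathbb C[\mathcal X]^{G'}$ of positive degree, the ideal $\langle f_o\rangle$ of $\mathbb C[\mathcal X]$ generated by $f_o$ is not a radical ideal.
   Context: All varieties are over $\mathbb C$. Let $\mathfrak v$ be a complex vector space of dimension $m$, $E=\operatorname{End}\mathfrak v$, $G=\operatorname{GL}(E)$, $G'=\operatorname{SL}(E)$, and $Q=S^m(E^* )$, the space of homogeneous polynomial functions of degree $m$ on $E$, on which $G$ acts by $(g\cdot q)(X)=q(g^{-1}X)$. Let $\det\in Q$ be the determinant function and $\mathcal X=\overline{G\cdot\det}$ the Zariski closure of its orbit in $Q$ (reduced). $\mathbb C[\mathcal X]$ is graded by degree as a quotient of the polynomial ring $\mathbb C[Q]$, and $\mathbb C[\mathcal X]^{G'}$ is the subring of $G'$-invariants. *)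

theory Defs
  imports "HOL-Analysis.Analysis" "HOL-Library.Function_Algebras" "HOL-Algebra.QuotRing"
begin

section \<open>Polynomial functions on a complex vector space\<close>

text \<open>
  A complex vector space is given as a subspace \<open>V\<close> of a type carrying an addition, together
  with a scalar multiplication \<open>scl\<close>.  Functions on \<open>V\<close> are made unique by being
  extensional, i.e. by taking the value \<^const>\<open>undefined\<close> outside \<open>V\<close>.
\<close>

definition linear_forms ::
    "(complex \<Rightarrow> 'a::ab_group_add \<Rightarrow> 'a) \<Rightarrow> 'a set \<Rightarrow> ('a \<Rightarrow> complex) set" where
  "linear_forms scl V =
     {\<phi>. (\<forall>x\<in>V. \<forall>y\<in>V. \<phi> (x + y) = \<phi> x + \<phi> y) \<and> (\<forall>c. \<forall>x\<in>V. \<phi> (scl c x) = c * \<phi> x)}"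

text \<open>\<open>S\<^sup>d(V\<^sup>*)\<close>: the span of the \<open>d\<close>-fold products of linear forms.\<close>

definition homogeneous_polys ::
    "(complex \<Rightarrow> 'a::ab_group_add \<Rightarrow> 'a) \<Rightarrow> 'a set \<Rightarrow> nat \<Rightarrow> ('a \<Rightarrow> complex) set" where
  "homogeneous_polys scl V d =
     {F \<in> extensional V. \<exists>(N::nat) (c :: nat \<Rightarrow> complex) (\<phi> :: nat \<Rightarrow> nat \<Rightarrow> 'a \<Rightarrow> complex).
        (\<forall>i<N. \<forall>j<d. \<phi> i j \<in> linear_forms scl V) \<and>
        (\<forall>x\<in>V. F x = (\<Sum>i<N. c i * (\<Prod>j<d. \<phi> i j x)))}"

definition polys ::
    "(complex \<Rightarrow> 'a::ab_group_add \<Rightarrow> 'a) \<Rightarrow> 'a set \<Rightarrow> ('a \<Rightarrow> complex) set" where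
  "polys scl V =
     {F. \<exists>(D::nat) (H :: nat \<Rightarrow> 'a \<Rightarrow> complex).
        (\<forall>d\<le>D. H d \<in> homogeneous_polys scl V d) \<and> F = restrict (\<lambda>x. \<Sum>d\<le>D. H d x) V}"

definition poly_ring ::
    "(complex \<Rightarrow> 'a::ab_group_add \<Rightarrow> 'a) \<Rightarrow> 'a set \<Rightarrow> ('a \<Rightarrow> complex) ring" where
  "poly_ring scl V =
     \<lparr>carrier = polys scl V,
      monoid.mult = (\<lambda>F H. restrict (\<lambda>x. F x * H x) V),
      one = restrict (\<lambda>x. 1) V,
      zero = restrict (\<lambda>x. 0) V,
      add = (\<lambda>F H. restrict (\<lambda>x. F x + H x) V)\<rparr>"

definition vanishing_ideal ::
    "(complex \<Rightarrow> 'a::ab_group_add \<Rightarrow> 'a) \<Rightarrow> 'a set \<Rightarrow> 'a set \<Rightarrow> ('a \<Rightarrow> complex) set" where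
  "vanishing_ideal scl V S = {F \<in> polys scl V. \<forall>x\<in>S. F x = 0}"

definition zariski_closure ::
    "(complex \<Rightarrow> 'a::ab_group_add \<Rightarrow> 'a) \<Rightarrow> 'a set \<Rightarrow> 'a set \<Rightarrow> 'a set" where
  "zariski_closure scl V S = {x \<in> V. \<forall>F \<in> vanishing_ideal scl V S. F x = 0}"

section \<open>The space \<open>Q = S\<^sup>m(E\<^sup>*)\<close> and the orbit closure of the determinant\<close>

text \<open>
  \<open>v\<close> is \<^typ>\<open>complex^'n\<close>, so \<open>m = CARD('n)\<close>, and \<open>E = End v\<close> is the space of matrices
  \<^typ>\<open>complex^'n^'n\<close>, with the following scalar multiplication.
\<close>

definition mat_scale :: "complex \<Rightarrow> complex^'n^'n \<Rightarrow> complex^'n^'n" where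
  "mat_scale c A = (\<chi> i j. c * A $ i $ j)"

definition fun_scale :: "complex \<Rightarrow> ('a \<Rightarrow> complex) \<Rightarrow> 'a \<Rightarrow> complex" where
  "fun_scale c q = (\<lambda>X. c * q X)"

definition Q_space :: "(complex^'n^'n \<Rightarrow> complex) set" where
  "Q_space = homogeneous_polys mat_scale UNIV CARD('n)"

definition GL_E :: "(complex^'n^'n \<Rightarrow> complex^'n^'n) set" where
  "GL_E = {g. Vector_Spaces.linear mat_scale mat_scale g \<and> bij g}"

text \<open>
  The determinant of an endomorphism of \<open>E\<close>, via its matrix in the basis of the matrix units,
  which is indexed by \<^typ>\<open>'n \<times> 'n\<close>.
\<close>

definition matrix_unit :: "'n \<times> 'n \<Rightarrow> complex^'n^'n" where
  "matrix_unit p = (\<chi> i j. if (i, j) = p then 1 else 0)"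

definition det_E :: "(complex^'n^'n \<Rightarrow> complex^'n^'n) \<Rightarrow> complex" where
  "det_E g = det (\<chi> p r. g (matrix_unit r) $ fst p $ snd p :: complex^('n \<times> 'n)^('n \<times> 'n))"

definition SL_E :: "(complex^'n^'n \<Rightarrow> complex^'n^'n) set" where
  "SL_E = {g \<in> GL_E. det_E g = 1}"

definition act_Q ::
    "(complex^'n^'n \<Rightarrow> complex^'n^'n) \<Rightarrow> (complex^'n^'n \<Rightarrow> complex) \<Rightarrow> complex^'n^'n \<Rightarrow> complex" where
  "act_Q g q = (\<lambda>X. q (inv_into UNIV g X))"

definition det_orbit :: "(complex^'n^'n \<Rightarrow> complex) set" where
  "det_orbit = (\<lambda>g. act_Q g det) ` GL_E"

definition det_orbit_closure :: "(complex^'n^'n \<Rightarrow> complex) set" where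
  "det_orbit_closure = zariski_closure fun_scale Q_space det_orbit"

section \<open>The coordinate ring of the orbit closure and its invariants\<close>

abbreviation CQ :: "((complex^'n^'n \<Rightarrow> complex) \<Rightarrow> complex) ring" where
  "CQ \<equiv> poly_ring fun_scale Q_space"

abbreviation IX :: "((complex^'n^'n \<Rightarrow> complex) \<Rightarrow> complex) set" where
  "IX \<equiv> vanishing_ideal fun_scale Q_space det_orbit_closure"

definition CX :: "((complex^'n^'n \<Rightarrow> complex) \<Rightarrow> complex) set ring" where
  "CX = CQ Quot IX"

definition CX_homogeneous :: "nat \<Rightarrow> ((complex^'n^'n \<Rightarrow> complex) \<Rightarrow> complex) set set" where
  "CX_homogeneous d = {IX +>\<^bsub>CQ\<^esub> F | F. F \<in> homogeneous_polys fun_scale Q_space d}"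

text \<open>
  \<open>(g \<cdot> F)(q) = F(inv g \<cdot> q)\<close>.  An element of \<open>CX\<close> is a coset of the ideal \<open>IX\<close>, which is stable under the
  group, and \<open>g\<close> sends this coset to its image.
\<close>

definition act_CQ ::
    "(complex^'n^'n \<Rightarrow> complex^'n^'n) \<Rightarrow> ((complex^'n^'n \<Rightarrow> complex) \<Rightarrow> complex)
       \<Rightarrow> (complex^'n^'n \<Rightarrow> complex) \<Rightarrow> complex" where
  "act_CQ g F = restrict (\<lambda>q. F (act_Q (inv_into UNIV g) q)) Q_space"

definition CX_invariants :: "((complex^'n^'n \<Rightarrow> complex) \<Rightarrow> complex) set set" where
  "CX_invariants = {f \<in> carrier CX. \<forall>g\<in>SL_E. act_CQ g ` f = f}"

definition ideal_radical :: "('a, 'b) ring_scheme \<Rightarrow> 'a set \<Rightarrow> 'a set" where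
  "ideal_radical R I = {a \<in> carrier R. \<exists>n::nat. n > 0 \<and> a [^]\<^bsub>R\<^esub> n \<in> I}"

definition radical_ideal :: "('a, 'b) ring_scheme \<Rightarrow> 'a set \<Rightarrow> bool" where
  "radical_ideal R I \<longleftrightarrow> ideal_radical R I = I"

end

theory Submission
  imports Defs
begin

text \<open>
  Let \<open>D = det g\<close> for \<open>g \<in> GL(E)\<close>, and restrict polynomials on \<open>Q\<close> to the forms \<open>q = det \<circ> g\<close>. The invariant
  \<open>f\<close> restricts to a multiple of \<open>D\<^sup>k\<close>, where \<open>d = k m\<close>, and Cayley's \<open>\<Omega>\<close>-process yields a semi-invariant \<open>G\<close>
  of weight \<open>k\<close> on all of \<open>Q\<close>. By symmetry the differential of \<open>G\<close> at \<open>q\<close> is a multiple of \<open>D\<^sup>k q\<^sup>*\<close>, where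
  \<open>q\<^sup>*\<close> is the dual determinant transported by \<open>g\<close>; its pole along \<open>D = 0\<close> forces \<open>k \<ge> m \<ge> 3\<close>.

  The Hessian determinant of \<open>q\<close> equals \<open>\<kappa> D\<^sup>2 q\<^sup>s\<close> with \<open>s = m (m - 2)\<close> and \<open>\<kappa> \<noteq> 0\<close>. Applying to it the
  differential operator \<open>(D\<^sup>k q\<^sup>*(\<partial>))\<^sup>s\<close>, whose coefficients are polynomials in \<open>q\<close>, removes the factor \<open>q\<^sup>s\<close>
  up to a nonzero constant. So some \<open>D\<^sup>r\<close> with \<open>r \<equiv> 2\<close> modulo \<open>k\<close> is the restriction of a polynomial \<open>H\<close>.
  For the least such \<open>r\<close>, the power \<open>H\<^sup>k\<close> is a multiple of \<open>f\<^sup>r\<close>, hence \<open>H\<close> lies in the radical of \<open>\<langle>f\<rangle>\<close>;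
  but \<open>H \<in> \<langle>f\<rangle>\<close> would make \<open>D\<close> to the power \<open>r - k\<close> a restriction too, against minimality or, if
  \<open>r < k\<close>, against its boundedness near \<open>0\<close>.
\<close>


section \<open>Polynomial functions\<close>

text \<open>Everything turns on the residue 2 of a weight modulo \<open>k\<close>. It enters because
  second derivatives form the matrix of a bilinear form, so that the Hessian determinant changes by
  the square of \<open>D\<close>. Since \<open>k \<ge> 3\<close> this residue is nonzero: a function
  \<open>D^r\<close> with \<open>r\<close> congruent to 2 is never constant, and division by
  \<open>f\<close> lowers \<open>r\<close> by \<open>k\<close> without changing the residue. The
  obstacle is that the Hessian determinant is a covariant and not a function of \<open>q\<close>
  alone. Its factor \<open>q^s\<close> is removed by differentiating along the dual form, but that
  form involves the inverse of \<open>g\<close> and becomes polynomial in \<open>q\<close> only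
  after multiplication by a power of \<open>D\<close>. The differential of a semi-invariant supplies
  such a multiple, with the power \<open>k\<close>, which does not disturb the residue. A
  differential needs directions that leave the orbit closure, whereas \<open>f\<close> is known only
  on it; this is why a multiple of \<open>f\<close> is first extended to all of
  \<open>Q\<close>.\<close>

definition forms ::
    "(complex \<Rightarrow> 'a::ab_group_add \<Rightarrow> 'a) \<Rightarrow> 'a set \<Rightarrow> nat \<Rightarrow> ('a \<Rightarrow> complex) set" where
  "forms scl V d =
     {F. \<exists>(N::nat) (c :: nat \<Rightarrow> complex) (\<phi> :: nat \<Rightarrow> nat \<Rightarrow> 'a \<Rightarrow> complex).
        (\<forall>i<N. \<forall>j<d. \<phi> i j \<in> linear_forms scl V) \<and>
        (\<forall>x\<in>V. F x = (\<Sum>i<N. c i * (\<Prod>j<d. \<phi> i j x)))}"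

lemma homogeneous_polys_iff: "F \<in> homogeneous_polys scl V d \<longleftrightarrow> F \<in> extensional V \<and> F \<in> forms scl V d"
  unfolding homogeneous_polys_def forms_def by blast

lemma formsI:
  assumes "finite I" "finite P" "card P = d"
    and lin: "\<And>i t. i \<in> I \<Longrightarrow> t \<in> P \<Longrightarrow> \<psi> i t \<in> linear_forms scl V"
    and F: "\<And>x. x \<in> V \<Longrightarrow> F x = (\<Sum>i\<in>I. c i * (\<Prod>t\<in>P. \<psi> i t x))"
  shows "F \<in> forms scl V d"
proof -
  obtain h where h: "bij_betw h {..<card I} I"
    using ex_bij_betw_nat_finite[OF \<open>finite I\<close>] by (auto simp: atLeast0LessThan)
  obtain g where g: "bij_betw g {..<d} P"
    using ex_bij_betw_nat_finite[OF \<open>finite P\<close>] assms(3) by (auto simp: atLeast0LessThan)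
  have "F x = (\<Sum>i<card I. c (h i) * (\<Prod>j<d. \<psi> (h i) (g j) x))" if "x \<in> V" for x
    unfolding F[OF that]
    by (subst sum.reindex_bij_betw[OF h, symmetric], subst prod.reindex_bij_betw[OF g, symmetric]) simp
  moreover have "\<forall>i<card I. \<forall>j<d. \<psi> (h i) (g j) \<in> linear_forms scl V"
    using h g lin by (auto simp: bij_betw_def)
  ultimately show ?thesis
    unfolding forms_def
    by (intro CollectI exI[of _ "card I"] exI[of _ "\<lambda>i. c (h i)"] exI[of _ "\<lambda>i j. \<psi> (h i) (g j)"]) simp
qed

lemma formsE:
  assumes "F \<in> forms scl V d" "finite P" "card P = d"
  obtains N :: nat and c \<psi> where
    "\<forall>i<N. \<forall>t\<in>P. \<psi> i t \<in> linear_forms scl V"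
    "\<forall>x\<in>V. F x = (\<Sum>i<N. c i * (\<Prod>t\<in>P. \<psi> i t x))"
proof -
  obtain N :: nat and c \<phi> where
    1: "\<forall>i<N. \<forall>j<d. \<phi> i j \<in> linear_forms scl V"
      "\<forall>x\<in>V. F x = (\<Sum>i<N. c i * (\<Prod>j<d. \<phi> i j x))"
    using assms(1) unfolding forms_def by blast
  obtain g where g: "bij_betw g P {..<d}"
    using ex_bij_betw_finite_nat[OF \<open>finite P\<close>] assms(3) by (auto simp: atLeast0LessThan)
  show ?thesis
  proof (rule that[of N "\<lambda>i t. \<phi> i (g t)" c])
    show "\<forall>i<N. \<forall>t\<in>P. \<phi> i (g t) \<in> linear_forms scl V"
      using 1 bij_betwE[OF g] by blast
    show "\<forall>x\<in>V. F x = (\<Sum>i<N. c i * (\<Prod>t\<in>P. \<phi> i (g t) x))"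
      using 1(2) prod.reindex_bij_betw[OF g, of "\<lambda>j. \<phi> _ j _"] by simp
  qed
qed

lemma forms_cong: "F \<in> forms scl V d \<Longrightarrow> (\<And>x. x \<in> V \<Longrightarrow> F x = G x) \<Longrightarrow> G \<in> forms scl V d"
  unfolding forms_def by simp

lemma restrict_forms: "F \<in> forms scl V d \<Longrightarrow> restrict F V \<in> homogeneous_polys scl V d"
  by (auto simp: homogeneous_polys_iff intro: forms_cong)

lemma forms_const: "(\<lambda>x. c) \<in> forms scl V 0"
  by (rule formsI[of "{()}" "{} :: unit set" _ "\<lambda>_ _ _. 0" _ _ _ "\<lambda>_. c"]) auto

lemma forms_zero: "(\<lambda>x. 0) \<in> forms scl V d"
  by (rule formsI[of "{} :: unit set" "{..<d}" _ "\<lambda>_ _ _. 0" _ _ _ "\<lambda>_. 0"]) auto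

lemma forms_linear: "\<phi> \<in> linear_forms scl V \<Longrightarrow> \<phi> \<in> forms scl V 1"
  by (rule formsI[of "{()}" "{()}" _ "\<lambda>_ _. \<phi>" _ _ _ "\<lambda>_. 1"]) auto

lemma forms_prod_linear:
  "finite P \<Longrightarrow> (\<And>t. t \<in> P \<Longrightarrow> \<psi> t \<in> linear_forms scl V) \<Longrightarrow>
    (\<lambda>x. \<Prod>t\<in>P. \<psi> t x) \<in> forms scl V (card P)"
  by (rule formsI[of "{()}" P _ "\<lambda>_. \<psi>" _ _ _ "\<lambda>_. 1"]) auto

lemma forms_mult:
  assumes "F \<in> forms scl V d" "G \<in> forms scl V e"
  shows "(\<lambda>x. F x * G x) \<in> forms scl V (d + e)"
proof -
  obtain N :: nat and c \<phi> where
    1: "\<forall>i<N. \<forall>j<d. \<phi> i j \<in> linear_forms scl V"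
      "\<forall>x\<in>V. F x = (\<Sum>i<N. c i * (\<Prod>j<d. \<phi> i j x))"
    using assms(1) unfolding forms_def by blast
  obtain N' :: nat and c' \<phi>' where
    2: "\<forall>i<N'. \<forall>j<e. \<phi>' i j \<in> linear_forms scl V"
      "\<forall>x\<in>V. G x = (\<Sum>i<N'. c' i * (\<Prod>j<e. \<phi>' i j x))"
    using assms(2) unfolding forms_def by blast
  show ?thesis
  proof (rule formsI[of "{..<N} \<times> {..<N'}" "{..<d} <+> {..<e}" _
      "\<lambda>(i, i') t. case t of Inl j \<Rightarrow> \<phi> i j | Inr j \<Rightarrow> \<phi>' i' j" _ _ _ "\<lambda>(i, i'). c i * c' i'"])
    show "F x * G x = (\<Sum>i\<in>{..<N} \<times> {..<N'}. (case i of (i, i') \<Rightarrow> c i * c' i') *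
        (\<Prod>t\<in>{..<d} <+> {..<e}. (case i of (i, i') \<Rightarrow> \<lambda>t. case t of Inl j \<Rightarrow> \<phi> i j | Inr j \<Rightarrow> \<phi>' i' j) t x))"
      if "x \<in> V" for x
      using 1(2) 2(2) that
      by (auto simp: sum_product sum.cartesian_product prod.Plus intro!: sum.cong)
  qed (use 1(1) 2(1) in \<open>auto simp: card_Plus\<close>)
qed

lemma forms_scale: "F \<in> forms scl V d \<Longrightarrow> (\<lambda>x. c * F x) \<in> forms scl V d"
  using forms_mult[OF forms_const[of c]] by auto

lemma forms_add:
  assumes "F \<in> forms scl V d" "G \<in> forms scl V d"
  shows "(\<lambda>x. F x + G x) \<in> forms scl V d"
proof -
  obtain N :: nat and c \<phi> where
    1: "\<forall>i<N. \<forall>j<d. \<phi> i j \<in> linear_forms scl V"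
      "\<forall>x\<in>V. F x = (\<Sum>i<N. c i * (\<Prod>j<d. \<phi> i j x))"
    using assms(1) unfolding forms_def by blast
  obtain N' :: nat and c' \<phi>' where
    2: "\<forall>i<N'. \<forall>j<d. \<phi>' i j \<in> linear_forms scl V"
      "\<forall>x\<in>V. G x = (\<Sum>i<N'. c' i * (\<Prod>j<d. \<phi>' i j x))"
    using assms(2) unfolding forms_def by blast
  show ?thesis
    by (rule formsI[of "{..<N} <+> {..<N'}" "{..<d}" _
      "case_sum \<phi> \<phi>'" _ _ _ "case_sum c c'"])
      (use 1 2 in \<open>auto simp: sum.Plus\<close>)
qed

lemma forms_sum: "(\<And>i. i \<in> I \<Longrightarrow> F i \<in> forms scl V d) \<Longrightarrow> (\<lambda>x. \<Sum>i\<in>I. F i x) \<in> forms scl V d"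
  by (induction I rule: infinite_finite_induct) (auto intro: forms_zero forms_add)

lemma forms_prod:
  "(\<And>i. i \<in> I \<Longrightarrow> F i \<in> forms scl V (d i)) \<Longrightarrow> (\<lambda>x. \<Prod>i\<in>I. F i x) \<in> forms scl V (\<Sum>i\<in>I. d i)"
  by (induction I rule: infinite_finite_induct) (auto intro: forms_const forms_mult)

section \<open>Sums of forms of different degrees\<close>

lemma polysI_forms:
  assumes "\<And>d. d \<le> D \<Longrightarrow> H d \<in> forms scl V d"
  shows "restrict (\<lambda>x. \<Sum>d\<le>D. H d x) V \<in> polys scl V"
  unfolding polys_def
  by (intro CollectI exI[of _ D] exI[of _ "\<lambda>d. restrict (H d) V"])
    (auto simp: fun_eq_iff intro!: restrict_forms assms)

lemma polysE_forms:
  assumes "F \<in> polys scl V"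
  obtains D H where "\<And>d. H d \<in> forms scl V d" "\<And>d. d > D \<Longrightarrow> H d = (\<lambda>x. 0)"
    "F = restrict (\<lambda>x. \<Sum>d\<le>D. H d x) V"
proof -
  obtain D H where 1: "\<forall>d\<le>D. H d \<in> homogeneous_polys scl V d"
    "F = restrict (\<lambda>x. \<Sum>d\<le>D. H d x) V"
    using assms unfolding polys_def by blast
  show ?thesis
    by (rule that[of "\<lambda>d. if d \<le> D then H d else (\<lambda>x. 0)" D])
      (use 1 in \<open>auto simp: homogeneous_polys_iff forms_zero\<close>)
qed

lemma polys_add:
  assumes "restrict F V \<in> polys scl V" "restrict G V \<in> polys scl V"
  shows "restrict (\<lambda>x. F x + G x) V \<in> polys scl V"
proof -
  obtain D H where 1: "\<And>d. H d \<in> forms scl V d" "\<And>d. d > D \<Longrightarrow> H d = (\<lambda>x. 0)"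
    "restrict F V = restrict (\<lambda>x. \<Sum>d\<le>D. H d x) V"
    by (rule polysE_forms[OF assms(1)], rule that)
  obtain D' H' where 2: "\<And>d. H' d \<in> forms scl V d" "\<And>d. d > D' \<Longrightarrow> H' d = (\<lambda>x. 0)"
    "restrict G V = restrict (\<lambda>x. \<Sum>d\<le>D'. H' d x) V"
    by (rule polysE_forms[OF assms(2)], rule that)
  let ?M = "max D D'"
  have "F x + G x = (\<Sum>d\<le>?M. H d x + H' d x)" if "x \<in> V" for x
  proof -
    have "F x = (\<Sum>d\<le>D. H d x)" "G x = (\<Sum>d\<le>D'. H' d x)"
      using that 1(3) 2(3) by (metis restrict_apply')+
    moreover have "(\<Sum>d\<le>D. H d x) = (\<Sum>d\<le>?M. H d x)" "(\<Sum>d\<le>D'. H' d x) = (\<Sum>d\<le>?M. H' d x)"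
      by (intro sum.mono_neutral_left; simp add: 1(2) 2(2))+
    ultimately show ?thesis by (simp add: sum.distrib)
  qed
  then have "restrict (\<lambda>x. F x + G x) V = restrict (\<lambda>x. \<Sum>d\<le>?M. H d x + H' d x) V"
    by (auto simp: restrict_def fun_eq_iff)
  then show ?thesis
    by (simp only: polysI_forms[OF forms_add[OF 1(1) 2(1)]])
qed

lemma forms_polys:
  assumes "F \<in> forms scl V d" shows "restrict F V \<in> polys scl V"
proof -
  have "restrict F V = restrict (\<lambda>x. \<Sum>e\<le>d. (if e = d then F else (\<lambda>x. 0)) x) V"
    by (auto simp: restrict_def fun_eq_iff if_distrib[of "\<lambda>f. f _"] cong: if_cong)
  moreover have "\<dots> \<in> polys scl V"
    by (rule polysI_forms) (auto simp: assms forms_zero)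
  ultimately show ?thesis by simp
qed

lemma polys_sum:
  "(\<And>i. i \<in> I \<Longrightarrow> restrict (F i) V \<in> polys scl V) \<Longrightarrow> restrict (\<lambda>x. \<Sum>i\<in>I. F i x) V \<in> polys scl V"
proof (induction I rule: infinite_finite_induct)
  case (insert i I)
  then show ?case by (simp add: polys_add del: restrict_apply)
qed (auto simp: forms_polys[OF forms_zero])

lemma polys_mult:
  assumes "restrict F V \<in> polys scl V" "restrict G V \<in> polys scl V"
  shows "restrict (\<lambda>x. F x * G x) V \<in> polys scl V"
proof -
  obtain D H where 1: "\<And>d. H d \<in> forms scl V d" "restrict F V = restrict (\<lambda>x. \<Sum>d\<le>D. H d x) V"
    by (rule polysE_forms[OF assms(1)], rule that)
  obtain D' H' where 2: "\<And>d. H' d \<in> forms scl V d" "restrict G V = restrict (\<lambda>x. \<Sum>d\<le>D'. H' d x) V"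
    by (rule polysE_forms[OF assms(2)], rule that)
  have "F x * G x = (\<Sum>d\<le>D. \<Sum>e\<le>D'. H d x * H' e x)" if "x \<in> V" for x
  proof -
    have "F x = (\<Sum>d\<le>D. H d x)" "G x = (\<Sum>d\<le>D'. H' d x)"
      using that 1(2) 2(2) by (metis restrict_apply')+
    then show ?thesis by (simp add: sum_product)
  qed
  then have "restrict (\<lambda>x. F x * G x) V = restrict (\<lambda>x. \<Sum>d\<le>D. \<Sum>e\<le>D'. H d x * H' e x) V"
    by (auto simp: restrict_def fun_eq_iff)
  then show ?thesis
    by (auto intro!: polys_sum forms_polys[OF forms_mult] 1 2)
qed

text \<open>An ungraded description by generators: polynomiality of determinants, contractions and
  derivatives follows from introduction rules, and derivatives are constructed by rule induction.
  Values off \<open>V\<close> are left free, so \<open>restrict\<close> is needed to return to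
  \<open>polys\<close>.\<close>

inductive polyfun :: "(complex \<Rightarrow> 'a::ab_group_add \<Rightarrow> 'a) \<Rightarrow> 'a set \<Rightarrow> ('a \<Rightarrow> complex) \<Rightarrow> bool"
  for scl V where
  const: "polyfun scl V (\<lambda>x. c)"
| linear: "\<phi> \<in> linear_forms scl V \<Longrightarrow> polyfun scl V \<phi>"
| add: "polyfun scl V F \<Longrightarrow> polyfun scl V G \<Longrightarrow> polyfun scl V (\<lambda>x. F x + G x)"
| mult: "polyfun scl V F \<Longrightarrow> polyfun scl V G \<Longrightarrow> polyfun scl V (\<lambda>x. F x * G x)"

lemma polyfun_sum: "(\<And>i. i \<in> I \<Longrightarrow> polyfun scl V (F i)) \<Longrightarrow> polyfun scl V (\<lambda>x. \<Sum>i\<in>I. F i x)"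
  by (induction I rule: infinite_finite_induct) (auto intro: polyfun.intros)

lemma polyfun_prod: "(\<And>i. i \<in> I \<Longrightarrow> polyfun scl V (F i)) \<Longrightarrow> polyfun scl V (\<lambda>x. \<Prod>i\<in>I. F i x)"
  by (induction I rule: infinite_finite_induct) (auto intro: polyfun.intros)

lemma polyfun_polys: "polyfun scl V F \<Longrightarrow> restrict F V \<in> polys scl V"
  by (induction rule: polyfun.induct)
    (simp_all add: polys_add polys_mult forms_polys[OF forms_const] forms_polys[OF forms_linear]
      del: restrict_apply)

lemma forms_polyfun:
  assumes "F \<in> forms scl V d"
  obtains G where "polyfun scl V G" "\<And>x. x \<in> V \<Longrightarrow> F x = G x"
proof -
  obtain N :: nat and c \<phi> where
    1: "\<forall>i<N. \<forall>j<d. \<phi> i j \<in> linear_forms scl V"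
      "\<forall>x\<in>V. F x = (\<Sum>i<N. c i * (\<Prod>j<d. \<phi> i j x))"
    using assms(1) unfolding forms_def by blast
  show ?thesis
  proof (rule that)
    show "polyfun scl V (\<lambda>x. \<Sum>i<N. c i * (\<Prod>j<d. \<phi> i j x))"
      using 1(1) by (intro polyfun_sum polyfun.mult polyfun.const polyfun_prod polyfun.linear) auto
  qed (use 1 in simp)
qed

lemma polys_polyfun:
  assumes "F \<in> polys scl V"
  obtains G where "polyfun scl V G" "F = restrict G V"
proof -
  obtain D H where 1: "\<And>d. H d \<in> forms scl V d" "F = restrict (\<lambda>x. \<Sum>d\<le>D. H d x) V"
    by (rule polysE_forms[OF assms(1)], rule that)
  have "\<exists>G. polyfun scl V G \<and> (\<forall>x\<in>V. H d x = G x)" for d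
    by (rule forms_polyfun[OF 1(1)[of d]]) blast
  then obtain H' where "\<And>d. polyfun scl V (H' d)" "\<And>d x. x \<in> V \<Longrightarrow> H d x = H' d x"
    by metis
  with 1 show ?thesis
    by (intro that[of "\<lambda>x. \<Sum>d\<le>D. H' d x"] polyfun_sum) (simp_all cong: restrict_cong)
qed

section \<open>The coordinate ring\<close>

lemma poly_ring_simps:
  "carrier (poly_ring scl V) = polys scl V"
  "F \<otimes>\<^bsub>poly_ring scl V\<^esub> G = restrict (\<lambda>x. F x * G x) V"
  "F \<oplus>\<^bsub>poly_ring scl V\<^esub> G = restrict (\<lambda>x. F x + G x) V"
  "\<one>\<^bsub>poly_ring scl V\<^esub> = restrict (\<lambda>x. 1) V"
  "\<zero>\<^bsub>poly_ring scl V\<^esub> = restrict (\<lambda>x. 0) V"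
  by (simp_all add: poly_ring_def)

lemma polys_ext: "F \<in> polys scl V \<Longrightarrow> restrict F V = F"
  by (auto simp: polys_def)

lemma polys_closed:
  assumes "F \<in> polys scl V" "G \<in> polys scl V"
  shows "restrict (\<lambda>x. F x + G x) V \<in> polys scl V" "restrict (\<lambda>x. F x * G x) V \<in> polys scl V"
    "restrict (\<lambda>x. c) V \<in> polys scl V"
  using assms polys_add[of F V scl G] polys_mult[of F V scl G] forms_polys[OF forms_const]
  by (auto simp: polys_ext)

lemma poly_ring_cring: "cring (poly_ring scl V)"
proof (rule cringI)
  show "abelian_group (poly_ring scl V)"
  proof (rule abelian_groupI; unfold poly_ring_simps)
    fix F assume F: "F \<in> polys scl V"
    have "restrict (\<lambda>x. - 1 * F x) V \<in> polys scl V"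
      by (rule polys_mult[OF forms_polys[OF forms_const]]) (subst polys_ext[OF F], rule F)
    moreover have "restrict (\<lambda>x. restrict (\<lambda>x. - 1 * F x) V x + F x) V = restrict (\<lambda>x. 0) V"
      by (auto simp: restrict_def fun_eq_iff)
    ultimately show "\<exists>G\<in>polys scl V. restrict (\<lambda>x. G x + F x) V = restrict (\<lambda>x. 0) V"
      by blast
    show "restrict (\<lambda>x. restrict (\<lambda>x. 0) V x + F x) V = F"
      by (subst polys_ext[OF F, symmetric]) (auto simp: restrict_def fun_eq_iff)
  next
    show "restrict (\<lambda>x. 0) V \<in> polys scl V"
      by (rule forms_polys[OF forms_const])
  next
    show "restrict (\<lambda>x. F x + G x) V = restrict (\<lambda>x. G x + F x) V" for F G :: "'a \<Rightarrow> complex"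
      by (rule restrict_ext) (rule add.commute)
    show "restrict (\<lambda>x. restrict (\<lambda>x. F x + G x) V x + H x) V =
        restrict (\<lambda>x. F x + restrict (\<lambda>x. G x + H x) V x) V" for F G H :: "'a \<Rightarrow> complex"
      by (rule restrict_ext) simp
  qed (simp_all add: polys_closed del: restrict_apply)
  show "comm_monoid (poly_ring scl V)"
  proof (rule comm_monoidI; unfold poly_ring_simps)
    fix F assume F: "F \<in> polys scl V"
    show "restrict (\<lambda>x. restrict (\<lambda>x. 1) V x * F x) V = F"
      by (subst polys_ext[OF F, symmetric]) (auto simp: restrict_def fun_eq_iff)
  next
    show "restrict (\<lambda>x. 1) V \<in> polys scl V"
      by (rule forms_polys[OF forms_const])
  next
    show "restrict (\<lambda>x. F x * G x) V = restrict (\<lambda>x. G x * F x) V" for F G :: "'a \<Rightarrow> complex"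
      by (rule restrict_ext) (rule mult.commute)
    show "restrict (\<lambda>x. restrict (\<lambda>x. F x * G x) V x * H x) V =
        restrict (\<lambda>x. F x * restrict (\<lambda>x. G x * H x) V x) V" for F G H :: "'a \<Rightarrow> complex"
      by (rule restrict_ext) simp
  qed (simp_all add: polys_closed del: restrict_apply)
qed (simp add: poly_ring_simps distrib_right cong: restrict_cong)

lemma vanishing_ideal_ideal:
  assumes "S \<subseteq> V"
  shows "ideal (vanishing_ideal scl V S) (poly_ring scl V)"
proof -
  interpret cring "poly_ring scl V" by (rule poly_ring_cring)
  have minus: "(\<ominus>\<^bsub>poly_ring scl V\<^esub> F) x = - F x" if "F \<in> polys scl V" "x \<in> V" for F x
  proof -
    have "(F \<oplus>\<^bsub>poly_ring scl V\<^esub> (\<ominus>\<^bsub>poly_ring scl V\<^esub> F)) x = 0"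
      using r_neg[of F] that by (simp add: poly_ring_simps)
    then show ?thesis using that
      by (simp add: poly_ring_simps add_eq_0_iff)
  qed
  show ?thesis
  proof (rule idealI)
    show "subgroup (vanishing_ideal scl V S) (add_monoid (poly_ring scl V))"
    proof (rule add.subgroupI)
      have "restrict (\<lambda>x. 0) V \<in> vanishing_ideal scl V S" if "S \<subseteq> V"
        using that forms_polys[OF forms_const[of 0 scl V]] by (auto simp: vanishing_ideal_def)
      then show "vanishing_ideal scl V S \<noteq> {}"
        using assms by blast
    next
      fix F assume F: "F \<in> vanishing_ideal scl V S"
      then show "\<ominus>\<^bsub>poly_ring scl V\<^esub> F \<in> vanishing_ideal scl V S"
        using a_inv_closed[of F] minus[of F] assms
        by (auto simp: vanishing_ideal_def poly_ring_simps a_inv_def subset_iff)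
    qed (use assms in \<open>auto simp: vanishing_ideal_def poly_ring_simps polys_closed subset_iff\<close>)
  qed (use assms in \<open>auto simp: vanishing_ideal_def poly_ring_simps polys_closed ring_axioms subset_iff\<close>)
qed

section \<open>Polarization\<close>

lemma linear_forms_add: "\<phi> \<in> linear_forms scl UNIV \<Longrightarrow> \<phi> (x + y) = \<phi> x + \<phi> y"
  and linear_forms_scale: "\<phi> \<in> linear_forms scl UNIV \<Longrightarrow> \<phi> (scl c x) = c * \<phi> x"
  by (auto simp: linear_forms_def)

lemma linear_forms_sum:
  assumes "\<phi> \<in> linear_forms scl UNIV"
  shows "\<phi> (\<Sum>i\<in>I. X i) = (\<Sum>i\<in>I. \<phi> (X i))"
proof -
  have "\<phi> 0 = 0"
    using linear_forms_add[OF assms, of 0 0] by simp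
  then show ?thesis
    by (induction I rule: infinite_finite_induct) (simp_all add: linear_forms_add[OF assms])
qed

text \<open>For a form of degree \<open>card P\<close> this is \<open>(card P)!\<close> times the
  associated symmetric multilinear form. As a signed sum of values of \<open>F\<close>, it involves
  no division and is visibly linear in \<open>F\<close>, which keeps everything built from it
  polynomial in the coefficients of a form.\<close>

definition polarize :: "'p set \<Rightarrow> ('a::comm_monoid_add \<Rightarrow> complex) \<Rightarrow> ('p \<Rightarrow> 'a) \<Rightarrow> complex" where
  "polarize P F X = (\<Sum>S\<in>Pow P. (-1) ^ card (P - S) * F (\<Sum>t\<in>S. X t))"

lemma polarize_sum: "polarize P (\<lambda>x. \<Sum>i\<in>I. c i * F i x) X = (\<Sum>i\<in>I. c i * polarize P (F i) X)"
  unfolding polarize_def sum_distrib_left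
  by (subst sum.swap) (simp add: sum_distrib_left mult.left_commute)

lemma sum_alternating_superset:
  assumes "finite P" "T \<subseteq> P"
  shows "(\<Sum>S\<in>Pow P. of_bool (T \<subseteq> S) * (-1) ^ card (P - S)) = (of_bool (T = P) :: complex)"
proof -
  \<comment> \<open>The value 0 on \<open>T\<close> kills the subsets that miss a point of
    \<open>T\<close>. After the sum over subsets is collected into a product, each point of
    \<open>P - T\<close> contributes the factor \<open>1 - 1\<close>.\<close>
  let ?g = "\<lambda>a. if a \<in> T then 0 else - 1 :: complex"
  have "(\<Sum>S\<in>Pow P. of_bool (T \<subseteq> S) * (-1) ^ card (P - S)) = (\<Sum>S\<in>Pow P. (\<Prod>a\<in>S. 1) * (\<Prod>a\<in>P - S. ?g a))"
  proof (rule sum.cong)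
    fix S assume S: "S \<in> Pow P"
    show "of_bool (T \<subseteq> S) * (-1) ^ card (P - S) = (\<Prod>a\<in>S. 1) * (\<Prod>a\<in>P - S. ?g a)"
    proof (cases "T \<subseteq> S")
      case True
      then have "(\<Prod>a\<in>P - S. ?g a) = (\<Prod>a\<in>P - S. - 1)"
        by (intro prod.cong) auto
      then show ?thesis using True by simp
    next
      case False
      then obtain a where "a \<in> T" "a \<notin> S" by blast
      then have "(\<Prod>a\<in>P - S. ?g a) = 0"
        using assms by (intro prod_zero) (auto intro!: bexI[of _ a])
      then show ?thesis using False by simp
    qed
  qed simp
  also have "\<dots> = (\<Prod>a\<in>P. 1 + ?g a)"
    using assms(1) by (rule prod_add[symmetric])
  also have "\<dots> = of_bool (T = P)"
  proof (cases "T = P")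
    case True
    then show ?thesis by (auto intro!: prod.neutral)
  next
    case False
    then show ?thesis using assms by auto
  qed
  finally show ?thesis .
qed

text \<open>This is Ryser's formula for the permanent.\<close>

lemma polarize_prod:
  assumes P: "finite P" and \<psi>: "\<And>t. t \<in> P \<Longrightarrow> \<psi> t \<in> linear_forms scl UNIV"
  shows "polarize P (\<lambda>x. \<Prod>t\<in>P. \<psi> t x) X = (\<Sum>\<pi> | \<pi> permutes P. \<Prod>t\<in>P. \<psi> (\<pi> t) (X t))"
proof -
  let ?g = "\<lambda>\<tau>. \<Prod>t\<in>P. \<psi> t (X (\<tau> t))"
  let ?Z = "P \<rightarrow>\<^sub>E P"
  have fin: "finite ?Z" using P by (simp add: finite_PiE)
  \<comment> \<open>Here \<open>\<tau>\<close> chooses one argument for each factor. In the signed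
    sum over \<open>S\<close> only those \<open>\<tau>\<close> with image \<open>P\<close> survive,
    that is, the permutations.\<close>
  have "(\<Prod>t\<in>P. \<psi> t (\<Sum>a\<in>S. X a)) = (\<Sum>\<tau>\<in>?Z. of_bool (\<tau> ` P \<subseteq> S) * ?g \<tau>)" if S: "S \<in> Pow P" for S
  proof -
    have "(\<Prod>t\<in>P. \<psi> t (\<Sum>a\<in>S. X a)) = (\<Prod>t\<in>P. \<Sum>a\<in>S. \<psi> t (X a))"
      by (intro prod.cong refl linear_forms_sum[OF \<psi>])
    also have "\<dots> = (\<Sum>\<tau>\<in>P \<rightarrow>\<^sub>E S. ?g \<tau>)"
      using P S by (intro prod_sum_PiE) (auto intro: finite_subset)
    also have "\<dots> = (\<Sum>\<tau>\<in>?Z. of_bool (\<tau> ` P \<subseteq> S) * ?g \<tau>)"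
      using fin S by (intro sum.mono_neutral_cong_left) (auto simp: PiE_iff)
    finally show ?thesis .
  qed
  then have "polarize P (\<lambda>x. \<Prod>t\<in>P. \<psi> t x) X =
      (\<Sum>S\<in>Pow P. \<Sum>\<tau>\<in>?Z. ?g \<tau> * (of_bool (\<tau> ` P \<subseteq> S) * (-1) ^ card (P - S)))"
    unfolding polarize_def by (simp add: sum_distrib_left mult_ac)
  also have "\<dots> = (\<Sum>\<tau>\<in>?Z. ?g \<tau> * of_bool (\<tau> ` P = P))"
    by (subst sum.swap, simp only: sum_distrib_left[symmetric], intro sum.cong refl,
        subst sum_alternating_superset[OF P]) auto
  also have "\<dots> = (\<Sum>\<tau>\<in>{\<tau>\<in>?Z. \<tau> ` P = P}. ?g \<tau>)"
    using fin by (intro sum.mono_neutral_cong_right) auto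
  also have "\<dots> = (\<Sum>\<pi> | \<pi> permutes P. \<Prod>t\<in>P. \<psi> t (X (\<pi> t)))"
  proof (rule sum.reindex_bij_witness[where j = "\<lambda>\<tau> a. if a \<in> P then \<tau> a else a" and i = "\<lambda>\<pi>. restrict \<pi> P"])
    fix \<tau> assume "\<tau> \<in> {\<tau>\<in>?Z. \<tau> ` P = P}"
    then have \<tau>: "\<tau> \<in> ?Z" "\<tau> ` P = P" by auto
    then have "inj_on \<tau> P" using P by (simp add: eq_card_imp_inj_on)
    with \<tau> have bij: "bij_betw \<tau> P P" by (simp add: bij_betw_def)
    then have "bij_betw (\<lambda>a. if a \<in> P then \<tau> a else a) P P"
      by (subst bij_betw_cong[where g = \<tau>]) auto
    then show "(\<lambda>a. if a \<in> P then \<tau> a else a) \<in> {\<pi>. \<pi> permutes P}"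
      by (auto intro!: bij_imp_permutes)
    show "restrict (\<lambda>a. if a \<in> P then \<tau> a else a) P = \<tau>"
      using \<tau> by (auto simp: fun_eq_iff PiE_iff extensional_def)
  next
    fix \<pi> assume "\<pi> \<in> {\<pi>. \<pi> permutes P}"
    then have \<pi>: "\<pi> permutes P" by simp
    then show "(\<lambda>a. if a \<in> P then restrict \<pi> P a else a) = \<pi>"
      by (auto simp: fun_eq_iff permutes_not_in)
    show "restrict \<pi> P \<in> {\<tau>\<in>?Z. \<tau> ` P = P}"
      using permutes_image[OF \<pi>] by auto
  qed simp
  also have "\<dots> = (\<Sum>\<pi> | \<pi> permutes P. \<Prod>t\<in>P. \<psi> (\<pi> t) (X t))"
    unfolding sum_permutations_inverse[of "\<lambda>\<pi>. \<Prod>t\<in>P. \<psi> t (X (\<pi> t))"]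
  proof (rule sum.cong[OF refl])
    fix \<pi> assume "\<pi> \<in> {\<pi>. \<pi> permutes P}"
    then have \<pi>: "\<pi> permutes P" by simp
    show "(\<Prod>t\<in>P. \<psi> t (X (inv_into UNIV \<pi> t))) = (\<Prod>t\<in>P. \<psi> (\<pi> t) (X t))"
      by (subst prod.reindex_bij_betw[OF permutes_imp_bij[OF \<pi>], symmetric])
        (simp add: permutes_inverses[OF \<pi>])
  qed
  finally show ?thesis .
qed

section \<open>Levi-Civita symbols\<close>

text \<open>Being 0 on maps that are not bijective, the symbol lets determinants be expanded over
  all maps, which is the form in which a product of sums multiplies out.\<close>

definition eps :: "('i::finite \<Rightarrow> 'i) \<Rightarrow> complex" where
  "eps u = (if bij u then of_int (sign u) else 0)"

lemma permutes_UNIV_iff: "p permutes UNIV \<longleftrightarrow> bij p"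
  by (auto simp: permutes_altdef)

lemma det_eps:
  fixes A :: "complex^'i^'i"
  shows "det A = (\<Sum>u\<in>UNIV. eps u * (\<Prod>i\<in>UNIV. A $ i $ u i))"
  unfolding det_def permutes_UNIV_iff
  by (intro sum.mono_neutral_cong_left) (auto simp: eps_def)

lemma det_select_rows:
  fixes A :: "complex^'i^'i"
  shows "det (\<chi> a. A $ u a) = eps u * det A"
proof (cases "bij u")
  case True
  then show ?thesis
    using det_permute_rows[of u A] by (simp add: eps_def permutes_UNIV_iff)
next
  case False
  then have "\<not> inj u" by (simp add: bij_def finite_UNIV_inj_surj)
  then obtain i j where "i \<noteq> j" "u i = u j" by (auto simp: inj_def)
  then have "det (\<chi> a. A $ u a) = 0"
    by (intro det_identical_rows[of i j]) (auto simp: row_def vec_eq_iff)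
  then show ?thesis using False by (simp add: eps_def)
qed

lemma sum_eps_rows:
  fixes A :: "complex^'i^'i"
  shows "(\<Sum>v\<in>UNIV. eps v * (\<Prod>a\<in>UNIV. A $ u a $ v a)) = eps u * det A"
  using det_eps[of "\<chi> a. A $ u a"] by (simp add: det_select_rows)

lemma sum_eps_square: "(\<Sum>u\<in>UNIV. eps u * eps (u :: 'i::finite \<Rightarrow> 'i)) = fact CARD('i)"
proof -
  have "eps u * eps u = of_bool (bij u)" for u :: "'i \<Rightarrow> 'i"
    by (simp add: eps_def flip: of_int_mult)
  then have "(\<Sum>u\<in>UNIV. eps u * eps (u :: 'i \<Rightarrow> 'i)) = of_nat (card {u :: 'i \<Rightarrow> 'i. bij u})"
    by simp
  also have "\<dots> = fact CARD('i)"
    using card_permutations[of "UNIV :: 'i set" "CARD('i)"] by (simp add: permutes_UNIV_iff)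
  finally show ?thesis .
qed

text \<open>The coefficient tensor of \<open>m! det\<close>. Using a symbol for the rows as well as
  one for the columns makes it invariant under permutations of the factors, at the price of the
  factorial.\<close>

definition detc :: "('i::finite \<Rightarrow> 'i \<times> 'i) \<Rightarrow> complex" where
  "detc j = eps (\<lambda>a. fst (j a)) * eps (\<lambda>a. snd (j a))"

lemma prod_of_bool: "finite A \<Longrightarrow> (\<Prod>a\<in>A. of_bool (R a)) = (of_bool (\<forall>a\<in>A. R a) :: complex)"
  by (induction rule: finite_induct) auto

lemma prod_sum_UNIV:
  fixes f :: "'a::finite \<Rightarrow> 'b::finite \<Rightarrow> complex"
  shows "(\<Prod>a\<in>UNIV. \<Sum>b\<in>UNIV. f a b) = (\<Sum>w\<in>UNIV. \<Prod>a\<in>UNIV. f a (w a))"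
  using prod_sum_PiE[of UNIV "\<lambda>_. UNIV" f] by (simp add: PiE_UNIV_domain)

lemma sum_fun_pair:
  fixes f :: "('i::finite \<Rightarrow> 'a::finite \<times> 'b::finite) \<Rightarrow> complex"
  shows "(\<Sum>j\<in>UNIV. f j) = (\<Sum>u\<in>UNIV. \<Sum>v\<in>UNIV. f (\<lambda>a. (u a, v a)))"
  unfolding sum.cartesian_product
  by (rule sum.reindex_bij_witness[where i = "\<lambda>(u, v) a. (u a, v a)" and j = "\<lambda>j. (\<lambda>a. fst (j a), \<lambda>a. snd (j a))"])
    auto

definition ent :: "complex^'i^'i \<Rightarrow> 'i \<times> 'i \<Rightarrow> complex" where
  "ent A p = A $ fst p $ snd p"

lemma sum_detc: "(\<Sum>j\<in>UNIV. detc j * (\<Prod>a\<in>UNIV. ent A (j a))) = fact CARD('i) * det (A :: complex^'i^'i)"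
proof -
  have "(\<Sum>j\<in>UNIV. detc j * (\<Prod>a\<in>UNIV. ent A (j a))) =
      (\<Sum>u\<in>UNIV. eps u * (\<Sum>v\<in>UNIV. eps v * (\<Prod>a\<in>UNIV. A $ u a $ v a)))"
    by (simp add: sum_fun_pair detc_def ent_def sum_distrib_left mult.assoc)
  also have "\<dots> = fact CARD('i) * det A"
    by (simp add: sum_eps_rows mult.assoc[symmetric] sum_distrib_right[symmetric] sum_eps_square)
  finally show ?thesis .
qed

lemma ent_matrix_unit: "ent (matrix_unit p) q = of_bool (p = q)"
  by (cases p; cases q) (auto simp: ent_def matrix_unit_def)

lemma ent_linear: "(\<lambda>A. ent A p) \<in> linear_forms mat_scale UNIV"
  by (simp add: linear_forms_def ent_def mat_scale_def)

lemma ent_add: "ent (A + B) p = ent A p + ent B p"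
  and ent_scale: "ent (mat_scale c A) p = c * ent A p"
  by (simp_all add: ent_def mat_scale_def)

lemma ent_sum: "ent (\<Sum>i\<in>I. A i) p = (\<Sum>i\<in>I. ent (A i) p)"
  using linear_forms_sum[OF ent_linear] .

lemma ent_eqI:
  assumes "\<And>p. ent A p = ent B p" shows "A = B"
  using assms[of "(i, j)" for i j] by (simp add: vec_eq_iff ent_def)

lemma matrix_expand: "A = (\<Sum>p\<in>UNIV. mat_scale (ent A p) (matrix_unit p))"
  by (rule ent_eqI) (simp add: ent_sum ent_scale ent_matrix_unit)

lemma linear_forms_expand:
  assumes "\<phi> \<in> linear_forms mat_scale UNIV"
  shows "\<phi> A = (\<Sum>p\<in>UNIV. ent A p * \<phi> (matrix_unit p))"
  by (subst matrix_expand) (simp add: linear_forms_sum[OF assms] linear_forms_scale[OF assms])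

text \<open>Left multiplication by \<open>g\<close> changes only the row index of a matrix unit.
  Once it is expanded, the alternating sum over the row maps reproduces \<open>det g\<close>, and
  the columns are untouched. This is the behaviour of Cayley's \<open>\<Omega>\<close> under
  substitution.\<close>

lemma sum_detc_linear_forms_mult:
  fixes g :: "complex^'i^'i"
  assumes \<xi>: "\<And>a. \<xi> a \<in> linear_forms mat_scale UNIV"
  shows "(\<Sum>j\<in>UNIV. detc j * (\<Prod>a\<in>UNIV. \<xi> a (g ** matrix_unit (j a)))) =
    det g * (\<Sum>j\<in>UNIV. detc j * (\<Prod>a\<in>UNIV. \<xi> a (matrix_unit (j a))))"
proof -
  have 1: "\<xi> a (g ** matrix_unit (u, v)) = (\<Sum>w\<in>UNIV. g $ w $ u * \<xi> a (matrix_unit (w, v)))" for a u v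
  proof -
    have "g ** matrix_unit (u, v) = (\<Sum>w\<in>UNIV. mat_scale (g $ w $ u) (matrix_unit (w, v)))"
    proof (rule ent_eqI)
      fix p :: "'i \<times> 'i"
      obtain i j where p: "p = (i, j)" by force
      have "ent (g ** matrix_unit (u, v)) p = (\<Sum>k\<in>UNIV. g $ i $ k * of_bool (k = u \<and> j = v))"
        by (simp add: p ent_def matrix_matrix_mult_def matrix_unit_def of_bool_def)
      also have "\<dots> = (\<Sum>w\<in>UNIV. g $ w $ u * of_bool (w = i \<and> v = j))"
        by (cases "v = j") auto
      also have "\<dots> = ent (\<Sum>w\<in>UNIV. mat_scale (g $ w $ u) (matrix_unit (w, v))) p"
        by (simp add: ent_sum ent_scale ent_matrix_unit p)
      finally show "ent (g ** matrix_unit (u, v)) p = \<dots>" .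
    qed
    then show ?thesis
      by (simp add: linear_forms_sum[OF \<xi>] linear_forms_scale[OF \<xi>])
  qed
  have "(\<Sum>j\<in>UNIV. detc j * (\<Prod>a\<in>UNIV. \<xi> a (g ** matrix_unit (j a)))) =
     (\<Sum>u\<in>UNIV. \<Sum>v\<in>UNIV. \<Sum>w\<in>UNIV. (eps v * (\<Prod>a\<in>UNIV. \<xi> a (matrix_unit (w a, v a)))) *
        (eps u * (\<Prod>a\<in>UNIV. g $ w a $ u a)))"
    by (simp add: sum_fun_pair detc_def 1 prod_sum_UNIV sum_distrib_left prod.distrib mult_ac)
  also have "\<dots> = (\<Sum>v\<in>UNIV. \<Sum>w\<in>UNIV. \<Sum>u\<in>UNIV. (eps v * (\<Prod>a\<in>UNIV. \<xi> a (matrix_unit (w a, v a)))) *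
        (eps u * (\<Prod>a\<in>UNIV. g $ w a $ u a)))"
    by (subst sum.swap, rule sum.cong[OF refl], rule sum.swap)
  also have "\<dots> = (\<Sum>v\<in>UNIV. \<Sum>w\<in>UNIV. eps v * (\<Prod>a\<in>UNIV. \<xi> a (matrix_unit (w a, v a))) *
        (eps w * det g))"
    by (simp only: sum_distrib_left[symmetric] sum_eps_rows)
  also have "\<dots> = det g * (\<Sum>j\<in>UNIV. detc j * (\<Prod>a\<in>UNIV. \<xi> a (matrix_unit (j a))))"
    by (subst sum.swap) (simp add: sum_fun_pair detc_def sum_distrib_left mult_ac)
  finally show ?thesis .
qed

section \<open>Contraction with a power of a multilinear form\<close>

abbreviation blocks :: "nat \<Rightarrow> (nat \<times> 'i) set" where
  "blocks r \<equiv> {..<r} \<times> UNIV"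

text \<open>
  \<open>contract r \<mu>\<close> is, on forms of degree \<open>r CARD('i)\<close>, the \<open>r\<close>-th power of the differential operator with
  constant coefficients \<open>\<mu>\<close>; for \<open>\<mu> = detc\<close> it is a multiple of the \<open>r\<close>-th power of Cayley's \<open>\<Omega>\<close>.
\<close>

definition contract :: "nat \<Rightarrow> (('i::finite \<Rightarrow> 'i \<times> 'i) \<Rightarrow> complex) \<Rightarrow> (complex^'i^'i \<Rightarrow> complex) \<Rightarrow> complex" where
  "contract r \<mu> F = (\<Sum>J\<in>blocks r \<rightarrow>\<^sub>E UNIV. (\<Prod>l<r. \<mu> (\<lambda>a. J (l, a))) *
     polarize (blocks r) F (\<lambda>t. matrix_unit (J t)))"

lemma prod_blocks: "(\<Prod>t\<in>blocks r. f t) = (\<Prod>l<r. \<Prod>a\<in>(UNIV :: 'i::finite set). f (l, a) :: complex)"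
  by (simp add: prod.cartesian_product)

lemma sum_prod_blocks:
  fixes h :: "nat \<Rightarrow> ('i::finite \<Rightarrow> 'a::finite) \<Rightarrow> complex"
  shows "(\<Sum>J\<in>blocks r \<rightarrow>\<^sub>E UNIV. \<Prod>l<r. h l (\<lambda>a. J (l, a))) = (\<Prod>l<r. \<Sum>j\<in>UNIV. h l j)"
proof -
  have "(\<Prod>l<r. \<Sum>j\<in>UNIV. h l j) = (\<Sum>\<Phi>\<in>{..<r} \<rightarrow>\<^sub>E UNIV. \<Prod>l<r. h l (\<Phi> l))"
    by (rule prod_sum_PiE) auto
  also have "\<dots> = (\<Sum>J\<in>blocks r \<rightarrow>\<^sub>E UNIV. \<Prod>l<r. h l (\<lambda>a. J (l, a)))"
    by (rule sum.reindex_bij_witness[where i = "\<lambda>J. \<lambda>l\<in>{..<r}. \<lambda>a. J (l, a)"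
          and j = "\<lambda>\<Phi>. \<lambda>(l, a)\<in>blocks r. \<Phi> l a"])
      (auto simp: PiE_iff extensional_def fun_eq_iff restrict_def)
  finally show ?thesis by simp
qed

lemma finite_blocks_fun: "finite (blocks r \<rightarrow>\<^sub>E (UNIV :: 'a::finite set) :: (nat \<times> 'i::finite \<Rightarrow> 'a) set)"
  by (intro finite_PiE) auto

lemma contract_sum: "contract r \<mu> (\<lambda>x. \<Sum>i\<in>I. c i * F i x) = (\<Sum>i\<in>I. c i * contract r \<mu> (F i))"
  unfolding contract_def polarize_sum sum_distrib_left
  by (subst sum.swap) (simp add: mult.left_commute)

text \<open>By Ryser's formula the polarization sums over the ways to distribute the linear factors
  over the slots; for a fixed distribution the blocks are independent. Transformation rules for
  \<open>contract\<close> thereby reduce to a single block.\<close>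

lemma contract_prod:
  assumes \<psi>: "\<And>t. t \<in> blocks r \<Longrightarrow> \<psi> t \<in> linear_forms mat_scale UNIV"
  shows "contract r \<mu> (\<lambda>x. \<Prod>t\<in>blocks r. \<psi> t x) =
    (\<Sum>\<pi> | \<pi> permutes blocks r. \<Prod>l<r. \<Sum>j\<in>UNIV. \<mu> j * (\<Prod>a\<in>UNIV. \<psi> (\<pi> (l, a)) (matrix_unit (j a))))"
proof -
  have "contract r \<mu> (\<lambda>x. \<Prod>t\<in>blocks r. \<psi> t x) =
     (\<Sum>J\<in>blocks r \<rightarrow>\<^sub>E UNIV. \<Sum>\<pi> | \<pi> permutes blocks r.
        \<Prod>l<r. \<mu> (\<lambda>a. J (l, a)) * (\<Prod>a\<in>UNIV. \<psi> (\<pi> (l, a)) (matrix_unit (J (l, a)))))"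
    unfolding contract_def
    by (subst polarize_prod[OF _ \<psi>]) (simp_all add: sum_distrib_left prod_blocks prod.distrib)
  also have "\<dots> = (\<Sum>\<pi> | \<pi> permutes blocks r. \<Sum>J\<in>blocks r \<rightarrow>\<^sub>E UNIV.
        \<Prod>l<r. \<mu> (\<lambda>a. J (l, a)) * (\<Prod>a\<in>UNIV. \<psi> (\<pi> (l, a)) (matrix_unit (J (l, a)))))"
    by (rule sum.swap)
  also have "\<dots> = (\<Sum>\<pi> | \<pi> permutes blocks r. \<Prod>l<r. \<Sum>j\<in>UNIV. \<mu> j * (\<Prod>a\<in>UNIV. \<psi> (\<pi> (l, a)) (matrix_unit (j a))))"
    by (intro sum.cong refl, rule sum_prod_blocks)
  finally show ?thesis .
qed

lemma contract_detc_mult: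
  fixes g :: "complex^'i^'i"
  assumes "F \<in> forms mat_scale UNIV (r * CARD('i))"
  shows "contract r detc (\<lambda>A. F (g ** A)) = det g ^ r * contract r detc F"
proof -
  obtain N :: nat and c \<psi> where
    "\<forall>i<N. \<forall>t\<in>(blocks r :: (nat \<times> 'i) set). \<psi> i t \<in> linear_forms mat_scale UNIV"
    "\<forall>x\<in>UNIV. F x = (\<Sum>i<N. c i * (\<Prod>t\<in>blocks r. \<psi> i t x))"
    by (rule formsE[OF assms, of "blocks r :: (nat \<times> 'i) set"], simp, simp, rule that)
  then have \<psi>: "\<And>i t. i < N \<Longrightarrow> t \<in> blocks r \<Longrightarrow> \<psi> i t \<in> linear_forms mat_scale UNIV"
    and F: "F = (\<lambda>x. \<Sum>i<N. c i * (\<Prod>t\<in>blocks r. \<psi> i t x))"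
    by blast+
  have mult: "(\<lambda>A. \<phi> (g ** A)) \<in> linear_forms mat_scale UNIV" if "\<phi> \<in> linear_forms mat_scale UNIV" for \<phi>
  proof -
    have "g ** mat_scale c A = mat_scale c (g ** A)" for c A
      by (simp add: vec_eq_iff matrix_matrix_mult_def mat_scale_def sum_distrib_left mult_ac)
    then show ?thesis using that
      by (simp add: linear_forms_def matrix_add_ldistrib)
  qed
  have "contract r detc (\<lambda>x. \<Prod>t\<in>blocks r. \<psi> i t (g ** x)) =
      det g ^ r * contract r detc (\<lambda>x. \<Prod>t\<in>blocks r. \<psi> i t x)" if i: "i < N" for i
  proof -
    have "(\<Prod>l<r. \<Sum>j\<in>UNIV. detc j * (\<Prod>a\<in>UNIV. \<psi> i (\<pi> (l, a)) (g ** matrix_unit (j a)))) =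
        det g ^ r * (\<Prod>l<r. \<Sum>j\<in>UNIV. detc j * (\<Prod>a\<in>UNIV. \<psi> i (\<pi> (l, a)) (matrix_unit (j a))))"
      if "\<pi> permutes blocks r" for \<pi>
    proof -
      have "(\<Sum>j\<in>UNIV. detc j * (\<Prod>a\<in>UNIV. \<psi> i (\<pi> (l, a)) (g ** matrix_unit (j a)))) =
          det g * (\<Sum>j\<in>UNIV. detc j * (\<Prod>a\<in>UNIV. \<psi> i (\<pi> (l, a)) (matrix_unit (j a))))" if "l < r" for l
        using \<psi>[OF i] \<open>\<pi> permutes blocks r\<close> that
        by (intro sum_detc_linear_forms_mult) (simp add: permutes_in_image)
      then show ?thesis by (simp add: prod.distrib)
    qed
    then show ?thesis
      using \<psi>[OF i] by (simp add: contract_prod mult sum_distrib_left)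
  qed
  then show ?thesis
    unfolding F by (simp add: contract_sum sum_distrib_left mult.left_commute)
qed

text \<open>Up to nonzero factors the left side is the sum of squares of the entries of the
  symmetrized coefficient tensor \<open>T\<close> of \<open>det ^ r\<close>, and these entries are
  real. If it vanished, \<open>T\<close> would vanish, and with it the value of
  \<open>det ^ r\<close> at the identity.\<close>

lemma contract_det_power: "contract r detc (\<lambda>A :: complex^'i^'i. det A ^ r) \<noteq> 0"
proof -
  let ?P = "blocks r :: (nat \<times> 'i) set"
  let ?\<Pi> = "{\<pi>. \<pi> permutes ?P}"
  let ?N = "of_nat (card ?\<Pi>) :: complex"
  define Z where "Z = (?P \<rightarrow>\<^sub>E UNIV :: (nat \<times> 'i \<Rightarrow> 'i \<times> 'i) set)"
  define K where "K J = (\<Prod>l<r. detc (\<lambda>a. J (l, a)))" for J :: "nat \<times> 'i \<Rightarrow> 'i \<times> 'i"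
  define T where "T J = (\<Sum>\<pi>\<in>?\<Pi>. K (J \<circ> \<pi>))" for J
  have finP: "finite ?\<Pi>" by (rule finite_permutations) simp
  have finZ: "finite Z" unfolding Z_def by (rule finite_blocks_fun)
  have comp: "J \<circ> \<pi> \<in> Z" if "J \<in> Z" "\<pi> permutes ?P" for J \<pi>
    using that by (auto simp: Z_def PiE_iff extensional_def permutes_not_in)
  have N: "?N \<noteq> 0"
    using finP by (auto simp: card_eq_0_iff intro!: exI[of _ id] permutes_id)
  have reindex: "(\<Sum>J\<in>Z. f (J \<circ> \<pi>)) = (\<Sum>J\<in>Z. f J)"
    if \<pi>: "\<pi> permutes ?P" for \<pi> and f :: "_ \<Rightarrow> complex"
    by (rule sum.reindex_bij_witness[where i = "\<lambda>J. J \<circ> inv_into UNIV \<pi>" and j = "\<lambda>J. J \<circ> \<pi>"])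
      (auto simp: comp \<pi> permutes_inv comp_assoc permutes_inv_o[OF \<pi>])
  \<comment> \<open>Paired with a symmetric weight \<open>f\<close>, the tensor \<open>K\<close> may
    be replaced by its symmetrization.\<close>
  have average: "?N * (\<Sum>J\<in>Z. K J * f J) = (\<Sum>J\<in>Z. T J * f J)"
    if f: "\<And>J \<pi>. J \<in> Z \<Longrightarrow> \<pi> permutes ?P \<Longrightarrow> f (J \<circ> \<pi>) = f J" for f
  proof -
    have "?N * (\<Sum>J\<in>Z. K J * f J) = (\<Sum>\<pi>\<in>?\<Pi>. \<Sum>J\<in>Z. K (J \<circ> \<pi>) * f (J \<circ> \<pi>))"
      using reindex[of _ "\<lambda>J. K J * f J"] by simp
    also have "\<dots> = (\<Sum>\<pi>\<in>?\<Pi>. \<Sum>J\<in>Z. K (J \<circ> \<pi>) * f J)"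
      by (intro sum.cong refl) (simp add: f)
    also have "\<dots> = (\<Sum>J\<in>Z. T J * f J)"
      by (subst sum.swap) (simp add: T_def sum_distrib_right)
    finally show ?thesis .
  qed
  have power: "fact CARD('i) ^ r * det A ^ r = (\<Sum>J\<in>Z. K J * (\<Prod>t\<in>?P. ent A (J t)))" for A
    using sum_prod_blocks[of "\<lambda>l j. detc j * (\<Prod>a\<in>UNIV. ent A (j a))" r]
    by (simp add: sum_detc power_mult_distrib prod_blocks prod.distrib K_def Z_def)
  \<comment> \<open>The polarized monomial is a permanent of zeros and ones: it counts the
    permutations that carry one index map into the other.\<close>
  have pol: "polarize ?P (\<lambda>A. \<Prod>t\<in>?P. ent A (J t)) (\<lambda>t. matrix_unit (J' t)) =
      (\<Sum>\<pi>\<in>?\<Pi>. of_bool (J = J' \<circ> inv_into UNIV \<pi>))" if J: "J \<in> Z" "J' \<in> Z" for J J'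
  proof -
    have eq: "J = J' \<circ> inv_into UNIV \<pi> \<longleftrightarrow> (\<forall>t\<in>?P. J' t = J (\<pi> t))" if \<pi>: "\<pi> permutes ?P" for \<pi>
    proof
      assume "J = J' \<circ> inv_into UNIV \<pi>"
      then show "\<forall>t\<in>?P. J' t = J (\<pi> t)"
        by (simp add: permutes_inverses[OF \<pi>])
    next
      assume *: "\<forall>t\<in>?P. J' t = J (\<pi> t)"
      have "J s = J' (inv_into UNIV \<pi> s)" for s
      proof (cases "s \<in> ?P")
        case True
        then have "inv_into UNIV \<pi> s \<in> ?P"
          by (simp only: permutes_in_image[OF permutes_inv[OF \<pi>]])
        then have "J' (inv_into UNIV \<pi> s) = J (\<pi> (inv_into UNIV \<pi> s))"
          by (rule *[rule_format])
        then show ?thesis by (simp add: permutes_inverses[OF \<pi>])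
      next
        case False
        then show ?thesis
          using J permutes_not_in[OF permutes_inv[OF \<pi>], of s]
          by (cases s) (simp add: Z_def PiE_iff extensional_def)
      qed
      then show "J = J' \<circ> inv_into UNIV \<pi>" by auto
    qed
    have "polarize ?P (\<lambda>A. \<Prod>t\<in>?P. ent A (J t)) (\<lambda>t. matrix_unit (J' t)) =
        (\<Sum>\<pi>\<in>?\<Pi>. \<Prod>t\<in>?P. of_bool (J' t = J (\<pi> t)))"
      by (subst polarize_prod[OF _ ent_linear]) (simp_all add: ent_matrix_unit)
    also have "\<dots> = (\<Sum>\<pi>\<in>?\<Pi>. of_bool (J = J' \<circ> inv_into UNIV \<pi>))"
    proof (rule sum.cong[OF refl])
      fix \<pi> assume "\<pi> \<in> ?\<Pi>"
      moreover have "(\<Prod>t\<in>?P. of_bool (J' t = J (\<pi> t)) :: complex) = of_bool (\<forall>t\<in>?P. J' t = J (\<pi> t))"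
        by (rule prod_of_bool) simp
      ultimately show "(\<Prod>t\<in>?P. of_bool (J' t = J (\<pi> t))) = (of_bool (J = J' \<circ> inv_into UNIV \<pi>) :: complex)"
        by (simp only: eq mem_Collect_eq)
    qed
    finally show ?thesis .
  qed
  have "polarize ?P (\<lambda>A. \<Sum>J\<in>Z. K J * (\<Prod>t\<in>?P. ent A (J t))) (\<lambda>t. matrix_unit (J' t)) = T J'"
    if J': "J' \<in> Z" for J'
  proof -
    have "polarize ?P (\<lambda>A. \<Sum>J\<in>Z. K J * (\<Prod>t\<in>?P. ent A (J t))) (\<lambda>t. matrix_unit (J' t)) =
        (\<Sum>\<pi>\<in>?\<Pi>. \<Sum>J\<in>Z. K J * of_bool (J = J' \<circ> inv_into UNIV \<pi>))"
      by (subst sum.swap) (simp add: polarize_sum pol J' sum_distrib_left)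
    also have "\<dots> = (\<Sum>\<pi>\<in>?\<Pi>. K (J' \<circ> inv_into UNIV \<pi>))"
      using finZ comp[OF J' permutes_inv] by (intro sum.cong refl) (simp add: of_bool_def if_distrib cong: if_cong)
    also have "\<dots> = T J'"
      unfolding T_def by (rule sum_permutations_inverse[symmetric])
    finally show ?thesis .
  qed
  then have "fact CARD('i) ^ r * contract r detc (\<lambda>A :: complex^'i^'i. det A ^ r) = (\<Sum>J\<in>Z. K J * T J)"
    using contract_sum[of r detc "\<lambda>_. fact CARD('i) ^ r" "\<lambda>_ A :: complex^'i^'i. det A ^ r" "{()}"]
    by (simp add: power contract_def flip: Z_def K_def)
  then have sq: "?N * (fact CARD('i) ^ r * contract r detc (\<lambda>A :: complex^'i^'i. det A ^ r)) = (\<Sum>J\<in>Z. T J * T J)"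
    by (subst average[symmetric])
      (auto simp: T_def comp_assoc setum_permutations_compose_left[of _ ?P "\<lambda>\<pi>. K (_ \<circ> \<pi>)"])
  have real: "T J = of_real (Re (T J))" for J
  proof -
    have "T J \<in> \<real>"
      unfolding T_def K_def detc_def eps_def by (intro sum_in_Reals prod_in_Reals Reals_mult) auto
    then show ?thesis by (simp add: complex_is_Real_iff complex_eq_iff)
  qed
  show ?thesis
  proof
    assume "contract r detc (\<lambda>A :: complex^'i^'i. det A ^ r) = 0"
    then have "(\<Sum>J\<in>Z. T J * T J) = 0"
      using sq by simp
    then have "complex_of_real (\<Sum>J\<in>Z. Re (T J) * Re (T J)) = 0"
      unfolding of_real_sum of_real_mult using real by simp
    then have "\<forall>J\<in>Z. T J = 0"
      using finZ real by (subst (asm) of_real_eq_0_iff, subst (asm) sum_nonneg_eq_0_iff) (auto, metis of_real_0)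
    then have "(\<Sum>J\<in>Z. T J * (\<Prod>t\<in>?P. ent (mat 1 :: complex^'i^'i) (J t))) = 0"
      by simp
    moreover have "?N * (\<Sum>J\<in>Z. K J * (\<Prod>t\<in>?P. ent (mat 1 :: complex^'i^'i) (J t))) =
      (\<Sum>J\<in>Z. T J * (\<Prod>t\<in>?P. ent (mat 1 :: complex^'i^'i) (J t)))"
    proof (rule average)
      fix J \<pi> assume "\<pi> permutes ?P"
      then show "(\<Prod>t\<in>?P. ent (mat 1 :: complex^'i^'i) ((J \<circ> \<pi>) t)) = (\<Prod>t\<in>?P. ent (mat 1 :: complex^'i^'i) (J t))"
        using prod.reindex_bij_betw[OF permutes_imp_bij, of \<pi> ?P "\<lambda>t. ent (mat 1) (J t)"] by simp
    qed
    ultimately show False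
      using N power[of "mat 1"] by simp
  qed
qed

section \<open>Linear maps of the space of matrices\<close>

definition lin :: "complex^('n \<times> 'n)^('n \<times> 'n) \<Rightarrow> complex^'n^'n \<Rightarrow> complex^'n^'n" where
  "lin M X = (\<chi> i j. \<Sum>b\<in>UNIV. M $ (i, j) $ b * ent X b)"

lemma ent_lin: "ent (lin M X) p = (\<Sum>b\<in>UNIV. M $ p $ b * ent X b)"
  by (cases p) (simp add: ent_def lin_def)

lemma lin_mult: "lin (M ** N) X = lin M (lin N X)"
proof (rule ent_eqI)
  fix p
  have "ent (lin (M ** N) X) p = (\<Sum>b\<in>UNIV. \<Sum>c\<in>UNIV. M $ p $ c * N $ c $ b * ent X b)"
    by (simp add: ent_lin matrix_matrix_mult_def sum_distrib_right)
  also have "\<dots> = ent (lin M (lin N X)) p"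
    by (subst sum.swap) (simp add: ent_lin sum_distrib_left mult.assoc)
  finally show "ent (lin (M ** N) X) p = ent (lin M (lin N X)) p" .
qed

lemma lin_mat_1 [simp]: "lin (mat 1) X = X"
  by (rule ent_eqI) (simp add: ent_lin mat_def if_distrib[of "\<lambda>x. x * _"] cong: if_cong)

lemma lin_add: "lin M (X + Y) = lin M X + lin M Y"
  and lin_scale: "lin M (mat_scale c X) = mat_scale c (lin M X)"
  by (rule ent_eqI; simp add: ent_lin ent_add ent_scale algebra_simps sum.distrib sum_distrib_left)+

lemma lin_sum: "lin M (\<Sum>i\<in>I. X i) = (\<Sum>i\<in>I. lin M (X i))"
proof (rule ent_eqI)
  fix p
  show "ent (lin M (\<Sum>i\<in>I. X i)) p = ent (\<Sum>i\<in>I. lin M (X i)) p"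
    by (simp add: ent_lin ent_sum sum_distrib_left) (rule sum.swap)
qed

lemma linear_forms_lin: "\<phi> \<in> linear_forms mat_scale UNIV \<Longrightarrow> (\<lambda>X. \<phi> (lin M X)) \<in> linear_forms mat_scale UNIV"
  by (simp add: linear_forms_def lin_add lin_scale)

lemma lin_matrix_unit: "lin M (matrix_unit b) = (\<Sum>c\<in>UNIV. mat_scale (M $ c $ b) (matrix_unit c))"
  by (rule ent_eqI) (simp add: ent_lin ent_sum ent_scale ent_matrix_unit)

definition matrix_of :: "(complex^'n^'n \<Rightarrow> complex^'n^'n) \<Rightarrow> complex^('n \<times> 'n)^('n \<times> 'n)" where
  "matrix_of g = (\<chi> p r. ent (g (matrix_unit r)) p)"

lemma det_E_matrix_of: "det_E g = det (matrix_of g)"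
  by (simp add: det_E_def matrix_of_def ent_def)

lemma matrix_of_lin: "matrix_of (lin M) = M"
  by (simp add: matrix_of_def ent_lin ent_matrix_unit vec_eq_iff)

lemma lin_matrix_of:
  assumes "\<And>X Y. g (X + Y) = g X + g Y" "\<And>c X. g (mat_scale c X) = mat_scale c (g X)"
  shows "g = lin (matrix_of g)"
proof (rule ext, rule ent_eqI)
  fix X p
  have "(\<lambda>X. ent (g X) p) \<in> linear_forms mat_scale UNIV"
    by (simp add: linear_forms_def assms ent_add ent_scale)
  from linear_forms_expand[OF this, of X]
  show "ent (g X) p = ent (lin (matrix_of g) X) p"
    by (simp add: ent_lin matrix_of_def mult.commute)
qed

lemma vector_space_mat_scale: "vector_space mat_scale"
  by unfold_locales (simp_all add: mat_scale_def vec_eq_iff algebra_simps)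

lemma linear_mat_scale_iff:
  "Vector_Spaces.linear mat_scale mat_scale g \<longleftrightarrow>
    (\<forall>X Y. g (X + Y) = g X + g Y) \<and> (\<forall>c X. g (mat_scale c X) = mat_scale c (g X))"
  by (simp add: Vector_Spaces.linear_iff vector_space_mat_scale)

lemma matrix_mul_inv:
  fixes M :: "complex^'i^'i"
  assumes "det M \<noteq> 0"
  shows "M ** matrix_inv M = mat 1" "matrix_inv M ** M = mat 1"
  using assms someI_ex[of "\<lambda>A'. M ** A' = mat 1 \<and> A' ** M = mat 1"]
  unfolding matrix_inv_def invertible_det_nz[symmetric] invertible_def by auto

lemma lin_matrix_inv:
  assumes "det M \<noteq> 0"
  shows "lin M (lin (matrix_inv M) X) = X" "lin (matrix_inv M) (lin M X) = X"
  using matrix_mul_inv[OF assms] by (simp_all flip: lin_mult)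

lemma lin_GL_E:
  assumes "det M \<noteq> 0"
  shows "lin M \<in> GL_E"
  using lin_matrix_inv[OF assms]
  by (auto simp: GL_E_def linear_mat_scale_iff lin_add lin_scale intro!: o_bij[of "lin (matrix_inv M)"])

lemma inv_lin:
  assumes "det M \<noteq> 0"
  shows "inv_into UNIV (lin M) = lin (matrix_inv M)"
  using lin_matrix_inv[OF assms] by (intro inv_equality) auto

lemma det_matrix_inv:
  fixes M :: "complex^'i^'i"
  assumes "det M \<noteq> 0" shows "det (matrix_inv M) = inverse (det M)"
proof -
  have "det M * det (matrix_inv M) = 1"
    using matrix_mul_inv[OF assms] by (simp flip: det_mul)
  then show ?thesis using assms by (simp add: field_simps)
qed

lemma GL_E_lin:
  assumes "g \<in> GL_E"
  obtains M where "g = lin M" "det M \<noteq> 0"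
proof -
  have g: "g (X + Y) = g X + g Y" "g (mat_scale c X) = mat_scale c (g X)" "bij g" for X Y c
    using assms by (auto simp: GL_E_def linear_mat_scale_iff)
  let ?h = "inv_into UNIV g"
  have gh: "g (?h X) = X" "?h (g X) = X" for X
    using g(3) by (simp_all add: bij_is_surj surj_f_inv_f bij_is_inj)
  have "?h (X + Y) = ?h X + ?h Y" "?h (mat_scale c X) = mat_scale c (?h X)" for X Y c
    by (metis g(1) gh) (metis g(2) gh)
  then have h: "?h = lin (matrix_of ?h)"
    by (rule lin_matrix_of)
  have g': "g = lin (matrix_of g)"
    using g by (intro lin_matrix_of)
  have "lin (matrix_of g ** matrix_of ?h) = lin (mat 1)"
    by (simp add: fun_eq_iff lin_mult flip: h g') (simp add: gh)
  then have "matrix_of g ** matrix_of ?h = mat 1"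
    by (metis matrix_of_lin)
  then have "det (matrix_of g) * det (matrix_of ?h) = 1"
    by (simp flip: det_mul)
  then have "det (matrix_of g) \<noteq> 0" by auto
  with g' show ?thesis by (rule that)
qed

text \<open>The inverse in the action is absorbed by letting the matrix run through all invertible
  ones. From here on, points of the orbit are parametrized by substitutions into
  \<open>det\<close>.\<close>

lemma det_orbit_lin: "det_orbit = {\<lambda>X. det (lin M X) |M. det M \<noteq> 0}"
proof (intro equalityI subsetI)
  fix q :: "complex^'n^'n \<Rightarrow> complex" assume "q \<in> det_orbit"
  then obtain M where "q = act_Q (lin M) det" "det M \<noteq> 0"
    unfolding det_orbit_def by (auto elim: GL_E_lin)
  then show "q \<in> {\<lambda>X. det (lin M X) |M. det M \<noteq> 0}"
    by (auto simp: act_Q_def inv_lin det_matrix_inv intro!: exI[of _ "matrix_inv M"])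
next
  fix q :: "complex^'n^'n \<Rightarrow> complex" assume "q \<in> {\<lambda>X. det (lin M X) |M. det M \<noteq> 0}"
  then obtain M where M: "q = (\<lambda>X. det (lin M X))" "det M \<noteq> 0" by auto
  let ?N = "matrix_inv M"
  have N: "det ?N \<noteq> 0" using M by (simp add: det_matrix_inv)
  have "inv_into UNIV (lin ?N) = lin M"
    using lin_matrix_inv[OF M(2)] by (intro inv_equality) auto
  then have "q = act_Q (lin ?N) det"
    by (simp add: M act_Q_def)
  then show "q \<in> det_orbit"
    unfolding det_orbit_def using lin_GL_E[OF N] by blast
qed

section \<open>The space of forms\<close>

lemma Q_space_forms: "(Q_space :: (complex^'n^'n \<Rightarrow> complex) set) = forms mat_scale UNIV CARD('n)"
  by (auto simp: Q_space_def homogeneous_polys_iff)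

lemma eval_linear: "(\<lambda>q. q X) \<in> linear_forms fun_scale V"
  by (simp add: linear_forms_def fun_scale_def)

text \<open>Indexing by maps instead of multisets makes expansions non-unique; only their existence
  is needed.\<close>

definition monomial :: "('n::finite \<Rightarrow> 'n \<times> 'n) \<Rightarrow> complex^'n^'n \<Rightarrow> complex" where
  "monomial j X = (\<Prod>a\<in>UNIV. ent X (j a))"

lemma Q_prod: "(\<And>a. \<psi> a \<in> linear_forms mat_scale UNIV) \<Longrightarrow> (\<lambda>X :: complex^'n^'n. \<Prod>a\<in>(UNIV :: 'n set). \<psi> a X) \<in> Q_space"
  unfolding Q_space_forms by (rule forms_prod_linear) auto

lemma monomial_Q: "monomial j \<in> Q_space"
  using Q_prod[OF ent_linear] by (simp add: monomial_def[abs_def])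

lemma Q_scale: "q \<in> Q_space \<Longrightarrow> (\<lambda>X. c * q X) \<in> Q_space"
  and Q_add: "q \<in> Q_space \<Longrightarrow> p \<in> Q_space \<Longrightarrow> (\<lambda>X. q X + p X) \<in> Q_space"
  and Q_sum: "(\<And>i. i \<in> I \<Longrightarrow> F i \<in> Q_space) \<Longrightarrow> (\<lambda>X. \<Sum>i\<in>I. F i X) \<in> Q_space"
  unfolding Q_space_forms by (auto intro: forms_scale forms_add forms_sum)

lemma prod_linear_expand:
  fixes \<psi> :: "'n::finite \<Rightarrow> complex^'n^'n \<Rightarrow> complex"
  assumes "\<And>a. \<psi> a \<in> linear_forms mat_scale UNIV"
  shows "(\<Prod>a\<in>UNIV. \<psi> a X) = (\<Sum>j\<in>UNIV. (\<Prod>a\<in>UNIV. \<psi> a (matrix_unit (j a))) * monomial j X)"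
  by (subst linear_forms_expand[OF assms])
    (simp add: prod_sum_UNIV monomial_def prod.distrib mult.commute)

lemma Q_expand:
  fixes q :: "complex^'n^'n \<Rightarrow> complex"
  assumes "q \<in> Q_space"
  obtains c where "q = (\<lambda>X. \<Sum>j\<in>UNIV. c j * monomial j X)"
proof -
  obtain N :: nat and c \<psi> where
    "\<forall>i<N. \<forall>a\<in>(UNIV :: 'n set). \<psi> i a \<in> linear_forms mat_scale UNIV"
    "\<forall>x\<in>UNIV. q x = (\<Sum>i<N. c i * (\<Prod>a\<in>UNIV. \<psi> i a x))"
    by (rule formsE[OF assms[unfolded Q_space_forms], of "UNIV :: 'n set"], simp, simp, rule that)
  then have "q = (\<lambda>X. \<Sum>i<N. \<Sum>j\<in>UNIV. c i * (\<Prod>a\<in>UNIV. \<psi> i a (matrix_unit (j a))) * monomial j X)"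
    by (auto simp: fun_eq_iff prod_linear_expand sum_distrib_left mult.assoc)
  then have "q = (\<lambda>X. \<Sum>j\<in>UNIV. (\<Sum>i<N. c i * (\<Prod>a\<in>UNIV. \<psi> i a (matrix_unit (j a)))) * monomial j X)"
    by (subst (asm) sum.swap) (simp add: sum_distrib_right)
  then show ?thesis by (rule that)
qed

lemma monomial_lin: "monomial j (lin M X) = (\<Sum>i\<in>UNIV. (\<Prod>a\<in>UNIV. M $ j a $ i a) * monomial i X)"
  by (simp add: monomial_def ent_lin prod_sum_UNIV prod.distrib)

lemma Q_lin: "q \<in> Q_space \<Longrightarrow> (\<lambda>X. q (lin M X)) \<in> Q_space"
  by (erule Q_expand) (auto simp: monomial_lin intro!: Q_sum Q_scale monomial_Q)

lemma det_monomial: "fact CARD('n) * det X = (\<Sum>j\<in>UNIV. detc j * monomial j (X :: complex^'n^'n))"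
  by (simp add: sum_detc monomial_def)

lemma det_Q: "(\<lambda>X. det X) \<in> Q_space"
  unfolding det_eps using Q_prod[OF ent_linear, of "\<lambda>a. (a, _ a)"]
  by (intro Q_sum Q_scale) (simp add: ent_def)

section \<open>Left and right multiplication\<close>

definition lmul :: "complex^'n^'n \<Rightarrow> complex^('n \<times> 'n)^('n \<times> 'n)" where
  "lmul A = (\<chi> p q. if snd p = snd q then A $ fst p $ fst q else 0)"

definition rmul :: "complex^'n^'n \<Rightarrow> complex^('n \<times> 'n)^('n \<times> 'n)" where
  "rmul B = (\<chi> p q. if fst p = fst q then B $ snd q $ snd p else 0)"

lemma lin_lmul: "lin (lmul A) X = A ** X"
proof (rule ent_eqI)
  fix p
  have "ent (lin (lmul A) X) p = (\<Sum>i\<in>UNIV. \<Sum>j\<in>UNIV. (if snd p = j then A $ fst p $ i else 0) * X $ i $ j)"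
    unfolding ent_lin by (simp add: lmul_def ent_def sum.cartesian_product case_prod_beta)
  also have "\<dots> = ent (A ** X) p"
    by (simp add: ent_def matrix_matrix_mult_def if_distrib[of "\<lambda>x. x * _"] cong: if_cong)
  finally show "ent (lin (lmul A) X) p = ent (A ** X) p" .
qed

lemma lin_rmul: "lin (rmul B) X = X ** B"
proof (rule ent_eqI)
  fix p
  have "ent (lin (rmul B) X) p = (\<Sum>j\<in>UNIV. \<Sum>i\<in>UNIV. (if fst p = i then B $ j $ snd p else 0) * X $ i $ j)"
    unfolding ent_lin by (subst sum.swap) (simp add: rmul_def ent_def sum.cartesian_product case_prod_beta)
  also have "\<dots> = ent (X ** B) p"
    by (simp add: ent_def matrix_matrix_mult_def if_distrib[of "\<lambda>x. x * _"] mult.commute[of "X $ _ $ _"] cong: if_cong)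
  finally show "ent (lin (rmul B) X) p = ent (X ** B) p" .
qed

text \<open>Multiplies by \<open>A\<close> only those columns of a matrix that are listed in
  \<open>S\<close>, which interpolates between the identity and \<open>lmul A\<close>, one column at
  a time.\<close>

definition column_mul :: "'n set \<Rightarrow> complex^'n^'n \<Rightarrow> complex^('n \<times> 'n)^('n \<times> 'n)" where
  "column_mul S A = (\<chi> p q. if snd p = snd q
     then (if snd p \<in> S then A $ fst p $ fst q else of_bool (fst p = fst q)) else 0)"

text \<open>A permutation contributes to the Leibniz sum only if it fixes every position outside
  column \<open>j\<close>; what remains is the Leibniz sum of \<open>A\<close>.\<close>

lemma det_column_mul_single: "det (column_mul {j} A) = det (A :: complex^'n^'n)"
proof -
  let ?M = "column_mul {j} A"
  let ?T = "(UNIV :: 'n set) \<times> {j}"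
  let ?f = "\<lambda>i :: 'n. (i, j)"
  have f: "bij_betw ?f UNIV ?T" by (auto simp: bij_betw_def inj_on_def)
  have bij: "bij_betw (map_permutation UNIV ?f) {\<pi>. \<pi> permutes UNIV} {q. q permutes ?T}"
    using bij_betw_permutations[OF f] f
    by (simp add: map_permutation_def[abs_def] restrict_id_def o_def bij_betw_def)
  have "det ?M = (\<Sum>q | q permutes ?T. of_int (sign q) * (\<Prod>p\<in>UNIV. ?M $ p $ q p))"
    unfolding det_def
  proof (rule sum.mono_neutral_right)
    show "\<forall>q\<in>{q. q permutes UNIV} - {q. q permutes ?T}. of_int (sign q) * (\<Prod>p\<in>UNIV. ?M $ p $ q p) = 0"
    proof
      fix q assume q: "q \<in> {q. q permutes (UNIV :: ('n \<times> 'n) set)} - {q. q permutes ?T}"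
      have "\<exists>x. x \<notin> ?T \<and> q x \<noteq> x"
      proof (rule ccontr)
        assume "\<not> ?thesis"
        then have id: "\<And>x. x \<in> UNIV - ?T \<Longrightarrow> q x = x" by blast
        have "q permutes UNIV" using q by blast
        from permutes_superset[OF this id] have "q permutes ?T" .
        then show False using q by blast
      qed
      then obtain x where "snd x \<noteq> j" "q x \<noteq> x" by (cases "x :: 'n \<times> 'n") auto
      then have "?M $ x $ q x = 0"
        by (auto simp: column_mul_def prod_eq_iff)
      then show "of_int (sign q) * (\<Prod>p\<in>UNIV. ?M $ p $ q p) = 0"
        by (simp add: prod_zero_iff) (metis prod.collapse)
    qed
  qed (auto dest: permutes_subset simp: finite_permutations)
  also have "\<dots> = (\<Sum>\<pi> | \<pi> permutes UNIV. of_int (sign (map_permutation UNIV ?f \<pi>)) *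
      (\<Prod>p\<in>UNIV. ?M $ p $ map_permutation UNIV ?f \<pi> p))"
    by (rule sum.reindex_bij_betw[OF bij, symmetric])
  also have "\<dots> = (\<Sum>\<pi> | \<pi> permutes UNIV. of_int (sign \<pi>) * (\<Prod>i\<in>UNIV. A $ i $ \<pi> i))"
  proof (rule sum.cong[OF refl])
    fix \<pi> assume "\<pi> \<in> {\<pi>. \<pi> permutes (UNIV :: 'n set)}"
    then have \<pi>: "\<pi> permutes UNIV" by simp
    have inj: "inj ?f" by (auto simp: inj_on_def)
    let ?q = "map_permutation UNIV ?f \<pi>"
    have q: "?q (i, j) = (\<pi> i, j)" for i
      using map_permutation_apply[of ?f UNIV i \<pi>] inj by simp
    have q': "?q p = p" if "p \<notin> ?T" for p
      using permutes_not_in[OF map_permutation_permutes[OF f \<pi>] that] .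
    have "(\<Prod>p\<in>UNIV. ?M $ p $ ?q p) = (\<Prod>p\<in>?T. ?M $ p $ ?q p)"
      by (rule prod.mono_neutral_right) (auto simp: q' column_mul_def)
    also have "\<dots> = (\<Prod>i\<in>UNIV. ?M $ (i, j) $ ?q (i, j))"
      by (rule prod.reindex_bij_betw[OF f, symmetric])
    also have "\<dots> = (\<Prod>i\<in>UNIV. A $ i $ \<pi> i)"
      by (simp add: q column_mul_def)
    finally show "of_int (sign ?q) * (\<Prod>p\<in>UNIV. ?M $ p $ ?q p) = of_int (sign \<pi>) * (\<Prod>i\<in>UNIV. A $ i $ \<pi> i)"
      using sign_map_permutation[OF inj \<pi>] by simp
  qed
  finally show ?thesis by (simp add: det_def)
qed

lemma column_mul_insert:
  assumes "j \<notin> S"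
  shows "column_mul (insert j S) A = column_mul {j} A ** column_mul S (A :: complex^'n^'n)"
proof -
  have "(column_mul {j} A ** column_mul S A) $ p $ q = column_mul (insert j S) A $ p $ q" for p q
  proof -
    have "(column_mul {j} A ** column_mul S A) $ p $ q =
      (\<Sum>k\<in>UNIV. \<Sum>l\<in>UNIV. column_mul {j} A $ p $ (k, l) * column_mul S A $ (k, l) $ q)"
      by (simp add: matrix_matrix_mult_def sum.cartesian_product)
    also have "\<dots> = (\<Sum>k\<in>UNIV. column_mul {j} A $ p $ (k, snd p) * column_mul S A $ (k, snd p) $ q)"
      by (intro sum.cong refl sum.mono_neutral_cong_right[of UNIV "{snd p}", simplified])
        (auto simp: column_mul_def)
    also have "\<dots> = column_mul (insert j S) A $ p $ q"
      using assms by (cases "snd p = snd q"; cases "snd p = j"; cases "snd p \<in> S")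
        (simp_all add: column_mul_def of_bool_def if_distrib[of "\<lambda>x. x * _"] if_distrib[of "\<lambda>x. _ * x"] cong: if_cong)
    finally show ?thesis .
  qed
  then show ?thesis by (simp add: vec_eq_iff)
qed

lemma det_column_mul: "det (column_mul S A) = det (A :: complex^'n^'n) ^ card S"
proof (induction S rule: finite_induct[OF finite])
  case 1
  have "column_mul {} A = mat 1"
    by (auto simp: vec_eq_iff column_mul_def mat_def prod_eq_iff)
  then show ?case by simp
next
  case (2 j S)
  then show ?case
    by (subst column_mul_insert) (simp_all add: det_mul det_column_mul_single)
qed

lemma det_lmul: "det (lmul A) = det (A :: complex^'n^'n) ^ CARD('n)"
proof -
  have "lmul A = column_mul UNIV A"
    by (simp add: vec_eq_iff lmul_def column_mul_def)
  then show ?thesis by (simp add: det_column_mul)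
qed

text \<open>Transposing matrices, that is, permuting rows and columns simultaneously by
  \<open>prod.swap\<close>, turns \<open>rmul B\<close> into \<open>lmul (transpose B)\<close>; the
  two signs cancel.\<close>

lemma det_rmul: "det (rmul B) = det (B :: complex^'n^'n) ^ CARD('n)"
proof -
  have sw: "(prod.swap :: 'n \<times> 'n \<Rightarrow> _) permutes UNIV"
    unfolding permutes_UNIV_iff by (rule bij_swap)
  let ?L = "lmul (transpose B)"
  have "rmul B = (\<chi> p. (\<chi> p q. ?L $ p $ prod.swap q) $ prod.swap p)"
    by (simp add: vec_eq_iff rmul_def lmul_def transpose_def)
  then have "det (rmul B) = of_int (sign (prod.swap :: 'n \<times> 'n \<Rightarrow> _)) * (of_int (sign (prod.swap :: 'n \<times> 'n \<Rightarrow> _)) * det ?L)"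
    by (simp only: det_permute_rows[OF sw] det_permute_columns[OF sw])
  also have "\<dots> = det ?L"
    by (simp flip: of_int_mult mult.assoc)
  finally show ?thesis by (simp add: det_lmul)
qed

section \<open>The Hessian\<close>

text \<open>
  Up to the factor \<open>(m - 2)!\<close>, \<open>hess a1 a2 q Y Z x\<close> is the second derivative of \<open>q\<close> at \<open>x\<close> in the
  directions \<open>Y\<close> and \<open>Z\<close>, which fill the slots \<open>a1\<close> and \<open>a2\<close> of the polarization of \<open>q\<close>.
\<close>

definition hess ::
    "'n \<Rightarrow> 'n \<Rightarrow> (complex^'n^'n \<Rightarrow> complex) \<Rightarrow> complex^'n^'n \<Rightarrow> complex^'n^'n \<Rightarrow> complex^'n^'n \<Rightarrow> complex" where
  "hess a1 a2 q Y Z x = polarize UNIV q ((\<lambda>_. x)(a2 := Z, a1 := Y))"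

definition hess_det :: "'n \<Rightarrow> 'n \<Rightarrow> (complex^'n^'n \<Rightarrow> complex) \<Rightarrow> complex^'n^'n \<Rightarrow> complex" where
  "hess_det a1 a2 q x =
     det (\<chi> b b'. hess a1 a2 q (matrix_unit b) (matrix_unit b') x :: complex^('n \<times> 'n)^('n \<times> 'n))"

section \<open>The Hessian under linear substitutions\<close>

lemma polarize_monomial:
  "polarize UNIV (monomial j) X = (\<Sum>\<pi> | \<pi> permutes UNIV. \<Prod>a\<in>UNIV. ent (X a) (j (\<pi> a)))"
  unfolding monomial_def[abs_def] by (rule polarize_prod[where scl = mat_scale]) (simp_all add: ent_linear)

lemma polarize_linear:
  fixes q :: "complex^'n^'n \<Rightarrow> complex" and X :: "'n \<Rightarrow> complex^'n^'n"
  assumes "q \<in> Q_space"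
  shows "(\<lambda>Y. polarize UNIV q (X(a := Y))) \<in> linear_forms mat_scale (UNIV :: (complex^'n^'n) set)"
proof -
  obtain c where q: "q = (\<lambda>X. \<Sum>j\<in>UNIV. c j * monomial j X)"
    using assms by (rule Q_expand)
  have "(\<Prod>t\<in>UNIV. ent ((X(a := Y)) t) (j (\<pi> t))) = ent Y (j (\<pi> a)) * (\<Prod>t\<in>UNIV - {a}. ent (X t) (j (\<pi> t)))"
    for Y :: "complex^'n^'n" and j :: "'n \<Rightarrow> 'n \<times> 'n" and \<pi>
    by (subst prod.remove[of _ a]) auto
  then have "polarize UNIV q (X(a := Y)) =
      (\<Sum>j\<in>UNIV. c j * (\<Sum>\<pi> | \<pi> permutes UNIV. ent Y (j (\<pi> a)) * (\<Prod>t\<in>UNIV - {a}. ent (X t) (j (\<pi> t)))))"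
    for Y
    unfolding q polarize_sum polarize_monomial by (simp only:)
  then show ?thesis
    by (simp add: linear_forms_def ent_add ent_scale algebra_simps sum.distrib sum_distrib_left)
qed

lemma hess_linear:
  assumes "q \<in> Q_space" "a1 \<noteq> a2"
  shows "(\<lambda>Y. hess a1 a2 q Y Z x) \<in> linear_forms mat_scale UNIV"
    "(\<lambda>Z. hess a1 a2 q Y Z x) \<in> linear_forms mat_scale UNIV"
  using polarize_linear[OF assms(1), of "(\<lambda>_. x)(a2 := Z)" a1]
    polarize_linear[OF assms(1), of "(\<lambda>_. x)(a1 := Y)" a2] fun_upd_twist[OF assms(2), of "\<lambda>_. x"]
  by (simp_all add: hess_def)

lemma hess_lin: "hess a1 a2 (\<lambda>X. q (lin M X)) Y Z x = hess a1 a2 q (lin M Y) (lin M Z) (lin M x)"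
  unfolding hess_def polarize_def by (simp add: lin_sum if_distrib[of "lin M"] cong: if_cong)

text \<open>The matrix of second derivatives is that of a bilinear form and changes by congruence
  with \<open>M\<close>, hence the square.\<close>

lemma hess_det_lin:
  fixes q :: "complex^'n^'n \<Rightarrow> complex"
  assumes "q \<in> Q_space" "a1 \<noteq> a2"
  shows "hess_det a1 a2 (\<lambda>X. q (lin M X)) x = det M ^ 2 * hess_det a1 a2 q (lin M x)"
proof -
  let ?H = "\<chi> b b'. hess a1 a2 q (matrix_unit b) (matrix_unit b') (lin M x) :: complex^('n \<times> 'n)^('n \<times> 'n)"
  let ?N = "\<chi> b b'. hess a1 a2 (\<lambda>X. q (lin M X)) (matrix_unit b) (matrix_unit b') x :: complex^('n \<times> 'n)^('n \<times> 'n)"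
  have "?N $ b $ b' = (transpose M ** (?H ** M)) $ b $ b'" for b b'
  proof -
    have "?N $ b $ b' = (\<Sum>c'\<in>UNIV. \<Sum>c\<in>UNIV. M $ c $ b * (hess a1 a2 q (matrix_unit c) (matrix_unit c') (lin M x) * M $ c' $ b'))"
      by (simp add: hess_lin lin_matrix_unit sum_distrib_left mult_ac
        linear_forms_sum[OF hess_linear(1)[OF assms]] linear_forms_scale[OF hess_linear(1)[OF assms]]
        linear_forms_sum[OF hess_linear(2)[OF assms]] linear_forms_scale[OF hess_linear(2)[OF assms]])
    also have "\<dots> = (transpose M ** (?H ** M)) $ b $ b'"
      by (subst sum.swap) (simp add: matrix_matrix_mult_def transpose_def sum_distrib_left)
    finally show ?thesis .
  qed
  then have "?N = transpose M ** (?H ** M)"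
    unfolding vec_eq_iff by blast
  then show ?thesis
    unfolding hess_det_def by (simp only: det_mul det_transpose power2_eq_square mult_ac)
qed

section \<open>The Hessian determinant of the determinant as a power of it\<close>

lemma mat_mul_entry: "(mat c ** B) $ i $ j = c * (B :: complex^'i^'i) $ i $ j"
  by (simp add: matrix_matrix_mult_def mat_def if_distrib[of "\<lambda>x. x * _"] cong: if_cong)

lemma hess_scale: "hess a1 a2 (\<lambda>X. c * q X) Y Z x = c * hess a1 a2 q Y Z x"
  by (simp add: hess_def polarize_def sum_distrib_left mult_ac)

lemma hess_det_scale:
  "hess_det a1 a2 (\<lambda>X :: complex^'n^'n. c * q X) x = c ^ (CARD('n) * CARD('n)) * hess_det a1 a2 q x"
proof -
  let ?H = "\<chi> b b'. hess a1 a2 q (matrix_unit b) (matrix_unit b') x :: complex^('n \<times> 'n)^('n \<times> 'n)"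
  have "(\<chi> b b'. hess a1 a2 (\<lambda>X. c * q X) (matrix_unit b) (matrix_unit b') x) = mat c ** ?H"
    by (simp add: vec_eq_iff hess_scale mat_mul_entry)
  moreover have "det (mat c :: complex^('n \<times> 'n)^('n \<times> 'n)) = c ^ (CARD('n) * CARD('n))"
    by (subst det_diagonal) (simp_all add: mat_def)
  ultimately show ?thesis
    by (simp add: hess_det_def det_mul)
qed

text \<open>The form \<open>det (A ** X)\<close> is treated in two ways: as the multiple
  \<open>det A * det X\<close>, which scales all \<open>m^2\<close> rows, and as a substitution by
  \<open>lmul A\<close>, whose determinant \<open>det A ^ m\<close> enters squared.\<close>

lemma hess_det_det_invertible:
  fixes A :: "complex^'n^'n"
  assumes "a1 \<noteq> a2"
  shows "det A ^ (CARD('n) * CARD('n)) * hess_det a1 a2 det (mat 1) =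
    det A ^ (2 * CARD('n)) * hess_det a1 a2 det A"
proof -
  have "hess_det a1 a2 (\<lambda>X. det (lin (lmul A) X)) (mat 1) = det A ^ (2 * CARD('n)) * hess_det a1 a2 det A"
    by (subst hess_det_lin[OF det_Q assms]) (simp add: det_lmul lin_lmul power_mult[symmetric] mult.commute)
  moreover have "(\<lambda>X. det (lin (lmul A) X)) = (\<lambda>X. det A * det X)"
    by (simp add: lin_lmul det_mul)
  ultimately show ?thesis
    by (simp add: hess_det_scale)
qed

lemma continuous_on_det:
  assumes "\<And>i j. continuous_on S (\<lambda>t. F t $ i $ j :: complex)"
  shows "continuous_on S (\<lambda>t. det (F t :: complex^'i^'i))"
  unfolding det_def by (intro continuous_intros assms)

text \<open>The determinant is a polynomial in \<open>t\<close>. With \<open>t = 1 / s\<close> it is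
  a nonzero multiple of \<open>det (1 + s A)\<close>, which tends to 1 as \<open>s\<close> tends to
  0, so the polynomial is nonzero and has finitely many roots. This carries identities from
  invertible to singular matrices by continuity.\<close>

lemma det_perturb_nonzero:
  fixes A :: "complex^'i^'i"
  shows "eventually (\<lambda>t. det (A + mat t) \<noteq> 0) (at 0)"
proof -
  define p where "p = (\<Sum>u\<in>UNIV. smult (eps u) (\<Prod>i\<in>UNIV. [: A $ i $ u i, of_bool (i = u i) :]))"
  have p: "poly p t = det (A + mat t)" for t
    by (auto simp: p_def det_eps poly_sum poly_prod mat_def intro!: sum.cong prod.cong)
  have "p \<noteq> 0"
  proof
    assume "p = 0"
    have "continuous_on UNIV (\<lambda>s :: complex. det (mat 1 + mat s ** A))"
    proof (rule continuous_on_det)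
      have "(mat 1 + mat s ** A) $ i $ j = of_bool (i = j) + s * A $ i $ j" for i j s
        by (simp add: mat_mul_entry) (simp add: mat_def)
      then show "continuous_on UNIV (\<lambda>s. (mat 1 + mat s ** A) $ i $ j)" for i j
        by (simp only:) (intro continuous_intros)
    qed
    from this[unfolded continuous_on_def, rule_format, of 0]
    have "((\<lambda>s :: complex. det (mat 1 + mat s ** A)) \<longlongrightarrow> 1) (at 0)"
      by simp
    then have "eventually (\<lambda>s :: complex. det (mat 1 + mat s ** A) \<noteq> 0) (at 0)"
      by (rule tendsto_imp_eventually_ne) simp
    moreover have "eventually (\<lambda>s :: complex. s \<noteq> 0) (at 0)"
      by (rule eventually_neq_at_within)
    ultimately have "eventually (\<lambda>s :: complex. det (mat 1 + mat s ** A) \<noteq> 0 \<and> s \<noteq> 0) (at 0)"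
      by (rule eventually_conj)
    then obtain s :: complex where s: "det (mat 1 + mat s ** A) \<noteq> 0" "s \<noteq> 0"
      using eventually_happens[of _ "at (0 :: complex)"] by auto
    have "mat 1 + mat s ** A = mat s ** (A + mat (1 / s))"
      using s(2) by (simp add: vec_eq_iff mat_mul_entry) (simp add: mat_def algebra_simps)
    then show False
      using s(1) p[of "1 / s"] \<open>p = 0\<close> by (simp add: det_mul)
  qed
  then have "\<not> 0 islimpt {t. poly p t = 0}"
    by (intro islimpt_finite poly_roots_finite)
  then show ?thesis
    by (simp add: islimpt_iff_eventually p)
qed

text \<open>For invertible \<open>A\<close> the factor \<open>det A ^ (2 m)\<close> cancels and
  leaves the exponent \<open>m^2 - 2 m\<close>; singular \<open>A\<close> are reached as limits of
  \<open>A + mat t\<close>.\<close>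

lemma hess_det_det:
  fixes A :: "complex^'n^'n"
  assumes "a1 \<noteq> a2" "CARD('n) \<ge> 2"
  shows "hess_det a1 a2 det A = hess_det a1 a2 det (mat 1) * det A ^ (CARD('n) * (CARD('n) - 2))"
    (is "_ = ?k * det A ^ ?s")
proof -
  have continuous_on_mat: "continuous_on UNIV (\<lambda>t :: complex. (mat t :: complex^'n^'n) $ i $ j)" for i j
    by (cases "i = j") (simp_all add: mat_def)
  have cont_A: "continuous_on UNIV (\<lambda>t :: complex. det (A + mat t))"
    by (rule continuous_on_det) (simp add: continuous_on_mat continuous_on_add)
  have "continuous_on UNIV (\<lambda>t :: complex. ent (((\<lambda>_. A + mat t)(a2 := Z, a1 := Y)) a) p)" for a Y Z p
    by (cases "a = a1"; cases "a = a2") (simp_all add: ent_def continuous_on_add continuous_on_mat)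
  then have "continuous_on UNIV (\<lambda>t :: complex. ent (\<Sum>a\<in>S. ((\<lambda>_. A + mat t)(a2 := Z, a1 := Y)) a) p)" for S Y Z p
    unfolding ent_sum by (intro continuous_on_sum)
  from this[of _ _ _ "(_, _)"]
  have "continuous_on UNIV (\<lambda>t :: complex. hess a1 a2 det Y Z (A + mat t))" for Y Z
    unfolding hess_def polarize_def
    by (intro continuous_on_sum continuous_on_mult continuous_on_const continuous_on_det)
      (simp add: ent_def)
  then have cont_H: "continuous_on UNIV (\<lambda>t :: complex. hess_det a1 a2 det (A + mat t))"
    unfolding hess_det_def by (intro continuous_on_det) simp
  have "hess_det a1 a2 det B = ?k * det B ^ ?s" if "det B \<noteq> 0" for B :: "complex^'n^'n"
  proof -
    have "CARD('n) * CARD('n) = ?s + 2 * CARD('n)"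
      using assms(2) by (simp add: algebra_simps flip: distrib_left)
    then have "det B ^ (2 * CARD('n)) * (?k * det B ^ ?s) = det B ^ (2 * CARD('n)) * hess_det a1 a2 det B"
      using hess_det_det_invertible[OF assms(1), of B] by (simp add: power_add mult_ac)
    then show ?thesis using that by simp
  qed
  then have ev: "eventually (\<lambda>t. hess_det a1 a2 det (A + mat t) = ?k * det (A + mat t) ^ ?s) (at 0)"
    by (intro eventually_mono[OF det_perturb_nonzero[of A]])
  have "((\<lambda>t :: complex. hess_det a1 a2 det (A + mat t)) \<longlongrightarrow> hess_det a1 a2 det A) (at 0)"
    using cont_H[unfolded continuous_on_def, rule_format, of 0] by simp
  then have "((\<lambda>t :: complex. ?k * det (A + mat t) ^ ?s) \<longlongrightarrow> hess_det a1 a2 det A) (at 0)"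
    using ev by (rule Lim_transform_eventually)
  moreover have "((\<lambda>t :: complex. ?k * det (A + mat t) ^ ?s) \<longlongrightarrow> ?k * det A ^ ?s) (at 0)"
    using cont_A[unfolded continuous_on_def, rule_format, of 0] by (intro tendsto_intros) simp
  ultimately show ?thesis
    by (rule tendsto_unique[OF at_neq_bot])
qed

section \<open>Nondegeneracy of the Hessian of the determinant at the identity\<close>

lemma polarize_det:
  "polarize UNIV det (X :: 'n \<Rightarrow> complex^'n^'n) =
    (\<Sum>\<pi> | \<pi> permutes UNIV. \<Sum>u\<in>UNIV. eps u * (\<Prod>a\<in>UNIV. X a $ \<pi> a $ u (\<pi> a)))"
proof -
  have "polarize UNIV det X = (\<Sum>u\<in>UNIV. eps u * polarize UNIV (\<lambda>A. \<Prod>a\<in>UNIV. ent A (a, u a)) X)"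
    unfolding det_eps[abs_def] polarize_sum by (simp add: ent_def)
  also have "\<dots> = (\<Sum>u\<in>UNIV. eps u * (\<Sum>\<pi> | \<pi> permutes UNIV. \<Prod>a\<in>UNIV. X a $ \<pi> a $ u (\<pi> a)))"
    by (subst polarize_prod[where scl = mat_scale]) (simp_all only: ent_linear finite_class.finite_UNIV, simp add: ent_def)
  finally show ?thesis
    by (simp add: sum_distrib_left) (rule sum.swap)
qed

lemma eps_two_values:
  assumes "i \<noteq> k"
  shows "eps (id(i := j, k := l)) = of_bool (j = i \<and> l = k) - of_bool (j = k \<and> l = i)"
proof -
  consider "j = i" "l = k" | "j = k" "l = i" | "\<not> (j = i \<and> l = k)" "\<not> (j = k \<and> l = i)" by blast
  then show ?thesis
  proof cases
    case 1
    then have "id(i := j, k := l) = id" by auto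
    then show ?thesis using 1 assms by (simp add: eps_def)
  next
    case 2
    then have "id(i := j, k := l) = Transposition.transpose i k"
      using assms by (auto simp: Transposition.transpose_def)
    then show ?thesis using 2 assms by (simp add: eps_def sign_swap_id)
  next
    case 3
    have "\<not> inj (id(i := j, k := l))"
    proof
      assume inj: "inj (id(i := j, k := l))"
      let ?u = "id(i := j, k := l)"
      have *: "?u i = j" "?u k = l" using assms by auto
      have "j \<in> {i, k}"
      proof (rule ccontr)
        assume "j \<notin> {i, k}"
        then have "?u j = ?u i" using * by simp
        from injD[OF inj this] show False using \<open>j \<notin> {i, k}\<close> by simp
      qed
      moreover have "l \<in> {i, k}"
      proof (rule ccontr)
        assume "l \<notin> {i, k}"
        then have "?u l = ?u k" by simp
        from injD[OF inj this] show False using \<open>l \<notin> {i, k}\<close> by simp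
      qed
      moreover have "j \<noteq> l"
      proof
        assume "j = l"
        then have "?u i = ?u k" using * by simp
        from injD[OF inj this] show False using assms by simp
      qed
      ultimately show False using 3 by auto
    qed
    then show ?thesis using 3 by (auto simp: eps_def bij_def)
  qed
qed

text \<open>This is the classical second derivative \<open>tr Y tr Z - tr (Y Z)\<close> of the
  determinant at the identity, evaluated at matrix units. The constant \<open>N\<close> is the
  number of permutations with two prescribed values.\<close>

lemma hess_mat_1:
  assumes "a1 \<noteq> (a2 :: 'n)"
  obtains N :: complex where "N \<noteq> 0"
    "\<And>i j k l. hess a1 a2 det (matrix_unit (i, j)) (matrix_unit (k, l)) (mat 1 :: complex^'n^'n) =
       N * of_bool (i \<noteq> k) * (of_bool (j = i \<and> l = k) - of_bool (j = k \<and> l = i))"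
proof -
  define P where "P i k = {\<pi>. \<pi> permutes (UNIV :: 'n set) \<and> \<pi> a1 = i \<and> \<pi> a2 = k}" for i k
  have card: "card (P i k) = card (P a1 a2)" if "i \<noteq> k" for i k
  proof -
    \<comment> \<open>\<open>?\<rho>\<close> is built to send \<open>i\<close> to \<open>a1\<close>
      and \<open>k\<close> to \<open>a2\<close>; composition with it shows that the count does not
      depend on \<open>i\<close> and \<open>k\<close>.\<close>
    let ?t = "Transposition.transpose i a1"
    let ?\<rho> = "Transposition.transpose (?t k) a2 \<circ> ?t"
    have \<rho>: "?\<rho> permutes UNIV"
      by (intro permutes_compose permutes_swap_id) auto
    have "?t k \<noteq> a1" using that by (auto simp: Transposition.transpose_def)
    then have "?\<rho> i = a1" using assms by (simp add: Transposition.transpose_def)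
    moreover have "?\<rho> k = a2" by simp
    ultimately have \<rho>': "inv_into UNIV ?\<rho> a1 = i" "inv_into UNIV ?\<rho> a2 = k"
      using permutes_inverses(2)[OF \<rho>] by metis+
    have "bij_betw (\<lambda>\<pi>. ?\<rho> \<circ> \<pi>) (P i k) (P a1 a2)"
    proof (rule bij_betw_byWitness[where f' = "\<lambda>\<pi>. inv_into UNIV ?\<rho> \<circ> \<pi>"])
      show "\<forall>\<pi>\<in>P i k. inv_into UNIV ?\<rho> \<circ> (?\<rho> \<circ> \<pi>) = \<pi>"
        by (simp only: comp_assoc[symmetric, of _ ?\<rho>] comp_assoc[symmetric, of ?\<rho>] permutes_inv_o[OF \<rho>] id_comp) simp
      show "\<forall>\<pi>\<in>P a1 a2. ?\<rho> \<circ> (inv_into UNIV ?\<rho> \<circ> \<pi>) = \<pi>"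
        by (simp only: comp_assoc[symmetric, of _ ?\<rho>] comp_assoc[symmetric, of ?\<rho>] permutes_inv_o[OF \<rho>] id_comp) simp
      show "(\<lambda>\<pi>. ?\<rho> \<circ> \<pi>) ` P i k \<subseteq> P a1 a2"
        using permutes_compose[OF _ \<rho>] \<open>?\<rho> i = a1\<close> \<open>?\<rho> k = a2\<close> by (auto simp: P_def simp del: comp_apply) (auto simp: P_def)
      show "(\<lambda>\<pi>. inv_into UNIV ?\<rho> \<circ> \<pi>) ` P a1 a2 \<subseteq> P i k"
        using permutes_compose[OF _ permutes_inv[OF \<rho>]] \<rho>' by (auto simp: P_def)
    qed
    then show ?thesis by (rule bij_betw_same_card)
  qed
  have fin: "finite (P a1 a2)"
    by (rule finite_subset[OF _ finite_permutations[of UNIV]]) (auto simp: P_def)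
  have "id \<in> P a1 a2" by (auto simp: P_def permutes_id)
  then have N: "of_nat (card (P a1 a2)) \<noteq> (0 :: complex)"
    using fin by auto
  show ?thesis
  proof (rule that[OF N])
    fix i j k l
    let ?X = "(\<lambda>_. mat 1 :: complex^'n^'n)(a2 := matrix_unit (k, l), a1 := matrix_unit (i, j))"
    \<comment> \<open>All slots but \<open>a1\<close> and \<open>a2\<close> hold the identity
      matrix, so a nonzero product forces \<open>u\<close> to fix every row other than
      \<open>i\<close> and \<open>k\<close>.\<close>
    have prod: "(\<Prod>a\<in>UNIV. ?X a $ \<pi> a $ u (\<pi> a)) =
      of_bool (\<pi> \<in> P i k \<and> i \<noteq> k \<and> u = id(i := j, k := l))" if \<pi>: "\<pi> permutes UNIV" for \<pi> u
    proof -
      have inj: "\<pi> x = \<pi> y \<longleftrightarrow> x = y" for x y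
        using permutes_inj[OF \<pi>] by (auto simp: inj_def)
      have "?X a $ \<pi> a $ u (\<pi> a) = of_bool (if a = a1 then \<pi> a = i \<and> u (\<pi> a) = j
          else if a = a2 then \<pi> a = k \<and> u (\<pi> a) = l else u (\<pi> a) = \<pi> a)" for a
        by (auto simp: matrix_unit_def mat_def)
      then have "(\<Prod>a\<in>UNIV. ?X a $ \<pi> a $ u (\<pi> a)) =
          of_bool (\<forall>a\<in>UNIV. if a = a1 then \<pi> a = i \<and> u (\<pi> a) = j
          else if a = a2 then \<pi> a = k \<and> u (\<pi> a) = l else u (\<pi> a) = \<pi> a)" (is "_ = of_bool (\<forall>a\<in>UNIV. ?R a)")
        by (simp only: prod_of_bool[OF finite_class.finite_UNIV])
      also have "(\<forall>a\<in>UNIV. ?R a) \<longleftrightarrow> \<pi> \<in> P i k \<and> i \<noteq> k \<and> u = id(i := j, k := l)"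
      proof
        assume R: "\<forall>a\<in>UNIV. ?R a"
        then have 1: "\<pi> a1 = i" "u i = j" "\<pi> a2 = k" "u k = l"
          using R[rule_format, of a1, OF UNIV_I] R[rule_format, of a2, OF UNIV_I] assms by auto
        have "i \<noteq> k" using 1 inj assms by auto
        moreover have "u b = (id(i := j, k := l)) b" for b
        proof -
          obtain a where "b = \<pi> a" using permutes_surj[OF \<pi>] by blast
          then show ?thesis using R[rule_format, of a, OF UNIV_I] 1 inj assms by (auto split: if_splits)
        qed
        ultimately show "\<pi> \<in> P i k \<and> i \<noteq> k \<and> u = id(i := j, k := l)"
          using 1 \<pi> by (auto simp: P_def)
      next
        assume "\<pi> \<in> P i k \<and> i \<noteq> k \<and> u = id(i := j, k := l)"
        then show "\<forall>a\<in>UNIV. ?R a" using inj by (auto simp: P_def)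
      qed
      finally show ?thesis .
    qed
    have "hess a1 a2 det (matrix_unit (i, j)) (matrix_unit (k, l)) (mat 1) =
      (\<Sum>\<pi> | \<pi> permutes UNIV. \<Sum>u\<in>UNIV. eps u * of_bool (\<pi> \<in> P i k \<and> i \<noteq> k \<and> u = id(i := j, k := l)))"
      unfolding hess_def polarize_det by (intro sum.cong refl) (simp only: prod mem_Collect_eq)
    also have "\<dots> = (\<Sum>\<pi> | \<pi> permutes UNIV. of_bool (\<pi> \<in> P i k) * of_bool (i \<noteq> k) * eps (id(i := j, k := l)))"
    proof -
      have "(\<Sum>u\<in>UNIV. eps u * of_bool (R \<and> S \<and> u = v)) = of_bool R * of_bool S * eps v"
        for v :: "'n \<Rightarrow> 'n" and R S
        by (cases R; cases S) (simp_all add: of_bool_def if_distrib[of "\<lambda>x. _ * x"] cong: if_cong)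
      then show ?thesis by (intro sum.cong refl)
    qed
    also have "\<dots> = (\<Sum>\<pi> | \<pi> permutes UNIV. of_bool (\<pi> \<in> P i k)) * (of_bool (i \<noteq> k) * eps (id(i := j, k := l)))"
      by (simp only: sum_distrib_right mult.assoc)
    also have "(\<Sum>\<pi> | \<pi> permutes (UNIV :: 'n set). of_bool (\<pi> \<in> P i k)) = (of_nat (card (P i k)) :: complex)"
    proof -
      have "{\<pi>. \<pi> permutes UNIV} \<inter> {\<pi>. \<pi> \<in> P i k} = P i k" by (auto simp: P_def)
      then show ?thesis by (simp add: finite_permutations)
    qed
    also have "of_nat (card (P i k)) * (of_bool (i \<noteq> k) * eps (id(i := j, k := l))) =
       of_nat (card (P a1 a2)) * of_bool (i \<noteq> k) * (of_bool (j = i \<and> l = k) - of_bool (j = k \<and> l = i))"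
    proof (cases "i = k")
      case False
      then show ?thesis by (simp only: card[OF False] eps_two_values[OF False] mult.assoc)
    qed simp
    finally show "hess a1 a2 det (matrix_unit (i, j)) (matrix_unit (k, l)) (mat 1) = \<dots>" .
  qed
qed

text \<open>A matrix \<open>z\<close> in the kernel of \<open>tr Y tr Z - tr (Y Z)\<close> equals
  \<open>tr z\<close> times the identity. Taking traces gives \<open>tr z = m tr z\<close>, and
  \<open>m \<noteq> 1\<close> because there are two distinct slots.\<close>

lemma hess_det_nonzero:
  assumes "a1 \<noteq> (a2 :: 'n)"
  shows "hess_det a1 a2 det (mat 1 :: complex^'n^'n) \<noteq> 0"
proof -
  obtain N :: complex where N: "N \<noteq> 0" and
    H: "\<And>i j k l. hess a1 a2 det (matrix_unit (i, j)) (matrix_unit (k, l)) (mat 1 :: complex^'n^'n) =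
       N * of_bool (i \<noteq> k) * (of_bool (j = i \<and> l = k) - of_bool (j = k \<and> l = i))"
    using hess_mat_1[OF assms] by blast
  let ?H = "\<chi> b b'. hess a1 a2 det (matrix_unit b) (matrix_unit b') (mat 1) :: complex^('n \<times> 'n)^('n \<times> 'n)"
  have "z = 0" if z: "?H *v z = 0" for z
  proof -
    have row: "(\<Sum>k\<in>UNIV. \<Sum>l\<in>UNIV. of_bool (i \<noteq> k) * (of_bool (j = i \<and> l = k) - of_bool (j = k \<and> l = i)) * z $ (k, l)) = 0"
      for i j
    proof -
      have "(?H *v z) $ (i, j) = (\<Sum>k\<in>UNIV. \<Sum>l\<in>UNIV.
          hess a1 a2 det (matrix_unit (i, j)) (matrix_unit (k, l)) (mat 1) * z $ (k, l))"
        by (simp only: sum.cartesian_product) (simp add: matrix_vector_mult_def case_prod_beta')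
      also have "\<dots> = N * (\<Sum>k\<in>UNIV. \<Sum>l\<in>UNIV.
          of_bool (i \<noteq> k) * (of_bool (j = i \<and> l = k) - of_bool (j = k \<and> l = i)) * z $ (k, l))"
        by (simp only: H sum_distrib_left mult.assoc)
      finally have "(?H *v z) $ (i, j) = \<dots>" .
      then show ?thesis using z N by simp
    qed
    have off: "z $ (j, i) = 0" if "i \<noteq> j" for i j
    proof -
      have "(\<Sum>k\<in>UNIV. \<Sum>l\<in>UNIV. of_bool (i \<noteq> k) * (of_bool (j = i \<and> l = k) - of_bool (j = k \<and> l = i)) * z $ (k, l)) =
         (\<Sum>k\<in>UNIV. \<Sum>l\<in>UNIV. if l = i then if k = j then - z $ (k, l) else 0 else 0)"
        using that by (intro sum.cong refl) auto
      also have "\<dots> = - z $ (j, i)" by simp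
      finally show ?thesis using row[of i j] by simp
    qed
    have diag: "z $ (i, i) = (\<Sum>k\<in>UNIV. z $ (k, k))" for i
    proof -
      have "(\<Sum>k\<in>UNIV. \<Sum>l\<in>UNIV. of_bool (i \<noteq> k) * (of_bool (i = i \<and> l = k) - of_bool (i = k \<and> l = i)) * z $ (k, l)) =
         (\<Sum>k\<in>UNIV. \<Sum>l\<in>UNIV. if l = k then if k = i then 0 else z $ (k, k) else 0)"
        by (intro sum.cong refl) auto
      also have "\<dots> = (\<Sum>k\<in>UNIV. if k = i then 0 else z $ (k, k))" by simp
      also have "\<dots> = (\<Sum>k\<in>UNIV - {i}. z $ (k, k))"
        by (rule sum.mono_neutral_cong_right) auto
      finally have "(\<Sum>k\<in>UNIV - {i}. z $ (k, k)) = 0"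
        using row[of i i] by simp
      then show ?thesis
        using sum.remove[of UNIV i "\<lambda>k. z $ (k, k)"] by simp
    qed
    let ?t = "\<Sum>k\<in>UNIV. z $ (k, k)"
    have "?t = (\<Sum>k\<in>(UNIV :: 'n set). ?t)"
      by (rule sum.cong[OF refl diag])
    then have "?t = of_nat CARD('n) * ?t"
      by (simp only: sum_constant)
    moreover have "CARD('n) \<noteq> 1"
      using assms by (metis UNIV_I card_1_singletonE singletonD)
    ultimately have "?t = 0" by simp
    then have "z $ (i, j) = 0" for i j
      using off[of j i] diag[of i] by (cases "i = j") auto
    then show ?thesis by (simp add: vec_eq_iff)
  qed
  then have "\<exists>B. B ** ?H = mat 1"
    by (simp add: matrix_left_invertible_ker)
  then obtain B where "B ** ?H = mat 1" by blast
  then have "det B * det ?H = 1" by (simp flip: det_mul)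
  then show ?thesis unfolding hess_det_def by auto
qed

lemma lin_mat: "lin (mat t) X = mat_scale t X"
  by (rule ent_eqI) (simp add: ent_lin ent_scale mat_def if_distrib[of "\<lambda>x. x * _"] cong: if_cong)

lemma det_mat_scalar: "det (mat t :: complex^'i^'i) = t ^ CARD('i)"
  by (subst det_diagonal) (simp_all add: mat_def)

lemma Q_mat_scale:
  fixes q :: "complex^'n^'n \<Rightarrow> complex"
  assumes "q \<in> Q_space" shows "q (mat_scale t X) = t ^ CARD('n) * q X"
proof -
  obtain a where "q = (\<lambda>X. \<Sum>j\<in>UNIV. a j * monomial j X)"
    using assms by (rule Q_expand)
  then show ?thesis
    by (simp add: monomial_def ent_scale prod.distrib sum_distrib_left mult_ac)
qed

section \<open>Linear forms and polynomial functions on the space of forms\<close>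

lemma Q_linear_sum:
  assumes \<phi>: "\<phi> \<in> linear_forms fun_scale Q_space" and F: "\<And>i. i \<in> I \<Longrightarrow> F i \<in> Q_space"
  shows "\<phi> (\<lambda>X. \<Sum>i\<in>I. c i * F i X) = (\<Sum>i\<in>I. c i * \<phi> (F i))"
proof -
  have zero: "\<phi> (\<lambda>X. 0) = 0"
  proof -
    have "\<phi> (fun_scale 0 det) = 0 * \<phi> det"
      using \<phi> det_Q unfolding linear_forms_def by blast
    then show ?thesis by (simp add: fun_scale_def)
  qed
  have add: "\<phi> (\<lambda>X. q X + p X) = \<phi> q + \<phi> p" if "q \<in> Q_space" "p \<in> Q_space" for q p
    using \<phi> that unfolding linear_forms_def by (auto simp: plus_fun_def)
  have scale: "\<phi> (\<lambda>X. a * q X) = a * \<phi> q" if "q \<in> Q_space" for q a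
    using \<phi> that unfolding linear_forms_def by (auto simp: fun_scale_def)
  show ?thesis
    using F
  proof (induction I rule: infinite_finite_induct)
    case (insert i I)
    have "\<phi> (\<lambda>X. \<Sum>i\<in>insert i I. c i * F i X) = \<phi> (\<lambda>X. c i * F i X + (\<Sum>i\<in>I. c i * F i X))"
      using insert by simp
    also have "\<dots> = \<phi> (\<lambda>X. c i * F i X) + \<phi> (\<lambda>X. \<Sum>i\<in>I. c i * F i X)"
      using insert by (intro add Q_scale Q_sum) auto
    finally show ?case using insert by (simp add: scale)
  qed (simp_all add: zero)
qed

lemma Q_linear_scale:
  assumes "\<phi> \<in> linear_forms fun_scale Q_space" "q \<in> Q_space"
  shows "\<phi> (\<lambda>X. c * q X) = c * \<phi> q"
  using Q_linear_sum[OF assms(1), of "{()}" "\<lambda>_. q" "\<lambda>_. c"] assms(2) by simp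

lemma Q_linear_monomials:
  assumes "\<phi> \<in> linear_forms fun_scale Q_space"
  shows "\<phi> (\<lambda>X. \<Sum>j\<in>UNIV. c j * monomial j X) = (\<Sum>j\<in>UNIV. c j * \<phi> (monomial j))"
  using assms by (rule Q_linear_sum) (rule monomial_Q)

lemma linear_forms_Q_lin:
  fixes \<phi> :: "(complex^'n^'n \<Rightarrow> complex) \<Rightarrow> complex"
  assumes "\<phi> \<in> linear_forms fun_scale Q_space"
  shows "(\<lambda>q. \<phi> (\<lambda>X. q (lin N X))) \<in> linear_forms fun_scale Q_space"
proof -
  have "\<phi> ((\<lambda>X. q (lin N X)) + (\<lambda>X. p (lin N X))) = \<phi> (\<lambda>X. q (lin N X)) + \<phi> (\<lambda>X. p (lin N X))"
    if "q \<in> Q_space" "p \<in> Q_space" for q p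
    using assms Q_lin[OF that(1)] Q_lin[OF that(2)] unfolding linear_forms_def by blast
  then show ?thesis
    using Q_linear_scale[OF assms Q_lin] by (simp add: linear_forms_def fun_scale_def plus_fun_def)
qed

lemma polyfun_Q_lin:
  assumes "polyfun fun_scale Q_space G"
  shows "polyfun fun_scale Q_space (\<lambda>q. G (\<lambda>X. q (lin N X)))"
  using assms
  by (induction rule: polyfun.induct) (auto intro: polyfun.intros linear_forms_Q_lin)

text \<open>Substituting linear forms for the variables makes each coefficient of the substituted
  form homogeneous of degree \<open>m\<close> in the entries of \<open>M\<close>; this is the degree
  count behind the later contractions.\<close>

lemma forms_Q_lin_linear:
  fixes q :: "complex^'n^'n \<Rightarrow> complex"
  assumes "\<phi> \<in> linear_forms fun_scale Q_space" "q \<in> Q_space"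
  shows "(\<lambda>M. \<phi> (\<lambda>X. q (lin M X))) \<in> forms mat_scale UNIV CARD('n)"
proof -
  obtain c where q: "q = (\<lambda>X. \<Sum>j\<in>UNIV. c j * monomial j X)"
    using assms(2) by (rule Q_expand)
  have "\<phi> (\<lambda>X. q (lin M X)) = (\<Sum>i\<in>UNIV. (\<Sum>j\<in>UNIV. c j * (\<Prod>a\<in>UNIV. ent M (j a, i a))) * \<phi> (monomial i))" for M
  proof -
    have "(\<lambda>X. q (lin M X)) = (\<lambda>X. \<Sum>i\<in>UNIV. (\<Sum>j\<in>UNIV. c j * (\<Prod>a\<in>UNIV. ent M (j a, i a))) * monomial i X)"
      unfolding q monomial_lin sum_distrib_left sum_distrib_right
      by (subst sum.swap) (simp add: ent_def mult.assoc)
    then show ?thesis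
      by (simp only: Q_linear_monomials[OF assms(1)])
  qed
  moreover have "(\<lambda>M. \<Prod>a\<in>UNIV. ent M (j a, i a)) \<in> forms mat_scale UNIV CARD('n)" for i j :: "'n \<Rightarrow> 'n \<times> 'n"
    by (rule forms_prod_linear) (simp_all add: ent_linear)
  ultimately show ?thesis
    by (simp add: mult.commute[of _ "\<phi> _"] forms_sum forms_scale)
qed

lemma forms_Q_lin:
  fixes q :: "complex^'n^'n \<Rightarrow> complex"
  assumes "F \<in> forms fun_scale Q_space d" "q \<in> Q_space"
  shows "(\<lambda>M. F (\<lambda>X. q (lin M X))) \<in> forms mat_scale UNIV (d * CARD('n))"
proof -
  obtain N :: nat and c \<phi> where
    1: "\<forall>i<N. \<forall>j<d. \<phi> i j \<in> linear_forms fun_scale Q_space"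
      "\<forall>q\<in>Q_space. F q = (\<Sum>i<N. c i * (\<Prod>j<d. \<phi> i j q))"
    using assms(1) unfolding forms_def by blast
  have "(\<lambda>M. \<Prod>j<d. \<phi> i j (\<lambda>X. q (lin M X))) \<in> forms mat_scale UNIV (\<Sum>j<d. CARD('n))" if "i < N" for i
    using 1(1) that assms(2) by (intro forms_prod forms_Q_lin_linear) auto
  then have "(\<lambda>M. \<Sum>i<N. c i * (\<Prod>j<d. \<phi> i j (\<lambda>X. q (lin M X)))) \<in> forms mat_scale UNIV (d * CARD('n))"
    by (intro forms_sum forms_scale) auto
  then show ?thesis
    using 1(2) Q_lin[OF assms(2)] by simp
qed

section \<open>Continuity and differentiation of polynomial functions of a form\<close>

lemma continuous_on_linear_form:
  assumes "\<phi> \<in> linear_forms mat_scale UNIV" "\<And>p. continuous_on S (\<lambda>t. ent (M t) p)"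
  shows "continuous_on S (\<lambda>t. \<phi> (M t))"
  by (subst linear_forms_expand[OF assms(1)]) (intro continuous_intros assms(2))

lemma continuous_on_forms:
  assumes "F \<in> forms mat_scale UNIV d" "\<And>p. continuous_on S (\<lambda>t. ent (M t) p)"
  shows "continuous_on S (\<lambda>t. F (M t))"
proof -
  obtain N :: nat and c \<phi> where
    1: "\<forall>i<N. \<forall>j<d. \<phi> i j \<in> linear_forms mat_scale UNIV"
      "\<forall>x\<in>UNIV. F x = (\<Sum>i<N. c i * (\<Prod>j<d. \<phi> i j x))"
    using assms(1) unfolding forms_def by blast
  have "continuous_on S (\<lambda>t. \<Sum>i<N. c i * (\<Prod>j<d. \<phi> i j (M t)))"
    using 1(1) by (intro continuous_intros continuous_on_linear_form[OF _ assms(2)]) auto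
  then show ?thesis using 1(2) by simp
qed

lemma continuous_on_polyfun:
  assumes "polyfun fun_scale Q_space G" "q \<in> Q_space" "\<And>p. continuous_on S (\<lambda>t. ent (M t) p)"
  shows "continuous_on S (\<lambda>t. G (\<lambda>X. q (lin (M t) X)))"
  using assms(1)
proof (induction rule: polyfun.induct)
  case (linear \<phi>)
  then show ?case
    by (rule continuous_on_forms[OF forms_Q_lin_linear[OF _ assms(2)] assms(3)])
qed (auto intro!: continuous_intros)

text \<open>The sum and product rules build the differential along the generation of
  \<open>G\<close>, so polynomial dependence on the base point and linearity in the direction come
  with it. In \<open>D p q\<close> the direction is \<open>p\<close> and the base point is
  \<open>q\<close>.\<close>

lemma polyfun_derivative:
  fixes G :: "(complex^'n^'n \<Rightarrow> complex) \<Rightarrow> complex"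
  assumes "polyfun fun_scale Q_space G"
  shows "\<exists>D. (\<forall>p\<in>Q_space. polyfun fun_scale Q_space (D p)) \<and>
    (\<forall>q\<in>Q_space. (\<lambda>p. D p q) \<in> linear_forms fun_scale Q_space) \<and>
    (\<forall>q\<in>Q_space. \<forall>p\<in>Q_space. ((\<lambda>s. G (\<lambda>X. q X + s * p X)) has_field_derivative D p q) (at 0))"
  using assms
proof (induction rule: polyfun.induct)
  case (const c)
  show ?case
    by (rule exI[of _ "\<lambda>_ _. 0"]) (auto intro: polyfun.intros simp: linear_forms_def)
next
  case (linear \<phi>)
  have "\<phi> (\<lambda>X. q X + s * p X) = \<phi> q + s * \<phi> p" if "q \<in> Q_space" "p \<in> Q_space" for q p s
    using Q_linear_sum[OF linear, of "{True, False}" "\<lambda>b. if b then q else p" "\<lambda>b. if b then 1 else s"] that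
    by simp
  then show ?case
    using linear by (intro exI[of _ "\<lambda>p _. \<phi> p"]) (auto intro!: polyfun.intros derivative_eq_intros)
next
  case (add F H)
  then obtain D E where
    D: "\<forall>p\<in>Q_space. polyfun fun_scale Q_space (D p)"
      "\<forall>q\<in>Q_space. (\<lambda>p. D p q) \<in> linear_forms fun_scale Q_space"
      "\<forall>q\<in>Q_space. \<forall>p\<in>Q_space. ((\<lambda>s. F (\<lambda>X. q X + s * p X)) has_field_derivative D p q) (at 0)" and
    E: "\<forall>p\<in>Q_space. polyfun fun_scale Q_space (E p)"
      "\<forall>q\<in>Q_space. (\<lambda>p. E p q) \<in> linear_forms fun_scale Q_space"
      "\<forall>q\<in>Q_space. \<forall>p\<in>Q_space. ((\<lambda>s. H (\<lambda>X. q X + s * p X)) has_field_derivative E p q) (at 0)"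
    by blast
  show ?case
  proof (intro exI[of _ "\<lambda>p q. D p q + E p q"] conjI ballI)
    show "(\<lambda>p. D p q + E p q) \<in> linear_forms fun_scale Q_space" if "q \<in> Q_space" for q
      using D(2) E(2) that by (auto simp: linear_forms_def algebra_simps)
    show "polyfun fun_scale Q_space (\<lambda>q. D p q + E p q)" if "p \<in> Q_space" for p
      using D(1) E(1) that by (intro polyfun.add) auto
  qed (use D E in \<open>auto intro!: DERIV_add\<close>)
next
  case (mult F H)
  then obtain D E where
    D: "\<forall>p\<in>Q_space. polyfun fun_scale Q_space (D p)"
      "\<forall>q\<in>Q_space. (\<lambda>p. D p q) \<in> linear_forms fun_scale Q_space"
      "\<forall>q\<in>Q_space. \<forall>p\<in>Q_space. ((\<lambda>s. F (\<lambda>X. q X + s * p X)) has_field_derivative D p q) (at 0)" and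
    E: "\<forall>p\<in>Q_space. polyfun fun_scale Q_space (E p)"
      "\<forall>q\<in>Q_space. (\<lambda>p. E p q) \<in> linear_forms fun_scale Q_space"
      "\<forall>q\<in>Q_space. \<forall>p\<in>Q_space. ((\<lambda>s. H (\<lambda>X. q X + s * p X)) has_field_derivative E p q) (at 0)"
    by blast
  show ?case
  proof (intro exI[of _ "\<lambda>p q. D p q * H q + F q * E p q"] conjI ballI)
    show "(\<lambda>p. D p q * H q + F q * E p q) \<in> linear_forms fun_scale Q_space" if "q \<in> Q_space" for q
      using D(2) E(2) that by (auto simp: linear_forms_def algebra_simps)
    show "polyfun fun_scale Q_space (\<lambda>q. D p q * H q + F q * E p q)" if "p \<in> Q_space" for p
      using D(1) E(1) that mult.hyps by (intro polyfun.add polyfun.mult) auto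
    show "((\<lambda>s. F (\<lambda>X. q X + s * p X) * H (\<lambda>X. q X + s * p X)) has_field_derivative
        D p q * H q + F q * E p q) (at 0)" if "q \<in> Q_space" "p \<in> Q_space" for p q
      using DERIV_mult'[OF D(3)[rule_format, OF that] E(3)[rule_format, OF that]] by (simp add: algebra_simps)
  qed
qed

lemma contract_scale: "contract r \<mu> (\<lambda>x. c * F x) = c * contract r \<mu> F"
  using contract_sum[of r \<mu> "\<lambda>_. c" "\<lambda>_. F" "{()}"] by simp

lemma contract_scale_left: "contract r (\<lambda>j. c * \<mu> j) F = c ^ r * contract r \<mu> F"
  by (simp add: contract_def prod.distrib sum_distrib_left mult_ac)

text \<open>On one block, contraction with the symbol \<open>\<phi> (monomial j)\<close> is
  \<open>\<phi>\<close> applied to the product of the \<open>m\<close> linear forms. There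
  \<open>h\<close> inside \<open>\<phi>\<close> and \<open>g\<close> inside the form cancel.\<close>

lemma contract_lin:
  fixes \<phi> :: "(complex^'n^'n \<Rightarrow> complex) \<Rightarrow> complex"
  assumes \<phi>: "\<phi> \<in> linear_forms fun_scale Q_space" and inv: "\<And>X. lin g (lin h X) = X"
    and F: "F \<in> forms mat_scale UNIV (r * CARD('n))"
  shows "contract r (\<lambda>j. \<phi> (\<lambda>X. monomial j (lin h X))) (\<lambda>x. F (lin g x)) = contract r (\<lambda>j. \<phi> (monomial j)) F"
proof -
  obtain N :: nat and c \<psi> where
    "\<forall>i<N. \<forall>t\<in>(blocks r :: (nat \<times> 'n) set). \<psi> i t \<in> linear_forms mat_scale UNIV"
    "\<forall>x\<in>UNIV. F x = (\<Sum>i<N. c i * (\<Prod>t\<in>blocks r. \<psi> i t x))"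
    by (rule formsE[OF F, of "blocks r :: (nat \<times> 'n) set"], simp, simp, rule that)
  then have \<psi>: "\<And>i t. i < N \<Longrightarrow> t \<in> blocks r \<Longrightarrow> \<psi> i t \<in> linear_forms mat_scale UNIV"
    and F: "F = (\<lambda>x. \<Sum>i<N. c i * (\<Prod>t\<in>blocks r. \<psi> i t x))"
    by blast+
  have eq: "(\<Sum>j\<in>UNIV. \<phi> (\<lambda>X. monomial j (lin h X)) * (\<Prod>a\<in>UNIV. \<xi> a (lin g (matrix_unit (j a))))) =
      (\<Sum>j\<in>UNIV. \<phi> (monomial j) * (\<Prod>a\<in>UNIV. \<xi> a (matrix_unit (j a))))"
    if \<xi>: "\<And>a. \<xi> a \<in> linear_forms mat_scale UNIV" for \<xi> :: "'n \<Rightarrow> complex^'n^'n \<Rightarrow> complex"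
  proof -
    have "(\<Sum>j\<in>UNIV. \<phi> (\<lambda>X. monomial j (lin h X)) * (\<Prod>a\<in>UNIV. \<xi> a (lin g (matrix_unit (j a))))) =
        \<phi> (\<lambda>X. \<Sum>j\<in>UNIV. (\<Prod>a\<in>UNIV. \<xi> a (lin g (matrix_unit (j a)))) * monomial j (lin h X))"
      by (subst Q_linear_sum[OF \<phi> Q_lin[OF monomial_Q]]) (simp add: mult.commute)
    also have "(\<lambda>X. \<Sum>j\<in>UNIV. (\<Prod>a\<in>UNIV. \<xi> a (lin g (matrix_unit (j a)))) * monomial j (lin h X)) =
        (\<lambda>X. \<Prod>a\<in>UNIV. \<xi> a (lin g (lin h X)))"
      by (rule ext) (rule prod_linear_expand[OF linear_forms_lin[OF \<xi>], symmetric])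
    also have "\<dots> = (\<lambda>X. \<Prod>a\<in>UNIV. \<xi> a X)"
      by (simp only: inv)
    also have "\<dots> = (\<lambda>X. \<Sum>j\<in>UNIV. (\<Prod>a\<in>UNIV. \<xi> a (matrix_unit (j a))) * monomial j X)"
      by (simp add: prod_linear_expand[OF \<xi>])
    also have "\<phi> \<dots> = (\<Sum>j\<in>UNIV. \<phi> (monomial j) * (\<Prod>a\<in>UNIV. \<xi> a (matrix_unit (j a))))"
      by (subst Q_linear_monomials[OF \<phi>]) (simp add: mult.commute)
    finally show ?thesis .
  qed
  have "contract r (\<lambda>j. \<phi> (\<lambda>X. monomial j (lin h X))) (\<lambda>x. \<Prod>t\<in>blocks r. \<psi> i t (lin g x)) =
      contract r (\<lambda>j. \<phi> (monomial j)) (\<lambda>x. \<Prod>t\<in>blocks r. \<psi> i t x)" if i: "i < N" for i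
  proof -
    have "\<psi> i (\<pi> (l, a)) \<in> linear_forms mat_scale UNIV" if "\<pi> permutes blocks r" "l < r" for \<pi> l a
      using \<psi>[OF i] that by (simp add: permutes_in_image)
    then show ?thesis
      by (simp only: contract_prod[OF \<psi>[OF i]] contract_prod[OF linear_forms_lin[OF \<psi>[OF i]]])
        (intro sum.cong prod.cong refl eq, auto)
  qed
  then show ?thesis
    unfolding F by (simp add: contract_sum)
qed

section \<open>Semi-invariants\<close>

text \<open>The condition \<open>pos\<close> excludes constants, whose differential at
  \<open>det\<close> would vanish.\<close>

locale semi_invariant =
  fixes G :: "(complex^'n^'n \<Rightarrow> complex) \<Rightarrow> complex" and k :: nat
  assumes polyfun: "polyfun fun_scale Q_space G"
    and G_lin: "q \<in> Q_space \<Longrightarrow> G (\<lambda>X. q (lin M X)) = det M ^ k * G q"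
    and nonzero: "G det \<noteq> 0"
    and pos: "k > 0"
begin

definition D :: "(complex^'n^'n \<Rightarrow> complex) \<Rightarrow> (complex^'n^'n \<Rightarrow> complex) \<Rightarrow> complex" where
  "D = (SOME D. (\<forall>p\<in>Q_space. polyfun fun_scale Q_space (D p)) \<and>
    (\<forall>q\<in>Q_space. (\<lambda>p. D p q) \<in> linear_forms fun_scale Q_space) \<and>
    (\<forall>q\<in>Q_space. \<forall>p\<in>Q_space. ((\<lambda>s. G (\<lambda>X. q X + s * p X)) has_field_derivative D p q) (at 0)))"

lemma D_polyfun: "p \<in> Q_space \<Longrightarrow> polyfun fun_scale Q_space (D p)"
  and D_linear: "q \<in> Q_space \<Longrightarrow> (\<lambda>p. D p q) \<in> linear_forms fun_scale Q_space"
  and D_deriv: "q \<in> Q_space \<Longrightarrow> p \<in> Q_space \<Longrightarrow>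
    ((\<lambda>s. G (\<lambda>X. q X + s * p X)) has_field_derivative D p q) (at 0)"
  using someI_ex[OF polyfun_derivative[OF polyfun]] unfolding D_def[symmetric] by blast+

lemma D_unique:
  "q \<in> Q_space \<Longrightarrow> p \<in> Q_space \<Longrightarrow>
    ((\<lambda>s. G (\<lambda>X. q X + s * p X)) has_field_derivative c) (at 0) \<Longrightarrow> D p q = c"
  using D_deriv DERIV_unique by blast

lemma D_lin:
  assumes "q \<in> Q_space" "p \<in> Q_space"
  shows "D (\<lambda>X. p (lin M X)) (\<lambda>X. q (lin M X)) = det M ^ k * D p q"
proof (rule D_unique)
  have "G (\<lambda>X. q (lin M X) + s * p (lin M X)) = det M ^ k * G (\<lambda>X. q X + s * p X)" for s
    by (rule G_lin[OF Q_add[OF assms(1) Q_scale[OF assms(2)]]])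
  then show "((\<lambda>s. G (\<lambda>X. q (lin M X) + s * p (lin M X))) has_field_derivative det M ^ k * D p q) (at 0)"
    by (simp add: DERIV_cmult D_deriv assms)
qed (simp_all add: assms Q_lin)

text \<open>Scaling a form by \<open>c\<close> is substitution of the scalar matrix \<open>t\<close>
  with \<open>t^m = c\<close>, whose determinant on \<open>E\<close> is
  \<open>t^(m^2) = c^m\<close>.\<close>

lemma G_scale:
  assumes "c \<noteq> 0" "q \<in> Q_space"
  shows "G (\<lambda>X. c * q X) = c ^ (k * CARD('n)) * G q"
proof -
  define t where "t = exp (Ln c / of_nat CARD('n))"
  have t: "t ^ CARD('n) = c"
    unfolding t_def by (subst exp_of_nat_mult[symmetric]) (simp add: assms(1))
  have "(t ^ CARD('n \<times> 'n)) ^ k = c ^ (k * CARD('n))"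
    by (simp add: power_mult t) (simp add: mult.commute flip: power_mult)
  then show ?thesis
    using G_lin[OF assms(2), of "mat t"]
    by (simp only: lin_mat Q_mat_scale[OF assms(2)] det_mat_scalar t)
qed

text \<open>Euler's relation for \<open>G\<close>, which is homogeneous of degree \<open>k m\<close>
  along the line through \<open>det\<close>.\<close>

lemma D_det_det: "D det det \<noteq> 0"
proof -
  have "D det det = of_nat (k * CARD('n)) * G det"
  proof (rule D_unique[OF det_Q det_Q])
    have "((\<lambda>s :: complex. (1 + s) ^ (k * CARD('n)) * G det) has_field_derivative of_nat (k * CARD('n)) * G det) (at 0)"
      by (auto intro!: derivative_eq_intros)
    moreover have "eventually (\<lambda>s :: complex. G (\<lambda>X. det X + s * det X) = (1 + s) ^ (k * CARD('n)) * G det) (nhds 0)"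
    proof -
      have "eventually (\<lambda>s :: complex. s \<in> - {- 1}) (nhds 0)"
        by (rule eventually_nhds_in_open) auto
      then show ?thesis
      proof (rule eventually_mono)
        fix s :: complex assume "s \<in> - {- 1}"
        then have "1 + s \<noteq> 0" by (metis ComplD add_eq_0_iff singletonI)
        then show "G (\<lambda>X. det X + s * det X) = (1 + s) ^ (k * CARD('n)) * G det"
          using G_scale[OF _ det_Q, of "1 + s"] by (simp add: distrib_right)
      qed
    qed
    ultimately show "((\<lambda>s. G (\<lambda>X. det X + s * det X)) has_field_derivative of_nat (k * CARD('n)) * G det) (at 0)"
      by (subst DERIV_cong_ev[OF refl _ refl])
  qed
  then show ?thesis using pos nonzero by simp
qed

text \<open>The differential of \<open>G\<close> at \<open>det\<close> turns out to be a multiple of the determinant of the dual space.\<close>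

definition lam :: "(complex^'n^'n \<Rightarrow> complex) \<Rightarrow> complex" where
  "lam p = D p det"

lemma lam_linear: "lam \<in> linear_forms fun_scale Q_space"
  unfolding lam_def[abs_def] by (rule D_linear[OF det_Q])

text \<open>\<open>M\<close> preserves the line of the base point \<open>det\<close>. Rescaling by
  \<open>inverse a\<close> returns to \<open>det\<close> itself and cancels the factor
  \<open>det M ^ k = a ^ (k m)\<close>, so only the factor \<open>a\<close> on the direction is
  left.\<close>

lemma lam_mult:
  assumes A: "\<And>X. det (lin M X) = a * det X" "det M = a ^ CARD('n)" "a \<noteq> 0" and p: "p \<in> Q_space"
  shows "lam (\<lambda>X. p (lin M X)) = a * lam p"
proof -
  have "lam (\<lambda>X. p (lin M X)) = D (\<lambda>X. a * p X) det"
    unfolding lam_def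
  proof (rule D_unique[OF det_Q Q_lin[OF p]])
    have "G (\<lambda>X. det X + s * p (lin M X)) = G (\<lambda>X. det X + s * (a * p X))" for s
    proof -
      have Q: "(\<lambda>X. det X + s * (a * p X)) \<in> Q_space"
        by (intro Q_add Q_scale det_Q p)
      have "inverse a * (det (lin M X) + s * (a * p (lin M X))) = det X + s * p (lin M X)" for X
        using A(3) by (simp add: A(1) field_simps)
      then have "G (\<lambda>X. det X + s * p (lin M X)) = G (\<lambda>X. (\<lambda>X. inverse a * (det X + s * (a * p X))) (lin M X))"
        by (simp only:)
      also have "\<dots> = det M ^ k * G (\<lambda>X. inverse a * (det X + s * (a * p X)))"
        using Q by (intro G_lin Q_scale)
      also have "\<dots> = (a * inverse a) ^ (k * CARD('n)) * G (\<lambda>X. det X + s * (a * p X))"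
        using Q A(3) by (subst G_scale) (simp_all add: A(2) power_mult_distrib power_inverse mult_ac flip: power_mult)
      finally show ?thesis using A(3) by simp
    qed
    then show "((\<lambda>s. G (\<lambda>X. det X + s * p (lin M X))) has_field_derivative D (\<lambda>X. a * p X) det) (at 0)"
      using D_deriv[OF det_Q Q_scale[OF p]] by simp
  qed
  then show ?thesis
    by (simp add: lam_def Q_linear_scale[OF D_linear[OF det_Q] p])
qed

lemma lam_lmul: "det A \<noteq> 0 \<Longrightarrow> p \<in> Q_space \<Longrightarrow> lam (\<lambda>X. p (A ** X)) = det A * lam p"
  using lam_mult[of "lmul A" "det A" p] by (simp add: lin_lmul det_lmul det_mul)

lemma lam_rmul: "det B \<noteq> 0 \<Longrightarrow> p \<in> Q_space \<Longrightarrow> lam (\<lambda>X. p (X ** B)) = det B * lam p"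
  using lam_mult[of "rmul B" "det B" p] by (simp add: lin_rmul det_rmul det_mul mult.commute)

text \<open>For bijective \<open>u\<close> a permutation matrix rearranges the rows and contributes
  its sign, by \<open>lam_lmul\<close>.\<close>

lemma lam_monomial_rows: "lam (monomial (\<lambda>a. (u a, v a))) = eps u * lam (monomial (\<lambda>a. (a, v a)))"
proof (cases "bij u")
  case True
  let ?A = "\<chi> i. (mat 1 :: complex^'n^'n) $ u i"
  have det: "det ?A = eps u" using det_select_rows[of "mat 1" u] by simp
  have "monomial (\<lambda>a. (a, v a)) (?A ** X) = monomial (\<lambda>a. (u a, v a)) X" for X
    by (simp add: monomial_def ent_def matrix_matrix_mult_def mat_def if_distrib[of "\<lambda>x. x * _"] cong: if_cong)
  moreover have "eps u \<noteq> 0" using True by (simp add: eps_def)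
  ultimately show ?thesis
    using lam_lmul[of ?A, OF _ monomial_Q[of "\<lambda>a. (a, v a)"]] det by simp
next
  case False
  then have "\<not> surj u" by (simp add: bij_def finite_UNIV_inj_surj) (metis finite_UNIV_surj_inj finite_class.finite_UNIV)
  then obtain i0 where i0: "\<And>a. u a \<noteq> i0" by (auto simp: surj_def) metis
  \<comment> \<open>Doubling the row \<open>i0\<close>, which the monomial avoids, leaves the
    monomial unchanged but doubles its value under \<open>lam\<close>; hence that value is
    0.\<close>
  let ?A = "\<chi> i j. if i = j then (if i = i0 then 2 else 1) else 0 :: complex^'n^'n"
  have det: "det ?A = 2"
    by (subst det_diagonal) simp_all
  have "monomial (\<lambda>a. (u a, v a)) (?A ** X) = monomial (\<lambda>a. (u a, v a)) X" for X
    by (simp add: monomial_def ent_def matrix_matrix_mult_def i0 if_distrib[of "\<lambda>x. x * _"] cong: if_cong)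
  then have "lam (monomial (\<lambda>a. (u a, v a))) = 2 * lam (monomial (\<lambda>a. (u a, v a)))"
    using lam_lmul[of ?A, OF _ monomial_Q[of "\<lambda>a. (u a, v a)"]] det by simp
  then show ?thesis using False by (simp add: eps_def)
qed

lemma lam_monomial_columns: "lam (monomial (\<lambda>a. (u a, v a))) = eps v * lam (monomial (\<lambda>a. (u a, a)))"
proof (cases "bij v")
  case True
  let ?B = "transpose (\<chi> i. (mat 1 :: complex^'n^'n) $ v i)"
  have det: "det ?B = eps v" using det_select_rows[of "mat 1" v] by simp
  have "monomial (\<lambda>a. (u a, a)) (X ** ?B) = monomial (\<lambda>a. (u a, v a)) X" for X
    by (simp add: monomial_def ent_def matrix_matrix_mult_def mat_def transpose_def if_distrib[of "\<lambda>x. _ * x"] cong: if_cong)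
  moreover have "eps v \<noteq> 0" using True by (simp add: eps_def)
  ultimately show ?thesis
    using lam_rmul[of ?B, OF _ monomial_Q[of "\<lambda>a. (u a, a)"]] det by simp
next
  case False
  then have "\<not> surj v" by (simp add: bij_def finite_UNIV_inj_surj) (metis finite_UNIV_surj_inj finite_class.finite_UNIV)
  then obtain i0 where i0: "\<And>a. v a \<noteq> i0" by (auto simp: surj_def) metis
  let ?B = "\<chi> i j. if i = j then (if i = i0 then 2 else 1) else 0 :: complex^'n^'n"
  have det: "det ?B = 2"
    by (subst det_diagonal) simp_all
  have "monomial (\<lambda>a. (u a, v a)) (X ** ?B) = monomial (\<lambda>a. (u a, v a)) X" for X
    by (simp add: monomial_def ent_def matrix_matrix_mult_def i0 if_distrib[of "\<lambda>x. _ * x"] cong: if_cong)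
  then have "lam (monomial (\<lambda>a. (u a, v a))) = 2 * lam (monomial (\<lambda>a. (u a, v a)))"
    using lam_rmul[of ?B, OF _ monomial_Q[of "\<lambda>a. (u a, v a)"]] det by simp
  then show ?thesis using False by (simp add: eps_def)
qed

definition lam0 :: complex where "lam0 = lam (monomial (\<lambda>a. (a, a)))"

lemma lam_monomial: "lam (monomial j) = lam0 * detc j"
proof -
  have "lam (monomial (\<lambda>a. (fst (j a), snd (j a)))) = eps (\<lambda>a. fst (j a)) * (eps (\<lambda>a. snd (j a)) * lam0)"
    by (simp only: lam0_def lam_monomial_rows[of "\<lambda>a. fst (j a)"]
        lam_monomial_columns[of "\<lambda>a. a" "\<lambda>a. snd (j a)"])
  then show ?thesis by (simp add: detc_def mult_ac)
qed

lemma lam0_nonzero: "lam0 \<noteq> 0"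
proof
  assume "lam0 = 0"
  have "fact CARD('n) * lam det = lam (\<lambda>X. fact CARD('n) * det X)"
    by (simp add: Q_linear_scale[OF lam_linear det_Q])
  also have "\<dots> = (\<Sum>j\<in>UNIV. detc j * lam (monomial j))"
    by (simp add: det_monomial Q_linear_monomials[OF lam_linear])
  also have "\<dots> = 0" by (simp add: lam_monomial \<open>lam0 = 0\<close>)
  finally show False using D_det_det by (simp add: lam_def)
qed

text \<open>
  Scaling the line spanned by a matrix unit of trace \<open>1\<close> by \<open>t\<close> and fixing the matrices of trace \<open>0\<close>
  multiplies the form \<open>tr\<^sup>m\<close> by \<open>t\<^sup>m\<close>, while it has determinant \<open>t\<close>. As \<open>lam\<close> does not
  vanish on \<open>tr\<^sup>m\<close>, letting \<open>t\<close> tend to \<open>0\<close> bounds the weight from below.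
\<close>

lemma weight_ge: "CARD('n) \<le> k"
proof (rule ccontr)
  assume "\<not> CARD('n) \<le> k"
  then have "k < CARD('n)" by simp
  obtain a0 :: 'n where True by blast
  define M :: "complex \<Rightarrow> complex^('n \<times> 'n)^('n \<times> 'n)" where
    "M t = (\<chi> p q. of_bool (p = q) + (if p = (a0, a0) \<and> fst q = snd q then t - 1 else 0))" for t
  define p :: "complex^'n^'n \<Rightarrow> complex" where "p X = (\<Prod>a\<in>(UNIV :: 'n set). trace X)" for X
  have trace: "(\<lambda>X :: complex^'n^'n. trace X) \<in> linear_forms mat_scale UNIV"
    by (simp add: linear_forms_def trace_def mat_scale_def sum.distrib sum_distrib_left)
  have p: "p \<in> Q_space"
    unfolding p_def[abs_def] by (rule Q_prod[OF trace])
  have "p = (\<lambda>X. \<Sum>j\<in>UNIV. 1 * monomial (\<lambda>a. (j a, j a)) X)"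
    unfolding p_def[abs_def] trace_def prod_sum_UNIV by (simp add: monomial_def ent_def)
  then have "lam p = (\<Sum>j\<in>UNIV. 1 * lam (monomial (\<lambda>a. (j a, j a))))"
    by (simp only: Q_linear_sum[OF lam_linear monomial_Q])
  \<comment> \<open>Only monomials in diagonal entries occur, so both symbols agree and no signs can
    cancel.\<close>
  also have "\<dots> = lam0 * (\<Sum>j\<in>UNIV. eps j * eps (j :: 'n \<Rightarrow> 'n))"
    by (simp add: lam_monomial detc_def sum_distrib_left)
  finally have lam_p: "lam p \<noteq> 0"
    using lam0_nonzero by (simp add: sum_eps_square)
  have det_M: "det (M t) = t" for t
  proof -
    have "det (M t) = (\<Sum>q\<in>{id}. of_int (sign q) * (\<Prod>p\<in>UNIV. M t $ p $ q p))"
      unfolding det_def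
    proof (rule sum.mono_neutral_right)
      show "\<forall>q\<in>{q. q permutes UNIV} - {id}. of_int (sign q) * (\<Prod>p\<in>UNIV. M t $ p $ q p) = 0"
      proof
        fix q assume q: "q \<in> {q. q permutes (UNIV :: ('n \<times> 'n) set)} - {id}"
        have "\<exists>x. x \<noteq> (a0, a0) \<and> q x \<noteq> x"
        proof (rule ccontr)
          assume "\<not> ?thesis"
          then have id: "\<And>x. x \<in> UNIV - {(a0, a0)} \<Longrightarrow> q x = x" by blast
          have "q permutes UNIV" using q by blast
          from permutes_superset[OF this id] have "q permutes {(a0, a0)}" .
          then show False using q by simp
        qed
        then obtain x where x: "x \<noteq> (a0, a0)" "q x \<noteq> x" by blast
        then have "M t $ x $ q x = 0" by (simp add: M_def)
        then show "of_int (sign q) * (\<Prod>p\<in>UNIV. M t $ p $ q p) = 0"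
          by (metis (mono_tags) UNIV_I finite_class.finite_UNIV mult_zero_right prod_zero)
      qed
    qed (simp_all add: finite_permutations permutes_id)
    also have "\<dots> = (\<Prod>p\<in>UNIV. M t $ p $ p)" by simp
    also have "\<dots> = (\<Prod>p\<in>UNIV. if p = (a0, a0) then t else 1)"
      by (rule prod.cong) (auto simp: M_def)
    also have "\<dots> = t" by simp
    finally show ?thesis .
  qed
  have lin_M: "lin (M t) X = X + mat_scale ((t - 1) * trace X) (matrix_unit (a0, a0))" for t X
  proof (rule ent_eqI)
    fix r :: "'n \<times> 'n"
    have "(\<Sum>q\<in>UNIV. if fst q = snd q then ent X q else 0) = trace X"
    proof -
      have "(\<Sum>q\<in>UNIV. if fst q = snd q then ent X q else 0) = (\<Sum>i\<in>UNIV. \<Sum>j\<in>UNIV. if i = j then X $ i $ j else 0)"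
        by (simp only: sum.cartesian_product) (simp add: ent_def case_prod_beta cong: if_cong)
      then show ?thesis by (simp add: trace_def)
    qed
    moreover have "ent (lin (M t) X) r = ent X r +
        (if r = (a0, a0) then (t - 1) * (\<Sum>q\<in>UNIV. if fst q = snd q then ent X q else 0) else 0)"
      by (simp add: ent_lin M_def distrib_right sum.distrib sum_distrib_left if_distrib[of "\<lambda>x. x * _"]
          if_distrib[of "\<lambda>x. _ * x"] of_bool_def cong: if_cong)
    ultimately show "ent (lin (M t) X) r = ent (X + mat_scale ((t - 1) * trace X) (matrix_unit (a0, a0))) r"
      by (auto simp: ent_add ent_scale ent_matrix_unit)
  qed
  have "trace (matrix_unit (a0, a0) :: complex^'n^'n) = 1"
    by (simp add: trace_def matrix_unit_def)
  then have "trace (lin (M t) X) = t * trace X" for t X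
    by (simp add: lin_M linear_forms_add[OF trace] linear_forms_scale[OF trace] algebra_simps)
  then have "(\<lambda>X. p (lin (M t) X)) = (\<lambda>X. t ^ CARD('n) * p X)" for t
    by (simp add: fun_eq_iff p_def power_mult_distrib)
  then have *: "t ^ CARD('n) * D p (\<lambda>X. det (lin (M t) X)) = t ^ k * lam p" for t
    using D_lin[OF det_Q p, of "M t"]
    by (simp add: det_M lam_def Q_linear_scale[OF D_linear[OF Q_lin[OF det_Q]] p])
  \<comment> \<open>If \<open>k < m\<close>, cancelling \<open>t ^ k\<close> leaves a positive power
    of \<open>t\<close>. The other factor stays bounded near 0 because \<open>D p\<close> is
    polynomial, although the right side is a nonzero constant.\<close>
  have h: "t ^ (CARD('n) - k) * D p (\<lambda>X. det (lin (M t) X)) = lam p" if "t \<noteq> 0" for t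
  proof -
    have "t ^ k * (t ^ (CARD('n) - k) * D p (\<lambda>X. det (lin (M t) X))) = t ^ k * lam p"
      using * \<open>k < CARD('n)\<close> by (simp add: mult.assoc[symmetric] power_add[symmetric])
    then show ?thesis using that by simp
  qed
  have "continuous_on UNIV (\<lambda>t. D p (\<lambda>X. det (lin (M t) X)))"
  proof (rule continuous_on_polyfun[OF D_polyfun[OF p] det_Q])
    show "continuous_on UNIV (\<lambda>t. ent (M t) r)" for r
      by (cases "fst r = (a0, a0) \<and> fst (snd r) = snd (snd r)") (auto simp: ent_def M_def intro!: continuous_intros)
  qed
  then have "continuous_on UNIV (\<lambda>t. t ^ (CARD('n) - k) * D p (\<lambda>X. det (lin (M t) X)))"
    by (intro continuous_intros)
  from this[unfolded continuous_on_def, rule_format, of 0]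
  have "((\<lambda>t. t ^ (CARD('n) - k) * D p (\<lambda>X. det (lin (M t) X))) \<longlongrightarrow> 0) (at 0)"
    using \<open>k < CARD('n)\<close> by (simp add: power_0_left)
  moreover have "eventually (\<lambda>t. t ^ (CARD('n) - k) * D p (\<lambda>X. det (lin (M t) X)) = lam p) (at 0)"
    using eventually_neq_at_within[of "0 :: complex" 0 UNIV] by (rule eventually_mono) (rule h)
  ultimately have "((\<lambda>t :: complex. lam p) \<longlongrightarrow> 0) (at 0)"
    by (rule Lim_transform_eventually)
  then show False using lam_p by (simp add: tendsto_const_iff)
qed

text \<open>
  The differential operator with symbol \<open>D (monomial j) q\<close> is, up to a scalar, \<open>q\<^sup>*(\<partial>)\<close> for the dual
  form \<open>q\<^sup>*\<close> of \<open>q\<close>; applied \<open>m (m - 2)\<close> times to the Hessian determinant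
  \<open>\<kappa> (det g)\<^sup>2 q\<^sup>m\<^sup>(\<^sup>m\<^sup>-\<^sup>2\<^sup>)\<close> of \<open>q = det \<circ> g\<close>, it yields a semi-invariant of weight \<open>2\<close> modulo \<open>k\<close>.
\<close>

lemma weight_two_mod:
  assumes "CARD('n) \<ge> 2"
  obtains H c r where "polyfun fun_scale Q_space H" "c \<noteq> 0"
    "\<And>g. det g \<noteq> 0 \<Longrightarrow> H (\<lambda>X :: complex^'n^'n. det (lin g X)) = c * det g ^ (2 + k * r)"
proof -
  have "\<not> card (UNIV :: 'n set) \<le> Suc 0" using assms by simp
  then obtain a1 a2 :: 'n where a: "a1 \<noteq> a2"
    by (auto simp: card_le_Suc0_iff_eq)
  \<comment> \<open>The Hessian determinant has \<open>m^2\<close> rows with entries of degree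
    \<open>m - 2\<close>, hence degree \<open>m ?s\<close>: exactly \<open>?s\<close> operators of
    order \<open>m\<close> reduce it to a constant.\<close>
  let ?s = "CARD('n) * (CARD('n) - 2)"
  let ?\<kappa> = "hess_det a1 a2 det (mat 1 :: complex^'n^'n)"
  define H where "H q = contract ?s (\<lambda>j. D (monomial j) q) (hess_det a1 a2 q)" for q
  define C where "C = contract ?s detc (\<lambda>x :: complex^'n^'n. det x ^ ?s)"
  have C: "contract ?s (\<lambda>j. lam (monomial j)) (\<lambda>x :: complex^'n^'n. det x ^ ?s) = lam0 ^ ?s * C"
    by (simp only: lam_monomial contract_scale_left C_def)
  show ?thesis
  proof (rule that)
    show "polyfun fun_scale Q_space H"
      unfolding H_def[abs_def] contract_def hess_det_def hess_def polarize_def det_eps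
      by (simp, intro polyfun_sum polyfun_prod polyfun.mult polyfun.const D_polyfun monomial_Q polyfun.linear eval_linear)
    show "?\<kappa> * lam0 ^ ?s * C \<noteq> 0"
      using hess_det_nonzero[OF a] lam0_nonzero contract_det_power[of ?s, where 'i = 'n] by (simp only: C_def) simp
    fix g :: "complex^('n \<times> 'n)^('n \<times> 'n)" assume g: "det g \<noteq> 0"
    let ?q = "\<lambda>X. det (lin g X)"
    let ?h = "matrix_inv g"
    \<comment> \<open>Since \<open>monomial j\<close> is \<open>monomial j (lin ?h X)\<close> with
      \<open>lin g X\<close> put for \<open>X\<close>, the weight law moves the base point back to
      \<open>det\<close>.\<close>
    have D: "D (monomial j) ?q = det g ^ k * lam (\<lambda>X. monomial j (lin ?h X))" for j
      using D_lin[OF det_Q Q_lin[OF monomial_Q, of j ?h], of g] by (simp add: lin_matrix_inv[OF g] lam_def)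
    have hess: "hess_det a1 a2 ?q = (\<lambda>x. det g ^ 2 * ?\<kappa> * det (lin g x) ^ ?s)"
      by (rule ext) (simp only: hess_det_lin[OF det_Q a] hess_det_det[OF a assms, of "lin g _"] mult.assoc)
    have "(\<lambda>x :: complex^'n^'n. \<Prod>l<?s. det x) \<in> forms mat_scale UNIV (\<Sum>l<?s. CARD('n))"
      using det_Q by (intro forms_prod) (simp add: Q_space_forms)
    then have forms: "(\<lambda>x :: complex^'n^'n. det x ^ ?s) \<in> forms mat_scale UNIV (?s * CARD('n))"
      by simp
    \<comment> \<open>The substitutions \<open>g\<close> in the form and \<open>?h\<close> in the
      symbol cancel. What remains of \<open>g\<close> is the square from the Hessian and one factor
      \<open>det g ^ k\<close> for each of the \<open>?s\<close> operators.\<close>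
    have "H ?q = det g ^ 2 * ?\<kappa> * ((det g ^ k) ^ ?s * (lam0 ^ ?s * C))"
      by (simp only: H_def D hess contract_scale contract_scale_left C
          contract_lin[OF lam_linear lin_matrix_inv(1)[OF g] forms])
    also have "\<dots> = ?\<kappa> * lam0 ^ ?s * C * det g ^ (2 + k * ?s)"
      by (simp only: power_add power_mult mult_ac)
    finally show "H ?q = \<dots>" .
  qed
qed

end

section \<open>Invariants on the orbit\<close>

abbreviation det_lin :: "complex^('n \<times> 'n)^('n \<times> 'n) \<Rightarrow> complex^'n^'n \<Rightarrow> complex" where
  "det_lin M \<equiv> \<lambda>X. det (lin M X)"

lemma det_lin_Q: "det_lin M \<in> Q_space"
  by (rule Q_lin[OF det_Q])

lemma forms_scale_arg:
  fixes q :: "complex^'n^'n \<Rightarrow> complex"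
  assumes "F \<in> forms fun_scale Q_space d" "q \<in> Q_space"
  shows "F (\<lambda>X. c * q X) = c ^ d * F q"
proof -
  obtain N :: nat and b \<phi> where
    1: "\<forall>i<N. \<forall>j<d. \<phi> i j \<in> linear_forms fun_scale Q_space"
      "\<forall>q\<in>Q_space. F q = (\<Sum>i<N. b i * (\<Prod>j<d. \<phi> i j q))"
    using assms(1) unfolding forms_def by blast
  have "(\<Prod>j<d. \<phi> i j (\<lambda>X. c * q X)) = c ^ d * (\<Prod>j<d. \<phi> i j q)" if "i < N" for i
    using 1(1) that by (simp add: Q_linear_scale[OF _ assms(2)] prod.distrib)
  then show ?thesis
    using 1(2) assms(2) Q_scale[OF assms(2)] by (simp add: sum_distrib_left mult_ac)
qed

text \<open>Dividing \<open>M\<close> by an \<open>m^2\<close>-th root \<open>t\<close> of its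
  determinant reduces to determinant 1 and gives the value \<open>t ^ (m d) * F det\<close>.
  Independence of the chosen root forces \<open>m\<close> to divide \<open>d\<close>; singular
  \<open>M\<close> follow by continuity.\<close>

lemma invariant_on_orbit:
  fixes F :: "(complex^'n^'n \<Rightarrow> complex) \<Rightarrow> complex"
  assumes F: "F \<in> forms fun_scale Q_space d" and d: "d > 0"
    and inv: "\<And>M. det M = 1 \<Longrightarrow> F (det_lin M) = F det"
    and M0: "det M0 \<noteq> 0" "F (det_lin M0) \<noteq> 0"
  obtains k where "d = k * CARD('n)" "k > 0" "F det \<noteq> 0" "\<And>M. F (det_lin M) = F det * det M ^ k"
proof -
  let ?m = "CARD('n)" and ?n = "CARD('n \<times> 'n)"
  have root: "F (det_lin M) = t ^ (?m * d) * F det" if t: "t ^ ?n = det M" "t \<noteq> 0" for M t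
  proof -
    let ?N = "mat (inverse t) ** M"
    have "F (det_lin ?N) = F det"
      using t by (intro inv) (simp add: det_mul det_mat_scalar power_inverse flip: t(1))
    moreover have "det_lin M = (\<lambda>X. t ^ ?m * det_lin ?N X)"
      using t(2) by (simp add: fun_eq_iff lin_mult lin_mat Q_mat_scale[OF det_Q] power_inverse)
    ultimately show ?thesis
      by (simp add: forms_scale_arg[OF F det_lin_Q] power_mult)
  qed
  have ex_root: "\<exists>t. t ^ ?n = c \<and> t \<noteq> 0" if "c \<noteq> 0" for c :: complex
  proof (intro exI conjI)
    show "exp (Ln c / of_nat ?n) ^ ?n = c"
      using that by (subst exp_of_nat_mult[symmetric]) simp
  qed simp
  have F_det: "F det \<noteq> 0"
  proof -
    obtain t where "t ^ ?n = det M0" "t \<noteq> 0" using ex_root[OF M0(1)] by blast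
    from root[OF this] M0(2) show ?thesis by auto
  qed
  \<comment> \<open>A primitive \<open>m^2\<close>-th root of unity is another admissible root for
    the identity matrix, so its power \<open>m d\<close> must be 1.\<close>
  let ?\<zeta> = "exp (2 * of_real pi * \<i> * of_nat 1 / of_nat ?n)"
  have \<zeta>: "?\<zeta> ^ ?n = 1"
    by (subst exp_of_nat_mult[symmetric]) simp
  have "?\<zeta> ^ (?m * d) = 1"
    using root[of ?\<zeta> "mat 1"] \<zeta> F_det by simp
  then have "exp (2 * of_real pi * \<i> * of_nat (?m * d) / of_nat ?n) = 1"
    by (subst (asm) exp_of_nat_mult[symmetric]) (simp add: mult_ac)
  then have "?n dvd ?m * d"
    by (subst (asm) complex_root_unity_eq_1) (simp_all add: Suc_leI)
  then have "?m dvd d" by simp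
  then obtain k where k: "d = k * ?m" by (metis dvd_def mult.commute)
  show ?thesis
  proof (rule that[OF k _ F_det])
    show "k > 0" using d k by simp
    have nonsing: "F (det_lin M) = F det * det M ^ k" if M: "det M \<noteq> 0" for M
    proof -
      obtain t where t: "t ^ ?n = det M" "t \<noteq> 0" using ex_root[OF M] by blast
      have "t ^ (?m * d) = (t ^ ?n) ^ k"
        by (simp add: k mult_ac flip: power_mult)
      then show ?thesis using root[OF t] t(1) by simp
    qed
    show "F (det_lin M) = F det * det M ^ k" for M
    proof -
      have mat: "continuous_on UNIV (\<lambda>t :: complex. (mat t :: complex^('n \<times> 'n)^('n \<times> 'n)) $ p $ q)" for p q
        by (cases "p = q") (simp_all add: mat_def)
      have "continuous_on UNIV (\<lambda>t. F (det_lin (M + mat t)))"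
        by (rule continuous_on_forms[OF forms_Q_lin[OF F det_Q]])
          (simp add: ent_def continuous_on_add mat)
      from this[unfolded continuous_on_def, rule_format, of 0]
      have "((\<lambda>t. F (det_lin (M + mat t))) \<longlongrightarrow> F (det_lin M)) (at 0)" by simp
      moreover have "eventually (\<lambda>t. F (det_lin (M + mat t)) = F det * det (M + mat t) ^ k) (at 0)"
        by (intro eventually_mono[OF det_perturb_nonzero[of M]] nonsing)
      ultimately have 1: "((\<lambda>t. F det * det (M + mat t) ^ k) \<longlongrightarrow> F (det_lin M)) (at 0)"
        by (rule Lim_transform_eventually)
      have "continuous_on UNIV (\<lambda>t. det (M + mat t))"
        by (rule continuous_on_det) (simp add: continuous_on_add mat)
      from this[unfolded continuous_on_def, rule_format, of 0]
      have "((\<lambda>t. F det * det (M + mat t) ^ k) \<longlongrightarrow> F det * det M ^ k) (at 0)"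
        by (intro tendsto_intros) simp
      with 1 show ?thesis by (rule tendsto_unique[OF at_neq_bot])
    qed
  qed
qed

text \<open>Cayley's \<open>\<Omega>\<close>-process turns \<open>F\<close> into a semi-invariant on the whole space of forms.\<close>

lemma semi_invariant_omega:
  fixes F :: "(complex^'n^'n \<Rightarrow> complex) \<Rightarrow> complex"
  assumes F: "F \<in> forms fun_scale Q_space (k * CARD('n))" and k: "k > 0" and nonzero: "F det \<noteq> 0"
    and orbit: "\<And>M. F (det_lin M) = F det * det M ^ k"
  obtains G :: "(complex^'n^'n \<Rightarrow> complex) \<Rightarrow> complex" where "semi_invariant G k"
proof -
  obtain H where H: "polyfun fun_scale Q_space H" "\<And>q. q \<in> Q_space \<Longrightarrow> F q = H q"
    using forms_polyfun[OF F] by blast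
  \<comment> \<open>The operator acts in the variable \<open>M\<close>, on matrices indexed by
    \<open>'n \<times> 'n\<close>, while \<open>q\<close> is any form. Replacing \<open>q\<close> by
    its substitution with \<open>N\<close> replaces \<open>M\<close> by \<open>N ** M\<close>, which
    is the left multiplication that \<open>contract_detc_mult\<close> handles.\<close>
  define G where "G q = contract k detc (\<lambda>M. H (\<lambda>X. q (lin M X)))" for q
  have "semi_invariant G k"
  proof
    show "polyfun fun_scale Q_space G"
      unfolding G_def[abs_def] contract_def polarize_def
      by (intro polyfun_sum polyfun.mult polyfun.const polyfun_Q_lin H)
    show "G (\<lambda>X. q (lin M X)) = det M ^ k * G q" if q: "q \<in> Q_space" for q M
    proof -
      have "(\<lambda>M. H (\<lambda>X. q (lin M X))) \<in> forms mat_scale UNIV (k * CARD('n) * CARD('n))"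
        by (rule forms_cong[OF forms_Q_lin[OF F q]]) (rule H(2)[OF Q_lin[OF q]])
      then have "(\<lambda>M. H (\<lambda>X. q (lin M X))) \<in> forms mat_scale UNIV (k * CARD('n \<times> 'n))"
        by (simp add: mult.assoc)
      then show ?thesis
        unfolding G_def lin_mult[symmetric] by (rule contract_detc_mult)
    qed
    have "G det = F det * contract k detc (\<lambda>M :: complex^('n \<times> 'n)^('n \<times> 'n). det M ^ k)"
      unfolding G_def H(2)[OF det_lin_Q, symmetric] orbit by (rule contract_scale)
    then show "G det \<noteq> 0" using nonzero contract_det_power by simp
  qed (rule k)
  then show ?thesis by (rule that)
qed

section \<open>The coordinate ring of the orbit closure\<close>

text \<open>Passing to the Zariski closure adds no polynomial conditions, so identities in
  \<open>CX\<close> can be tested at the points \<open>det_lin M\<close>.\<close>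

lemma mem_IX_iff: "F \<in> IX \<longleftrightarrow> F \<in> polys fun_scale Q_space \<and> (\<forall>M. det M \<noteq> 0 \<longrightarrow> F (det_lin M) = 0)"
proof -
  have closure: "det_lin M \<in> det_orbit_closure" if "det M \<noteq> 0" for M
    using that det_lin_Q[of M] by (auto simp: det_orbit_closure_def zariski_closure_def vanishing_ideal_def det_orbit_lin)
  show ?thesis
  proof
    assume "F \<in> IX"
    then show "F \<in> polys fun_scale Q_space \<and> (\<forall>M. det M \<noteq> 0 \<longrightarrow> F (det_lin M) = 0)"
      using closure by (auto simp: vanishing_ideal_def)
  next
    assume "F \<in> polys fun_scale Q_space \<and> (\<forall>M. det M \<noteq> 0 \<longrightarrow> F (det_lin M) = 0)"
    then have "F \<in> vanishing_ideal fun_scale Q_space det_orbit" "F \<in> polys fun_scale Q_space"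
      by (auto simp: vanishing_ideal_def det_orbit_lin)
    moreover from this have "\<forall>q\<in>det_orbit_closure. F q = 0"
      by (auto simp: det_orbit_closure_def zariski_closure_def)
    ultimately show "F \<in> IX"
      by (simp add: vanishing_ideal_def)
  qed
qed

lemma IX_ideal: "ideal IX CQ"
  by (rule vanishing_ideal_ideal) (auto simp: det_orbit_closure_def zariski_closure_def)

lemma CX_cring: "cring CX"
  unfolding CX_def by (rule ideal.quotient_is_cring[OF IX_ideal poly_ring_cring])

lemma CX_carrier: "carrier CX = {IX +>\<^bsub>CQ\<^esub> F |F. F \<in> polys fun_scale Q_space}"
  unfolding CX_def FactRing_def A_RCOSETS_def' by (auto simp: poly_ring_simps(1))

lemma CX_mult:
  "F \<in> polys fun_scale Q_space \<Longrightarrow> G \<in> polys fun_scale Q_space \<Longrightarrow>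
    (IX +>\<^bsub>CQ\<^esub> F) \<otimes>\<^bsub>CX\<^esub> (IX +>\<^bsub>CQ\<^esub> G) = IX +>\<^bsub>CQ\<^esub> (restrict (\<lambda>q. F q * G q) Q_space)"
  using ideal.rcoset_mult_add[OF IX_ideal] by (simp add: CX_def FactRing_simps poly_ring_simps)

lemma CX_coset_eq_iff:
  assumes F: "F \<in> polys fun_scale Q_space" and G: "G \<in> polys fun_scale Q_space"
  shows "IX +>\<^bsub>CQ\<^esub> F = IX +>\<^bsub>CQ\<^esub> G \<longleftrightarrow> (\<forall>M. det M \<noteq> 0 \<longrightarrow> F (det_lin M) = G (det_lin M))"
proof -
  interpret cring CQ by (rule poly_ring_cring)
  have FG: "F \<in> carrier CQ" "G \<in> carrier CQ" using F G by (simp_all add: poly_ring_simps)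
  have "(F \<ominus>\<^bsub>CQ\<^esub> G) q = F q - G q" if "q \<in> Q_space" for q
  proof -
    have "(F \<ominus>\<^bsub>CQ\<^esub> G) \<oplus>\<^bsub>CQ\<^esub> G = F"
      using FG by (simp add: minus_eq a_assoc l_neg)
    then have "((F \<ominus>\<^bsub>CQ\<^esub> G) \<oplus>\<^bsub>CQ\<^esub> G) q = F q" by simp
    then show ?thesis using that by (simp add: poly_ring_simps eq_diff_eq)
  qed
  then have "F \<ominus>\<^bsub>CQ\<^esub> G \<in> IX \<longleftrightarrow> (\<forall>M. det M \<noteq> 0 \<longrightarrow> F (det_lin M) = G (det_lin M))"
    using minus_closed[OF FG] by (auto simp: mem_IX_iff poly_ring_simps det_lin_Q)
  then show ?thesis
    using quotient_eq_iff_same_a_r_cos[OF IX_ideal FG] by simp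
qed

lemma CX_pow:
  assumes "F \<in> polys fun_scale Q_space"
  shows "(IX +>\<^bsub>CQ\<^esub> F) [^]\<^bsub>CX\<^esub> (n::nat) = IX +>\<^bsub>CQ\<^esub> (restrict (\<lambda>q. F q ^ n) Q_space)"
    and polys_power: "restrict (\<lambda>q. F q ^ n) Q_space \<in> polys fun_scale Q_space"
proof (induction n)
  case 0
  {
    case 1
    interpret cring CX by (rule CX_cring)
    show ?case by (simp add: CX_def FactRing_def poly_ring_simps del: restrict_apply)
  next
    case 2
    show ?case by (simp add: forms_polys[OF forms_const] del: restrict_apply)
  }
next
  case (Suc n)
  {
    case 1
    interpret cring CX by (rule CX_cring)
    have "restrict (\<lambda>q. restrict (\<lambda>q. F q ^ n) Q_space q * F q) Q_space = restrict (\<lambda>q. F q ^ Suc n) Q_space"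
      by (rule restrict_ext) simp
    then show ?case
      using CX_mult[OF Suc(2) assms] Suc(1) by (simp del: restrict_apply power_Suc)
  next
    case 2
    show ?case
      using polys_mult[of F Q_space fun_scale "\<lambda>q. F q ^ n"] Suc(2) assms by (simp add: polys_ext del: restrict_apply)
  }
qed

text \<open>Invariance of the coset puts the translate of \<open>F\<close> back into it, so both
  agree modulo \<open>IX\<close>, in particular at \<open>det\<close>. The inverses in the actions
  on forms and on functions cancel, which leaves \<open>det_lin M\<close> as the point of
  evaluation.\<close>

lemma invariant_at_det:
  assumes F: "F \<in> polys fun_scale Q_space" and inv: "IX +>\<^bsub>CQ\<^esub> F \<in> CX_invariants" and M: "det M = 1"
  shows "F (det_lin M) = F det"
proof -
  interpret ideal IX CQ by (rule IX_ideal)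
  have g: "lin M \<in> SL_E"
    using M lin_GL_E[of M] by (simp add: SL_E_def det_E_matrix_of matrix_of_lin)
  then have bij: "bij (lin M)" by (simp add: SL_E_def GL_E_def)
  have "F \<in> IX +>\<^bsub>CQ\<^esub> F"
    using F by (intro a_rcos_self) (simp add: poly_ring_simps)
  then have "act_CQ (lin M) F \<in> IX +>\<^bsub>CQ\<^esub> F"
    using inv g unfolding CX_invariants_def by blast
  then obtain h where h: "h \<in> IX" "act_CQ (lin M) F = h \<oplus>\<^bsub>CQ\<^esub> F"
    by (auto simp: a_r_coset_def')
  have "act_CQ (lin M) F det = F (det_lin M)"
    by (simp add: act_CQ_def act_Q_def inv_inv_eq[OF bij] det_Q)
  moreover have "(h \<oplus>\<^bsub>CQ\<^esub> F) det = F det"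
    using h(1)[unfolded mem_IX_iff, THEN conjunct2, rule_format, of "mat 1"] by (simp add: poly_ring_simps det_Q)
  ultimately show ?thesis using h(2) by simp
qed

theorem corollary3p9:
  fixes f :: "((complex^'n^'n \<Rightarrow> complex) \<Rightarrow> complex) set"
    and d :: nat
  assumes "CARD('n) \<ge> 3"
    and "f \<in> CX_invariants"
    and "f \<noteq> \<zero>\<^bsub>CX\<^esub>"
    and "d > 0"
    and "f \<in> CX_homogeneous d"
  shows "\<not> radical_ideal CX (Idl\<^bsub>CX\<^esub> {f})"
proof
  assume radical: "radical_ideal CX (Idl\<^bsub>CX\<^esub> {f})"
  interpret CX: cring CX by (rule CX_cring)
  obtain F where f: "f = IX +>\<^bsub>CQ\<^esub> F" and "F \<in> homogeneous_polys fun_scale Q_space d"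
    using assms(5) unfolding CX_homogeneous_def by blast
  then have F: "F \<in> forms fun_scale Q_space d" "F \<in> polys fun_scale Q_space"
    using forms_polys[of F fun_scale Q_space d] by (auto simp: homogeneous_polys_iff extensional_restrict)
  have inv: "F (det_lin M) = F det" if "det M = 1" for M
    using invariant_at_det[OF F(2) _ that] assms(2) f by simp
  have "F \<notin> IX"
  proof
    assume "F \<in> IX"
    then have "f = IX +>\<^bsub>CQ\<^esub> \<zero>\<^bsub>CQ\<^esub>"
      unfolding f by (subst CX_coset_eq_iff)
        (use F(2) in \<open>auto simp: mem_IX_iff poly_ring_simps det_lin_Q forms_polys[OF forms_const] restrict_apply' simp del: restrict_apply\<close>)
    also have "\<dots> = \<zero>\<^bsub>CX\<^esub>"
      unfolding CX_def by (rule ring_hom_cring.hom_zero[OF ideal.rcos_ring_hom_cring[OF IX_ideal poly_ring_cring]])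
    finally show False using assms(3) by simp
  qed
  then obtain M0 where M0: "det M0 \<noteq> 0" "F (det_lin M0) \<noteq> 0"
    using F(2) by (auto simp: mem_IX_iff)
  obtain k where k: "d = k * CARD('n)" "k > 0" "F det \<noteq> 0"
    and orbit: "\<And>M. F (det_lin M) = F det * det M ^ k"
    using invariant_on_orbit[OF F(1) assms(4) inv M0] by blast
  obtain G where "semi_invariant (G :: (complex^'n^'n \<Rightarrow> complex) \<Rightarrow> complex) k"
    using semi_invariant_omega[OF F(1)[unfolded k(1)] k(2,3) orbit] by blast
  then interpret semi_invariant G k .
  have k3: "k \<ge> 3" using weight_ge assms(1) by simp
  \<comment> \<open>The residue excludes \<open>r = 0\<close>, and it survives subtraction of
    \<open>k\<close>, as needed for the descent below.\<close>
  define P where "P r \<longleftrightarrow> r mod k = 2 \<and> (\<exists>H\<in>polys fun_scale Q_space. \<exists>c\<noteq>0. \<forall>M. det M \<noteq> 0 \<longrightarrow>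
      H (\<lambda>X :: complex^'n^'n. det (lin M X)) = c * det M ^ r)" for r
  have "\<exists>r. P r"
  proof -
    have card: "CARD('n) \<ge> 2" using assms(1) by simp
    obtain H c r where H: "polyfun fun_scale Q_space H" "c \<noteq> 0"
      "\<And>g. det g \<noteq> 0 \<Longrightarrow> H (\<lambda>X :: complex^'n^'n. det (lin g X)) = c * det g ^ (2 + k * r)"
      by (rule weight_two_mod[OF card], rule that)
    have "P (2 + k * r)"
      unfolding P_def
    proof (intro conjI bexI[of _ "restrict H Q_space"] exI[of _ c])
      show "(2 + k * r) mod k = 2"
        using k3 by (simp only: mod_mult_self2) simp
    qed (use polyfun_polys[OF H(1)] H(2,3) det_lin_Q in \<open>auto simp del: power_add\<close>)
    then show ?thesis ..
  qed
  define r where "r = (LEAST r. P r)"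
  have "P r" unfolding r_def by (rule LeastI_ex) fact
  have minimal: "\<not> P r'" if "r' < r" for r'
    using that unfolding r_def by (rule not_less_Least)
  obtain H :: "(complex^'n^'n \<Rightarrow> complex) \<Rightarrow> complex" and c where
    H: "H \<in> polys fun_scale Q_space" "c \<noteq> 0"
    "\<And>M. det M \<noteq> 0 \<Longrightarrow> H (det_lin M) = c * det M ^ r" and r: "r mod k = 2"
    using \<open>P r\<close> unfolding P_def by blast
  have "r \<noteq> 0" using r by (metis mod_0 zero_neq_numeral)
  have f_carrier: "f \<in> carrier CX" using F(2) f by (auto simp: CX_carrier)
  have Idl: "Idl\<^bsub>CX\<^esub> {f} = {x \<otimes>\<^bsub>CX\<^esub> f |x. x \<in> carrier CX}"
    using CX.cgenideal_eq_genideal[OF f_carrier] by (simp add: cgenideal_def)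
  let ?h = "IX +>\<^bsub>CQ\<^esub> H"
  \<comment> \<open>The constant compares \<open>H^k = c^k D^(k r)\<close> with
    \<open>F^r = (F det)^r D^(k r)\<close> on the orbit; one factor \<open>F\<close> is split off,
    which is possible because \<open>r\<close> is positive.\<close>
  define W where "W = restrict (\<lambda>q. c ^ k / F det ^ r * F q ^ (r - 1)) Q_space"
  have W: "W \<in> polys fun_scale Q_space"
    unfolding W_def by (intro polys_mult forms_polys[OF forms_const] polys_power F(2))
  have "?h [^]\<^bsub>CX\<^esub> k = (IX +>\<^bsub>CQ\<^esub> W) \<otimes>\<^bsub>CX\<^esub> f"
  proof -
    have "W (det_lin M) * F (det_lin M) = H (det_lin M) ^ k" if "det M \<noteq> 0" for M
    proof -
      have "W (det_lin M) * F (det_lin M) = c ^ k / F det ^ r * F (det_lin M) ^ r"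
        using \<open>r \<noteq> 0\<close> power_minus_mult[of r "F (det_lin M)"] by (simp add: W_def det_lin_Q mult.assoc)
      also have "\<dots> = c ^ k * (det M ^ k) ^ r"
        using k(3) by (simp add: orbit power_mult_distrib)
      also have "\<dots> = H (det_lin M) ^ k"
        unfolding H(3)[OF that] power_mult_distrib power_mult[symmetric] mult.commute[of k r] ..
      finally show ?thesis .
    qed
    then show ?thesis
      unfolding f CX_pow[OF H(1)] CX_mult[OF W F(2)]
      by (subst CX_coset_eq_iff) (auto simp: polys_power[OF H(1)] polys_closed W F(2) det_lin_Q restrict_apply' simp del: restrict_apply intro: sym)
  qed
  moreover have "IX +>\<^bsub>CQ\<^esub> W \<in> carrier CX" using W by (auto simp: CX_carrier)
  ultimately have "?h \<in> ideal_radical CX (Idl\<^bsub>CX\<^esub> {f})"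
    using H(1) k(2) unfolding ideal_radical_def Idl by (auto simp: CX_carrier)
  then have "?h \<in> Idl\<^bsub>CX\<^esub> {f}"
    using radical by (simp add: radical_ideal_def)
  then obtain U where U: "U \<in> polys fun_scale Q_space" "?h = (IX +>\<^bsub>CQ\<^esub> U) \<otimes>\<^bsub>CX\<^esub> f"
    unfolding Idl by (auto simp: CX_carrier)
  have UF: "c * det M ^ r = U (det_lin M) * (F det * det M ^ k)" if "det M \<noteq> 0" for M
  proof -
    have "H (det_lin M) = restrict (\<lambda>q. U q * F q) Q_space (det_lin M)"
      using U(2) that unfolding f CX_mult[OF U(1) F(2)]
      by (subst (asm) CX_coset_eq_iff) (use H(1) U(1) F(2) in \<open>auto simp: polys_closed restrict_apply' simp del: restrict_apply\<close>)
    then show ?thesis using H(3)[OF that] by (simp add: det_lin_Q orbit)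
  qed
  show False
  proof (cases "k \<le> r")
    case True
    \<comment> \<open>Dividing by \<open>F\<close> produces a polynomial realizing the exponent
      \<open>r - k\<close>, with the same residue.\<close>
    have "U (det_lin M) = c / F det * det M ^ (r - k)" if "det M \<noteq> 0" for M
    proof -
      have "det M ^ r = det M ^ (r - k) * det M ^ k"
        using True by (simp flip: power_add)
      then show ?thesis
        using UF[OF that] that k(3) by (simp add: field_simps)
    qed
    moreover have "(r - k) mod k = 2" using True r by (simp add: le_mod_geq)
    ultimately have "P (r - k)"
      unfolding P_def using U(1) H(2) k(3) by (intro conjI bexI[of _ U] exI[of _ "c / F det"]) auto
    then show False using minimal[of "r - k"] True k(2) by simp
  next
    case False
    obtain V where V: "polyfun fun_scale Q_space V" "U = restrict V Q_space"
      using U(1) by (rule polys_polyfun)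
    let ?n = "CARD('n \<times> 'n)"
    \<comment> \<open>On scalar matrices \<open>t\<close> the determinant is \<open>t ^ ?n\<close>.
      With \<open>r < k\<close>, the polynomial \<open>V\<close> would need a pole at
      \<open>t = 0\<close>.\<close>
    have eq: "V (det_lin (mat t)) * F det * t ^ (?n * (k - r)) = c" if "t \<noteq> 0" for t
    proof -
      have "(t ^ ?n) ^ k = (t ^ ?n) ^ r * t ^ (?n * (k - r))"
        using False by (simp flip: power_mult power_add distrib_left)
      then have "(t ^ ?n) ^ r * c = (t ^ ?n) ^ r * (V (det_lin (mat t)) * F det * t ^ (?n * (k - r)))"
        using UF[of "mat t"] that by (simp add: det_mat_scalar V(2) det_lin_Q mult_ac)
      then show ?thesis using that by simp
    qed
    have "continuous_on UNIV (\<lambda>t. V (det_lin (mat t)))"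
    proof (rule continuous_on_polyfun[OF V(1) det_Q])
      show "continuous_on UNIV (\<lambda>t :: complex. ent (mat t) p)" for p
        by (cases "fst p = snd p") (simp_all add: ent_def mat_def)
    qed
    then have "continuous_on UNIV (\<lambda>t. V (det_lin (mat t)) * F det * t ^ (?n * (k - r)))"
      by (intro continuous_intros)
    from this[unfolded continuous_on_def, rule_format, of 0]
    have "((\<lambda>t. V (det_lin (mat t)) * F det * t ^ (?n * (k - r))) \<longlongrightarrow> 0) (at 0)"
      using False by (simp add: power_0_left)
    moreover have "eventually (\<lambda>t. V (det_lin (mat t)) * F det * t ^ (?n * (k - r)) = c) (at 0)"
      using eventually_neq_at_within[of "0 :: complex" 0 UNIV] by (rule eventually_mono) (rule eq)
    ultimately have "((\<lambda>t :: complex. c) \<longlongrightarrow> 0) (at 0)"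
      by (rule Lim_transform_eventually)
    then show False using H(2) by (simp add: tendsto_const_iff)
  qed
qed

end
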